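(* Let the memory size $H\ge1$ be an integer with $H \ge \frac{\log(2\kappa^2)}{\log((1-\gamma)^{-1})}$, let $\eta>0$ be the stepsize, let $\epsilon\ge0$, and define $$\epsilon_1(H) := c_1 H (1-\gamma)^H,\qquad \epsilon_2(\eta,H) := c_2 \sqrt{mn^3}\,\eta H^2,\qquad \epsilon_3(H) := c_3 \sqrt{n}\,(1-\gamma)^H,$$ where $c_1 = \overline{w}\kappa^3(2\kappa^3 + 2a\kappa^3 \kappa_B + a)/\gamma$, $c_2 = 4 G \overline{w}^3 (\kappa^3 + 2a\kappa^3 \kappa_B)(1+\kappa)\kappa^5\kappa_B^2/\gamma^4$ and $c_3 = 2\overline{w}\kappa^5$. Suppose $$\epsilon_1(H) + \epsilon_2(\eta,H) \le \epsilon \le \epsilon_* - \epsilon_1(H) - \epsilon_3(H)\qquad\text{and}\qquad \epsilon < \frac{\epsilon_*}{2} - \epsilon_1(H) - \epsilon_3(H).$$ Then the regret of OGD-BZC (with inputs $K,H,\epsilon,\eta$) satisfies $$\mathrm{Reg}_T(\text{OGD-BZC}) \le \mathcal O\Big( T \sqrt{m^2 n^3}\, H^2 (1-\gamma)^H + Tmn^2H^3\eta + \frac{m}{\eta} + \frac{T(1-\gamma)^H \sqrt{m^2n^3H^5}}{\epsilon_*} + \frac{\epsilon\, T\sqrt{m^2n^2H^3}}{\epsilon_*}\Big),$$ where the constant hidden in $\mathcal O(\cdot)$ is a polynomial in $\overline w, G,\kappa,\kappa_B,a,\gamma^{-1}$.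
   Context: System. $x_{t+1}=Ax_t+Bu_t+w_t$, $t\ge 0$, $x_0=0$, with $x_t\in\mathbb R^n$, $u_t\in\mathbb R^m$, known matrices $A\in\mathbb R^{n\times n}$, $B\in\mathbb R^{n\times m}$, and disturbances $w_t\in\mathcal W:=\{w\in\mathbb R^n:\|w\|_\infty\le\overline w\}$ with $\overline w$ known; $w_t:=0$ for $t<0$. $\mathcal X\subseteq\mathbb R^n$ and $\mathcal U\subseteq\mathbb R^m$ are closed convex sets containing the origin. $T$ is the horizon. Costs. $c_t:\mathbb R^n\times\mathbb R^m\to\mathbb R$ ($0\le t\le T$) are arbitrary functions, each convex and differentiable, revealed after $u_t$ is applied; there is a constant $G$ such that whenever $\|x\|_2\le D$ and $\|u\|_2\le D$, the quantities $|c_t(x,u)|$, $\|\nabla_x c_t(x,u)\|_2$, $\|\nabla_u c_t(x,u)\|_2$ are all at most $GD$. Strong stability. For $\kappa>1$, $\gamma\in(0,1]$, a matrix $K\in\mathbb R^{m\times n}$ (controller $u_t=-Kx_t$) is $(\kappa,\gamma)$-strongly stable if there are matrices $L,P$ with $A-BK=PLP^{-1}$, $\|L\|_2\le 1-\gamma$ and $\max\{\|K\|_2,\|P\|_2,\|P^{-1}\|_2\}\le\kappa$. Put $\kappa_B:=\max\{\|B\|_2,1\}$ and $a:=2\kappa^3$. (If $\gamma=1$, the condition on $H$ is read as $H\ge 1$, and $0^0=1$.) Shrinkage/expansion (in $\|\cdot\|_\infty$). For $\Delta>0$ and $\mathcal D\subseteq\mathbb R^d$, $\bar{\mathcal B}(\Delta)$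 is the closed $\ell_\infty$ ball of radius $\Delta$ centred at $0$, $\mathcal D_\Delta:=\{x\in\mathcal D: x+y\in\mathcal D\ \forall y\in\bar{\mathcal B}(\Delta)\}$, $\mathcal D_{-\Delta}:=\{x+y:x\in\mathcal D,y\in\bar{\mathcal B}(\Delta)\}$, $\mathcal D_0:=\mathcal D$. Standing assumption. There exist $\epsilon_*>0$ and a $(\kappa,\gamma)$-strongly stable $K_{ss}\in\mathbb R^{m\times n}$ such that, under $u_t=-K_{ss}x_t$, one has $x_t\in\mathcal X_{\epsilon_*}$ and $u_t\in\mathcal U_{\epsilon_*}$ for all $t\ge0$ and every disturbance sequence in $\mathcal W$. Regret. $\mathcal K$ is the set of $(\kappa,\gamma)$-strongly stable $K'\in\mathbb R^{m\times n}$ such that the trajectory $(x_t^{K'},u_t^{K'})$ generated by $u_t=-K'x_t$ satisfies $x_t^{K'}\in\mathcal X$, $u_t^{K'}\in\mathcal U$ for all $0\le t\le T$ and all disturbance sequences in $\mathcal W$. For an algorithm $\mathcal A$ with trajectory $(x_t^{\mathcal A},u_t^{\mathcal A})$, $$\mathrm{Reg}_T(\mathcal A)=\max_{\{w_k\in\mathcal W\}}\Big(\sum_{t=0}^Tc_t(x_t^{\mathcal A},u_t^{\mathcal A})-\min_{K'\in\mathcal K}\sum_{t=0}^Tc_t(x_t^{K'},u_t^{K'})\Big).$$ Policies. Fix a $(\kappa,\gamma)$-strongly stable matrix $K$ and put $A_K:=A-BK$. Let $\mathcal M:=\{M=(M^{[1]},\dots,M^{[H]}): M^{[i]}\in\mathbb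 R^{m\times n},\ \|M^{[i]}\|_2\le a(1-\gamma)^{i-1}\ \forall i\}$. For $M\in\mathcal M$ and $1\le k\le 2H$ let $$\mathring\Psi^x_k(M)=A_K^{k-1}\mathbf 1_{(k\le H)}+\sum_{i=1}^H A_K^{i-1}BM^{[k-i]}\mathbf 1_{(1\le k-i\le H)},\qquad \mathring\Psi^u_k(M)=M^{[k]}\mathbf 1_{(k\le H)}-K\mathring\Psi^x_k(M),$$ $\mathring h^x(M)=[\mathring\Psi^x_1\ \cdots\ \mathring\Psi^x_{2H}]$, $\mathring h^u(M)=[\mathring\Psi^u_1\ \cdots\ \mathring\Psi^u_{2H}]$. Let $$\Omega^\epsilon:=\{M\in\mathcal M:\ \mathring h^x(M)\,\bar{\mathcal B}(\overline w)\subseteq\mathcal X_\epsilon,\ \ \mathring h^u(M)\,\bar{\mathcal B}(\overline w)\subseteq\mathcal U_\epsilon\},$$ where $\bar{\mathcal B}(\overline w)\subset\mathbb R^{2Hn}$ is the closed $\ell_\infty$ ball and $N\,S$ denotes the image of the set $S$ under the matrix $N$. Approximate cost. $\mathring f_t(M):=c_t\big(\sum_{k=1}^{2H}\mathring\Psi^x_k(M)w_{t-k},\ \sum_{k=1}^{2H}\mathring\Psi^u_k(M)w_{t-k}\big)$, where $w_s$ are the realized disturbances. Algorithm OGD-BZC (inputs $K,H,\epsilon,\eta$). Choose any $M_0\in\Omega^\epsilon$. For $t=0,1,\dots,T$: apply $u_t=-Kx_t+\sum_{i=1}^H M_t^{[i]}w_{t-i}$; observe $x_{t+1}$ and compute $w_t$;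 set $M_{t+1}=\Pi_{\Omega^\epsilon}[M_t-\eta\nabla\mathring f_t(M_t)]$, where $\Pi_{\Omega^\epsilon}$ is Euclidean (Frobenius-norm) projection onto $\Omega^\epsilon$. *)

theory Defs
  imports "HOL-Analysis.Analysis"
begin

section \<open>Finitely supported families as an inner product space\<close>

text \<open>
  The constant hidden in the regret bound does not depend on the dimensions, so the dimensions
  have to be quantified inside the statement and cannot be types.  Vectors are therefore
  finitely supported families of reals; the space of dimension \<open>d\<close> is the subspace
  of the families that vanish at all indices \<open>\<ge> d\<close>.  On that subspace, the inner product,
  norm and topology below are the Euclidean ones, and the library notions
  (\<^const>\<open>norm\<close>, \<^const>\<open>closed\<close>, \<^const>\<open>convex\<close>, \<^const>\<open>convex_on\<close>, \<^const>\<open>onorm\<close>,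
  \<^const>\<open>has_derivative\<close> within the subspace) have their usual meaning.
  Nesting the construction gives the Frobenius inner product on matrices and on tuples of matrices.
\<close>

typedef (overloaded) ('i, 'a::real_inner) fsfam = "{f :: 'i \<Rightarrow> 'a. finite {i. f i \<noteq> 0}}"
  morphisms entry Fsfam
  by (rule exI[of _ "\<lambda>_. 0"]) simp

setup_lifting type_definition_fsfam

lemma finite_support [simp]: "finite {i. entry x i \<noteq> 0}"
  using entry by auto

lemma fsfam_eqI: "(\<And>i. entry x i = entry y i) \<Longrightarrow> x = y"
  by (metis entry_inject ext)

instantiation fsfam :: (type, real_inner) real_vector
begin

lift_definition zero_fsfam :: "('a, 'b) fsfam" is "\<lambda>_. 0" by simp

lift_definition plus_fsfam :: "('a, 'b) fsfam \<Rightarrow> ('a, 'b) fsfam \<Rightarrow> ('a, 'b) fsfam"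
  is "\<lambda>f g i. f i + g i"
proof -
  fix f g :: "'a \<Rightarrow> 'b"
  assume "finite {i. f i \<noteq> 0}" "finite {i. g i \<noteq> 0}"
  then have "finite ({i. f i \<noteq> 0} \<union> {i. g i \<noteq> 0})" by (rule finite_UnI)
  moreover have "{i. f i + g i \<noteq> 0} \<subseteq> {i. f i \<noteq> 0} \<union> {i. g i \<noteq> 0}" by auto
  ultimately show "finite {i. f i + g i \<noteq> 0}" by (rule rev_finite_subset)
qed

lift_definition uminus_fsfam :: "('a, 'b) fsfam \<Rightarrow> ('a, 'b) fsfam" is "\<lambda>f i. - f i"
  by simp

lift_definition minus_fsfam :: "('a, 'b) fsfam \<Rightarrow> ('a, 'b) fsfam \<Rightarrow> ('a, 'b) fsfam"
  is "\<lambda>f g i. f i - g i"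
proof -
  fix f g :: "'a \<Rightarrow> 'b"
  assume "finite {i. f i \<noteq> 0}" "finite {i. g i \<noteq> 0}"
  then have "finite ({i. f i \<noteq> 0} \<union> {i. g i \<noteq> 0})" by (rule finite_UnI)
  moreover have "{i. f i - g i \<noteq> 0} \<subseteq> {i. f i \<noteq> 0} \<union> {i. g i \<noteq> 0}" by auto
  ultimately show "finite {i. f i - g i \<noteq> 0}" by (rule rev_finite_subset)
qed

lift_definition scaleR_fsfam :: "real \<Rightarrow> ('a, 'b) fsfam \<Rightarrow> ('a, 'b) fsfam"
  is "\<lambda>r f i. r *\<^sub>R f i"
  by (erule rev_finite_subset) auto

lemmas entry_rep_eq =
  zero_fsfam.rep_eq plus_fsfam.rep_eq uminus_fsfam.rep_eq minus_fsfam.rep_eq scaleR_fsfam.rep_eq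

instance
proof
  fix x y z :: "('a, 'b) fsfam" and r s :: real
  show "x + y + z = x + (y + z)" "x + y = y + x" "0 + x = x" "- x + x = 0" "x - y = x + - y"
    "r *\<^sub>R (x + y) = r *\<^sub>R x + r *\<^sub>R y" "(r + s) *\<^sub>R x = r *\<^sub>R x + s *\<^sub>R x"
    "r *\<^sub>R s *\<^sub>R x = (r * s) *\<^sub>R x" "1 *\<^sub>R x = x"
    by (rule fsfam_eqI; simp add: entry_rep_eq algebra_simps)+
qed

end

declare entry_rep_eq [simp]

instantiation fsfam :: (type, real_inner) real_inner
begin

definition inner_fsfam :: "('a, 'b) fsfam \<Rightarrow> ('a, 'b) fsfam \<Rightarrow> real" where
  "inner_fsfam x y = (\<Sum>i | entry x i \<noteq> 0. entry x i \<bullet> entry y i)"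

definition norm_fsfam :: "('a, 'b) fsfam \<Rightarrow> real" where
  "norm_fsfam x = sqrt (x \<bullet> x)"

definition dist_fsfam :: "('a, 'b) fsfam \<Rightarrow> ('a, 'b) fsfam \<Rightarrow> real" where
  "dist_fsfam x y = norm (x - y)"

definition sgn_fsfam :: "('a, 'b) fsfam \<Rightarrow> ('a, 'b) fsfam" where
  "sgn_fsfam x = x /\<^sub>R norm x"

definition uniformity_fsfam :: "(('a, 'b) fsfam \<times> ('a, 'b) fsfam) filter" where
  "uniformity_fsfam = (INF e\<in>{0<..}. principal {(x, y). dist x y < e})"

definition open_fsfam :: "('a, 'b) fsfam set \<Rightarrow> bool" where
  "open_fsfam U \<longleftrightarrow> (\<forall>x\<in>U. \<forall>\<^sub>F (x', y) in uniformity. x' = x \<longrightarrow> y \<in> U)"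

lemma inner_fsfam_superset:
  fixes x y :: "('a, 'b) fsfam"
  assumes "finite S" "\<And>i. i \<notin> S \<Longrightarrow> entry x i = 0 \<or> entry y i = 0"
  shows "x \<bullet> y = (\<Sum>i\<in>S. entry x i \<bullet> entry y i)"
proof -
  have "(\<Sum>i | entry x i \<noteq> 0. entry x i \<bullet> entry y i)
      = (\<Sum>i\<in>S \<union> {i. entry x i \<noteq> 0}. entry x i \<bullet> entry y i)"
    using assms(1) by (intro sum.mono_neutral_left) auto
  also have "\<dots> = (\<Sum>i\<in>S. entry x i \<bullet> entry y i)"
    using assms by (intro sum.mono_neutral_right) (auto, metis inner_zero_left inner_zero_right)
  finally show ?thesis by (simp add: inner_fsfam_def)
qed

instance
proof
  fix x y z :: "('a, 'b) fsfam" and r :: real and U :: "('a, 'b) fsfam set"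
  show "x \<bullet> y = y \<bullet> x"
    using inner_fsfam_superset[of "{i. entry x i \<noteq> 0}" x y]
      inner_fsfam_superset[of "{i. entry x i \<noteq> 0}" y x]
    by (simp add: inner_commute)
  let ?S = "{i. entry x i \<noteq> 0} \<union> {i. entry y i \<noteq> 0}"
  have "(x + y) \<bullet> z = (\<Sum>i\<in>?S. entry (x + y) i \<bullet> entry z i)"
    by (rule inner_fsfam_superset) auto
  moreover have "x \<bullet> z = (\<Sum>i\<in>?S. entry x i \<bullet> entry z i)"
    by (rule inner_fsfam_superset) auto
  moreover have "y \<bullet> z = (\<Sum>i\<in>?S. entry y i \<bullet> entry z i)"
    by (rule inner_fsfam_superset) auto
  ultimately show "(x + y) \<bullet> z = x \<bullet> z + y \<bullet> z"
    by (simp add: inner_add_left sum.distrib)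
  have "(r *\<^sub>R x) \<bullet> y = (\<Sum>i | entry x i \<noteq> 0. entry (r *\<^sub>R x) i \<bullet> entry y i)"
    by (rule inner_fsfam_superset) auto
  then show "(r *\<^sub>R x) \<bullet> y = r * (x \<bullet> y)"
    by (simp add: inner_fsfam_def sum_distrib_left)
  show "0 \<le> x \<bullet> x"
    by (simp add: inner_fsfam_def sum_nonneg)
  show "x \<bullet> x = 0 \<longleftrightarrow> x = 0"
  proof
    assume "x \<bullet> x = 0"
    then have "\<forall>i\<in>{i. entry x i \<noteq> 0}. entry x i \<bullet> entry x i = 0"
      unfolding inner_fsfam_def by (subst (asm) sum_nonneg_eq_0_iff) auto
    then have "entry x i = 0" for i by auto
    then show "x = 0" by (intro fsfam_eqI) simp
  qed (simp add: inner_fsfam_def)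
qed (simp_all add: norm_fsfam_def dist_fsfam_def sgn_fsfam_def uniformity_fsfam_def open_fsfam_def)

end

section \<open>Vectors and matrices\<close>

text \<open>Entries are indexed from 0; the blocks of a policy are indexed from 1.\<close>

type_synonym rvec = "(nat, real) fsfam"
type_synonym rmat = "(nat \<times> nat, real) fsfam"
type_synonym policy = "(nat, rmat) fsfam"

definition Rvec :: "nat \<Rightarrow> rvec set" where
  "Rvec n = {x. \<forall>i. entry x i \<noteq> 0 \<longrightarrow> i < n}"

definition Rmat :: "nat \<Rightarrow> nat \<Rightarrow> rmat set" where
  "Rmat m n = {A. \<forall>i j. entry A (i, j) \<noteq> 0 \<longrightarrow> i < m \<and> j < n}"

definition policy_space :: "nat \<Rightarrow> nat \<Rightarrow> nat \<Rightarrow> policy set" where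
  "policy_space H m n = {M. (\<forall>i. entry M i \<in> Rmat m n) \<and> (\<forall>i. entry M i \<noteq> 0 \<longrightarrow> 1 \<le> i \<and> i \<le> H)}"

lift_definition mat_vec :: "rmat \<Rightarrow> rvec \<Rightarrow> rvec"
  is "\<lambda>A x i. \<Sum>j | x j \<noteq> 0. A (i, j) * x j"
proof -
  fix A :: "nat \<times> nat \<Rightarrow> real" and x :: "nat \<Rightarrow> real"
  assume "finite {p. A p \<noteq> 0}"
  then have "finite (fst ` {p. A p \<noteq> 0})" by simp
  moreover have "{i. (\<Sum>j | x j \<noteq> 0. A (i, j) * x j) \<noteq> 0} \<subseteq> fst ` {p. A p \<noteq> 0}"
  proof clarify
    fix i assume "(\<Sum>j | x j \<noteq> 0. A (i, j) * x j) \<noteq> 0"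
    then obtain j where "A (i, j) * x j \<noteq> 0"
      by (rule sum.not_neutral_contains_not_neutral)
    then have "(i, j) \<in> {p. A p \<noteq> 0}" by auto
    then show "i \<in> fst ` {p. A p \<noteq> 0}" by (intro image_eqI) auto
  qed
  ultimately show "finite {i. (\<Sum>j | x j \<noteq> 0. A (i, j) * x j) \<noteq> 0}"
    by (rule rev_finite_subset)
qed

lift_definition mat_mult :: "rmat \<Rightarrow> rmat \<Rightarrow> rmat"
  is "\<lambda>A B (i, l). \<Sum>j | B (j, l) \<noteq> 0. A (i, j) * B (j, l)"
proof -
  fix A B :: "nat \<times> nat \<Rightarrow> real"
  assume "finite {p. A p \<noteq> 0}" "finite {p. B p \<noteq> 0}"
  then have "finite (fst ` {p. A p \<noteq> 0} \<times> snd ` {p. B p \<noteq> 0})" by simp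
  moreover have "{p. (case p of (i, l) \<Rightarrow> \<Sum>j | B (j, l) \<noteq> 0. A (i, j) * B (j, l)) \<noteq> 0}
      \<subseteq> fst ` {p. A p \<noteq> 0} \<times> snd ` {p. B p \<noteq> 0}"
  proof
    fix p assume "p \<in> {p. (case p of (i, l) \<Rightarrow> \<Sum>j | B (j, l) \<noteq> 0. A (i, j) * B (j, l)) \<noteq> 0}"
    moreover obtain i l where p: "p = (i, l)" by (cases p)
    ultimately have "(\<Sum>j | B (j, l) \<noteq> 0. A (i, j) * B (j, l)) \<noteq> 0" by simp
    then obtain j where "A (i, j) * B (j, l) \<noteq> 0"
      by (rule sum.not_neutral_contains_not_neutral)
    then have "(i, j) \<in> {p. A p \<noteq> 0}" "(j, l) \<in> {p. B p \<noteq> 0}" by auto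
    then show "p \<in> fst ` {p. A p \<noteq> 0} \<times> snd ` {p. B p \<noteq> 0}"
      unfolding p by (intro SigmaI image_eqI) auto
  qed
  ultimately show "finite {p. (case p of (i, l) \<Rightarrow> \<Sum>j | B (j, l) \<noteq> 0. A (i, j) * B (j, l)) \<noteq> 0}"
    by (rule rev_finite_subset)
qed

lift_definition id_mat :: "nat \<Rightarrow> rmat" is "\<lambda>n (i, j). if i = j \<and> i < n then 1 else 0"
proof -
  fix n :: nat
  show "finite {p. (case p of (i, j) \<Rightarrow> if i = j \<and> i < n then 1 else 0) \<noteq> (0 :: real)}"
    by (rule finite_subset[of _ "{..<n} \<times> {..<n}"]) (auto split: if_splits)
qed

primrec mat_pow :: "nat \<Rightarrow> rmat \<Rightarrow> nat \<Rightarrow> rmat" where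
  "mat_pow n A 0 = id_mat n"
| "mat_pow n A (Suc k) = mat_mult A (mat_pow n A k)"

text \<open>The block matrix \<open>[F 1 \<dots> F N]\<close> whose blocks have \<open>n\<close> columns each.\<close>

lift_definition block_row :: "nat \<Rightarrow> nat \<Rightarrow> (nat \<Rightarrow> rmat) \<Rightarrow> rmat"
  is "\<lambda>n N F (i, j). if j < N * n then F (Suc (j div n)) (i, j mod n) else 0"
proof -
  fix n N :: nat and F :: "nat \<Rightarrow> nat \<times> nat \<Rightarrow> real"
  assume "\<And>k. finite {p. F k p \<noteq> 0}"
  then have "finite ((\<Union>k\<in>Suc ` {..<N * n}. fst ` {p. F k p \<noteq> 0}) \<times> {..<N * n})" by simp
  moreover have "{p. (case p of (i, j) \<Rightarrow> if j < N * n then F (Suc (j div n)) (i, j mod n) else 0) \<noteq> 0}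
      \<subseteq> (\<Union>k\<in>Suc ` {..<N * n}. fst ` {p. F k p \<noteq> 0}) \<times> {..<N * n}"
  proof (clarsimp split: if_splits)
    fix i j assume "j < N * n" and *: "F (Suc (j div n)) (i, j mod n) \<noteq> 0"
    have "j div n < N * n" using \<open>j < N * n\<close> div_le_dividend[of j n] by linarith
    then show "\<exists>k\<in>{..<N * n}. i \<in> fst ` {p. F (Suc k) p \<noteq> 0}"
      using * by (intro bexI[of _ "j div n"]) force+
  qed
  ultimately show "finite {p. (case p of (i, j) \<Rightarrow> if j < N * n then F (Suc (j div n)) (i, j mod n) else 0) \<noteq> 0}"
    by (rule rev_finite_subset)
qed

text \<open>Spectral norm. Entries outside the dimensions vanish, so \<^const>\<open>onorm\<close> over all
  finitely supported vectors is the operator norm on the Euclidean space.\<close>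

definition snorm :: "rmat \<Rightarrow> real" where
  "snorm A = onorm (mat_vec A)"

definition linf :: "rvec \<Rightarrow> real" where
  "linf x = (SUP i. \<bar>entry x i\<bar>)"

definition linf_ball :: "nat \<Rightarrow> real \<Rightarrow> rvec set" where
  "linf_ball d r = {x \<in> Rvec d. linf x \<le> r}"

text \<open>For \<open>\<Delta> = 0\<close> this is \<open>D\<close> itself.\<close>

definition shrink :: "nat \<Rightarrow> real \<Rightarrow> rvec set \<Rightarrow> rvec set" where
  "shrink d \<Delta> D = {x \<in> D. \<forall>y \<in> linf_ball d \<Delta>. x + y \<in> D}"

text \<open>The gradient of \<open>f\<close>, as a function on the finite-dimensional subspace \<open>S\<close>.\<close>

definition grad_on :: "'a::real_inner set \<Rightarrow> ('a \<Rightarrow> real) \<Rightarrow> 'a \<Rightarrow> 'a" where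
  "grad_on S f x = (THE g. g \<in> S \<and> (f has_derivative (\<lambda>h. g \<bullet> h)) (at x within S))"

text \<open>Same definition as the library's \<^const>\<open>closest_point\<close>, which is restricted to
  types in which all closed bounded sets are compact.\<close>

definition proj_on :: "'a::real_inner set \<Rightarrow> 'a \<Rightarrow> 'a" where
  "proj_on S a = (SOME x. x \<in> S \<and> (\<forall>y\<in>S. dist a x \<le> dist a y))"

definition polynomial_fun :: "nat \<Rightarrow> (real list \<Rightarrow> real) \<Rightarrow> bool" where
  "polynomial_fun k F \<longleftrightarrow> (\<exists>(E :: (nat \<Rightarrow> nat) set) coef. finite E \<and>
     (\<forall>xs. length xs = k \<longrightarrow> F xs = (\<Sum>\<alpha>\<in>E. coef \<alpha> * (\<Prod>i<k. xs ! i ^ \<alpha> i))))"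

section \<open>The control problem\<close>

record plant =
  dimx :: nat
  dimu :: nat
  Amat :: rmat
  Bmat :: rmat
  wbar :: real
  Xset :: "rvec set"
  Uset :: "rvec set"
  kappa :: real
  gamma :: real

definition plant_ok :: "plant \<Rightarrow> bool" where
  "plant_ok S \<longleftrightarrow> dimx S \<ge> 1 \<and> dimu S \<ge> 1 \<and>
     Amat S \<in> Rmat (dimx S) (dimx S) \<and> Bmat S \<in> Rmat (dimx S) (dimu S) \<and> wbar S \<ge> 0 \<and>
     Xset S \<subseteq> Rvec (dimx S) \<and> closed (Xset S) \<and> convex (Xset S) \<and> 0 \<in> Xset S \<and>
     Uset S \<subseteq> Rvec (dimu S) \<and> closed (Uset S) \<and> convex (Uset S) \<and> 0 \<in> Uset S \<and>
     kappa S > 1 \<and> 0 < gamma S \<and> gamma S \<le> 1"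

definition kappaB :: "plant \<Rightarrow> real" where
  "kappaB S = max (snorm (Bmat S)) 1"

definition acoef :: "plant \<Rightarrow> real" where
  "acoef S = 2 * kappa S ^ 3"

definition Acl :: "plant \<Rightarrow> rmat \<Rightarrow> rmat" where
  "Acl S K = Amat S - mat_mult (Bmat S) K"

definition strongly_stable :: "plant \<Rightarrow> rmat \<Rightarrow> bool" where
  "strongly_stable S K \<longleftrightarrow> K \<in> Rmat (dimu S) (dimx S) \<and>
     (\<exists>L P Q. L \<in> Rmat (dimx S) (dimx S) \<and> P \<in> Rmat (dimx S) (dimx S) \<and> Q \<in> Rmat (dimx S) (dimx S) \<and>
        mat_mult P Q = id_mat (dimx S) \<and> mat_mult Q P = id_mat (dimx S) \<and>
        Acl S K = mat_mult P (mat_mult L Q) \<and> snorm L \<le> 1 - gamma S \<and>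
        max (snorm K) (max (snorm P) (snorm Q)) \<le> kappa S)"

definition disturbances :: "plant \<Rightarrow> (nat \<Rightarrow> rvec) set" where
  "disturbances S = {w. \<forall>t. w t \<in> linf_ball (dimx S) (wbar S)}"

text \<open>\<open>w\<^bsub>t-k\<^esub>\<close>, with the convention that disturbances at negative times vanish.\<close>

definition lag :: "(nat \<Rightarrow> rvec) \<Rightarrow> nat \<Rightarrow> nat \<Rightarrow> rvec" where
  "lag w t k = (if k \<le> t then w (t - k) else 0)"

primrec lin_state :: "plant \<Rightarrow> rmat \<Rightarrow> (nat \<Rightarrow> rvec) \<Rightarrow> nat \<Rightarrow> rvec" where
  "lin_state S K w 0 = 0"
| "lin_state S K w (Suc t) = mat_vec (Amat S) (lin_state S K w t)
     + mat_vec (Bmat S) (- mat_vec K (lin_state S K w t)) + w t"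

definition lin_input :: "plant \<Rightarrow> rmat \<Rightarrow> (nat \<Rightarrow> rvec) \<Rightarrow> nat \<Rightarrow> rvec" where
  "lin_input S K w t = - mat_vec K (lin_state S K w t)"

definition strictly_safe :: "plant \<Rightarrow> real \<Rightarrow> rmat \<Rightarrow> bool" where
  "strictly_safe S \<epsilon> K \<longleftrightarrow> (\<forall>w \<in> disturbances S. \<forall>t.
     lin_state S K w t \<in> shrink (dimx S) \<epsilon> (Xset S) \<and>
     lin_input S K w t \<in> shrink (dimu S) \<epsilon> (Uset S))"

text \<open>The benchmark class: safe strongly stable linear policies over the horizon \<open>T\<close>.\<close>

definition benchmark :: "plant \<Rightarrow> nat \<Rightarrow> rmat set" where
  "benchmark S T = {K. strongly_stable S K \<and> (\<forall>w \<in> disturbances S. \<forall>t\<le>T.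
     lin_state S K w t \<in> Xset S \<and> lin_input S K w t \<in> Uset S)}"

definition costs_ok :: "plant \<Rightarrow> nat \<Rightarrow> real \<Rightarrow> (nat \<Rightarrow> rvec \<times> rvec \<Rightarrow> real) \<Rightarrow> bool" where
  "costs_ok S T G c \<longleftrightarrow> (\<forall>t\<le>T.
     convex_on (Rvec (dimx S) \<times> Rvec (dimu S)) (c t) \<and>
     c t differentiable_on (Rvec (dimx S) \<times> Rvec (dimu S)) \<and>
     (\<forall>D. \<forall>x \<in> Rvec (dimx S). \<forall>u \<in> Rvec (dimu S). norm x \<le> D \<and> norm u \<le> D \<longrightarrow>
        \<bar>c t (x, u)\<bar> \<le> G * D \<and>
        norm (grad_on (Rvec (dimx S)) (\<lambda>x'. c t (x', u)) x) \<le> G * D \<and>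
        norm (grad_on (Rvec (dimu S)) (\<lambda>u'. c t (x, u')) u) \<le> G * D))"

section \<open>Disturbance-action policies\<close>

definition Mset :: "plant \<Rightarrow> nat \<Rightarrow> policy set" where
  "Mset S H = {M \<in> policy_space H (dimu S) (dimx S).
     \<forall>i\<in>{1..H}. snorm (entry M i) \<le> acoef S * (1 - gamma S) ^ (i - 1)}"

text \<open>For \<open>k \<le> i\<close> the subtraction \<open>k - i\<close> truncates to 0, which the indicator excludes.\<close>

definition Psix :: "plant \<Rightarrow> rmat \<Rightarrow> nat \<Rightarrow> policy \<Rightarrow> nat \<Rightarrow> rmat" where
  "Psix S K H M k =
     (if k \<le> H then mat_pow (dimx S) (Acl S K) (k - 1) else 0) +
     (\<Sum>i=1..H. if 1 \<le> k - i \<and> k - i \<le> H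
        then mat_mult (mat_pow (dimx S) (Acl S K) (i - 1)) (mat_mult (Bmat S) (entry M (k - i)))
        else 0)"

definition Psiu :: "plant \<Rightarrow> rmat \<Rightarrow> nat \<Rightarrow> policy \<Rightarrow> nat \<Rightarrow> rmat" where
  "Psiu S K H M k = (if k \<le> H then entry M k else 0) - mat_mult K (Psix S K H M k)"

definition hx :: "plant \<Rightarrow> rmat \<Rightarrow> nat \<Rightarrow> policy \<Rightarrow> rmat" where
  "hx S K H M = block_row (dimx S) (2 * H) (Psix S K H M)"

definition hu :: "plant \<Rightarrow> rmat \<Rightarrow> nat \<Rightarrow> policy \<Rightarrow> rmat" where
  "hu S K H M = block_row (dimx S) (2 * H) (Psiu S K H M)"

definition Omega :: "plant \<Rightarrow> rmat \<Rightarrow> nat \<Rightarrow> real \<Rightarrow> policy set" where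
  "Omega S K H \<epsilon> = {M \<in> Mset S H.
     mat_vec (hx S K H M) ` linf_ball (2 * H * dimx S) (wbar S) \<subseteq> shrink (dimx S) \<epsilon> (Xset S) \<and>
     mat_vec (hu S K H M) ` linf_ball (2 * H * dimx S) (wbar S) \<subseteq> shrink (dimu S) \<epsilon> (Uset S)}"

definition approx_cost ::
  "plant \<Rightarrow> (nat \<Rightarrow> rvec \<times> rvec \<Rightarrow> real) \<Rightarrow> rmat \<Rightarrow> nat \<Rightarrow> (nat \<Rightarrow> rvec) \<Rightarrow> nat \<Rightarrow> policy \<Rightarrow> real" where
  "approx_cost S c K H w t M =
     c t (\<Sum>k=1..2*H. mat_vec (Psix S K H M k) (lag w t k),
          \<Sum>k=1..2*H. mat_vec (Psiu S K H M k) (lag w t k))"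

section \<open>The algorithm and its regret\<close>

definition ogd_action :: "rmat \<Rightarrow> nat \<Rightarrow> (nat \<Rightarrow> rvec) \<Rightarrow> nat \<Rightarrow> rvec \<Rightarrow> policy \<Rightarrow> rvec" where
  "ogd_action K H w t x M = - mat_vec K x + (\<Sum>i=1..H. mat_vec (entry M i) (lag w t i))"

record alg_input =
  inK :: rmat
  inH :: nat
  ineps :: real
  ineta :: real
  inM0 :: policy

text \<open>The pairs \<open>(x\<^sub>t, M\<^sub>t)\<close> generated by the algorithm.\<close>

primrec ogd_run ::
  "plant \<Rightarrow> (nat \<Rightarrow> rvec \<times> rvec \<Rightarrow> real) \<Rightarrow> alg_input \<Rightarrow> (nat \<Rightarrow> rvec) \<Rightarrow> nat \<Rightarrow> rvec \<times> policy" where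
  "ogd_run S c I w 0 = (0, inM0 I)"
| "ogd_run S c I w (Suc t) = (case ogd_run S c I w t of (x, M) \<Rightarrow>
     (mat_vec (Amat S) x + mat_vec (Bmat S) (ogd_action (inK I) (inH I) w t x M) + w t,
      proj_on (Omega S (inK I) (inH I) (ineps I))
        (M - ineta I *\<^sub>R grad_on (policy_space (inH I) (dimu S) (dimx S))
           (approx_cost S c (inK I) (inH I) w t) M)))"

definition ogd_state where
  "ogd_state S c I w t = fst (ogd_run S c I w t)"

definition ogd_input where
  "ogd_input S c I w t =
     ogd_action (inK I) (inH I) w t (fst (ogd_run S c I w t)) (snd (ogd_run S c I w t))"

text \<open>Extended reals, so that no boundedness is presupposed by the supremum and the infimum.\<close>

definition regret :: "plant \<Rightarrow> nat \<Rightarrow> (nat \<Rightarrow> rvec \<times> rvec \<Rightarrow> real) \<Rightarrow> alg_input \<Rightarrow> ereal" where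
  "regret S T c I = (SUP w \<in> disturbances S.
     ereal (\<Sum>t\<le>T. c t (ogd_state S c I w t, ogd_input S c I w t))
     - (INF K \<in> benchmark S T. ereal (\<Sum>t\<le>T. c t (lin_state S K w t, lin_input S K w t))))"

definition eps1 :: "plant \<Rightarrow> nat \<Rightarrow> real" where
  "eps1 S H = wbar S * kappa S ^ 3
       * (2 * kappa S ^ 3 + 2 * acoef S * kappa S ^ 3 * kappaB S + acoef S) / gamma S
     * real H * (1 - gamma S) ^ H"

definition eps2 :: "plant \<Rightarrow> real \<Rightarrow> real \<Rightarrow> nat \<Rightarrow> real" where
  "eps2 S G \<eta> H = 4 * G * wbar S ^ 3 * (kappa S ^ 3 + 2 * acoef S * kappa S ^ 3 * kappaB S)
       * (1 + kappa S) * kappa S ^ 5 * kappaB S ^ 2 / gamma S ^ 4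
     * sqrt (real (dimu S) * real (dimx S) ^ 3) * \<eta> * real H ^ 2"

definition eps3 :: "plant \<Rightarrow> nat \<Rightarrow> real" where
  "eps3 S H = 2 * wbar S * kappa S ^ 5 * sqrt (real (dimx S)) * (1 - gamma S) ^ H"

definition regret_rate :: "nat \<Rightarrow> nat \<Rightarrow> nat \<Rightarrow> nat \<Rightarrow> real \<Rightarrow> real \<Rightarrow> real \<Rightarrow> real \<Rightarrow> real" where
  "regret_rate n m T H \<gamma> \<eta> \<epsilon> \<epsilon>s =
     real T * sqrt (real m ^ 2 * real n ^ 3) * real H ^ 2 * (1 - \<gamma>) ^ H
     + real T * real m * real n ^ 2 * real H ^ 3 * \<eta>
     + real m / \<eta>
     + real T * (1 - \<gamma>) ^ H * sqrt (real m ^ 2 * real n ^ 3 * real H ^ 5) / \<epsilon>s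
     + \<epsilon> * real T * sqrt (real m ^ 2 * real n ^ 2 * real H ^ 3) / \<epsilon>s"

end

theory Submission
  imports Defs
begin

text \<open>
  The costs are Lipschitz on the region that all trajectories stay in, so the regret splits into four
  parts.  (1) The state differs from the response to the current policy frozen in the past by a
  truncation error, of order \<open>(1 - \<gamma>)\<^sup>H\<close>, and by a drift of order \<open>\<eta>\<close>, since one step of the descent
  moves the policy by at most \<open>\<eta>\<close> times the Lipschitz constant.  (2) Projected gradient descent on the
  compact convex set of safe policies has regret \<open>O(m / \<eta> + \<eta> T)\<close>.  (3) A linear controller \<open>K'\<close> is imitated
  by the policy \<open>M\<^bsub>i\<^esub> = (K - K') A\<^bsub>K'\<^esub>\<^bsup>i-1\<^esup>\<close> up to an error of order \<open>H (1 - \<gamma>)\<^sup>H\<close>.  (4) This policy may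
  violate the tightened constraints, but its mixture with the policy that imitates the strictly safe
  controller, with a weight of order \<open>(\<epsilon> + H (1 - \<gamma>)\<^sup>H) / \<epsilon>\<^sub>*\<close>, satisfies them.
\<close>

section \<open>Subspaces of finitely supported families\<close>

text \<open>Vectors of all dimensions share one infinite-dimensional, incomplete space. Gradients
  exist because the subspaces of fixed dimension admit a Riesz representation, projections because
  the safe policies are a closed part of a finite box. Membership in \<open>Omega\<close> speaks of
  every window of disturbances, whereas a linear controller is known to be safe only along its
  trajectories. Reversing time makes a window the start of a disturbance sequence, so the response
  truncated to \<open>H\<close> lags is a genuine state at time \<open>H\<close>. For benchmark
  controllers this needs \<open>H \<le> T\<close>; a shorter horizon is left to the trivial bound.
  Dimensions enter in two ways. A disturbance has Euclidean norm up to \<open>sqrt n * wbar\<close>,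
  and every Lipschitz estimate collects two such factors, one from the radius in the cost assumption
  and one from the perturbed response. The Frobenius norm can exceed the spectral norm by
  \<open>sqrt m\<close>, which fixes the diameter of the policy set and hence the term
  \<open>m / \<eta>\<close>.\<close>

lemma entry_sum [simp]: "entry (sum f A) i = (\<Sum>a\<in>A. entry (f a) i)"
  by (induction A rule: infinite_finite_induct) auto

lemma norm_fsfam_sq:
  fixes x :: "('i, 'a::real_inner) fsfam"
  assumes "finite I" "\<And>i. i \<notin> I \<Longrightarrow> entry x i = 0"
  shows "(norm x)\<^sup>2 = (\<Sum>i\<in>I. (norm (entry x i))\<^sup>2)"
  using inner_fsfam_superset[of I x x] assms by (simp add: power2_norm_eq_inner)

lemma norm_entry_le: "norm (entry x i) \<le> norm x"
proof -
  have "(norm (entry x i))\<^sup>2 \<le> (\<Sum>j\<in>insert i {j. entry x j \<noteq> 0}. (norm (entry x j))\<^sup>2)"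
    by (rule member_le_sum) auto
  also have "\<dots> = (norm x)\<^sup>2"
    by (subst norm_fsfam_sq[of "insert i {j. entry x j \<noteq> 0}"]) auto
  finally show ?thesis
    by (rule power2_le_imp_le) simp
qed

lemma bounded_linear_entry: "bounded_linear (\<lambda>x. entry x i)"
  by (rule bounded_linear_intro[of _ 1]) (auto intro: norm_entry_le)

lift_definition fsingle :: "'i \<Rightarrow> 'a \<Rightarrow> ('i, 'a::real_inner) fsfam" is "\<lambda>i a j. if j = i then a else 0"
  by simp

lemma norm_fsingle: "norm (fsingle i a) = norm a"
proof -
  have "(norm (fsingle i a))\<^sup>2 = (norm a)\<^sup>2"
    by (subst norm_fsfam_sq[of "{i}"]) (auto simp: fsingle.rep_eq)
  then show ?thesis by simp
qed

lemma bounded_linear_fsingle: "bounded_linear (fsingle i)"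
  by (rule bounded_linear_intro[of _ 1])
     (auto simp: norm_fsingle intro!: fsfam_eqI simp: fsingle.rep_eq)

lemma fsfam_eq_sum_fsingle:
  assumes "finite I" "\<And>i. i \<notin> I \<Longrightarrow> entry x i = 0"
  shows "x = (\<Sum>i\<in>I. fsingle i (entry x i))"
  using assms by (intro fsfam_eqI) (auto simp: fsingle.rep_eq)

text \<open>The common form of \<open>Rvec\<close>, \<open>Rmat\<close> and
  \<open>policy_space\<close>, so that closedness and the Riesz property are proved once; policies
  arise by nesting.\<close>

definition fam_space :: "'i set \<Rightarrow> 'a::real_inner set \<Rightarrow> ('i, 'a) fsfam set" where
  "fam_space I T = {x. (\<forall>i. entry x i \<in> T) \<and> (\<forall>i. entry x i \<noteq> 0 \<longrightarrow> i \<in> I)}"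

lemma subspace_fam_space:
  assumes "subspace T"
  shows "subspace (fam_space I T)"
proof (rule subspaceI)
  show "0 \<in> fam_space I T" "\<And>c x. x \<in> fam_space I T \<Longrightarrow> c *\<^sub>R x \<in> fam_space I T"
    using assms by (auto simp: fam_space_def subspace_0 subspace_scale)
  fix x y assume xy: "x \<in> fam_space I T" "y \<in> fam_space I T"
  have "i \<in> I" if "entry x i + entry y i \<noteq> 0" for i
  proof (rule ccontr)
    assume "i \<notin> I"
    then have "entry x i = 0" "entry y i = 0" using xy by (auto simp: fam_space_def)
    then show False using that by simp
  qed
  then show "x + y \<in> fam_space I T"
    using xy assms by (auto simp: fam_space_def subspace_add)
qed

lemma closed_fam_space:
  fixes T :: "'a::real_inner set"
  assumes "closed T"
  shows "closed (fam_space I T)"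
proof -
  have eq: "fam_space I T = (\<Inter>i. (\<lambda>x. entry x i) -` T) \<inter> (\<Inter>i\<in>-I. (\<lambda>x. entry x i) -` {0})"
    unfolding fam_space_def by auto
  show ?thesis unfolding eq using assms
    by (intro closed_Int closed_INT ballI closed_vimage bounded_linear.continuous_on[OF bounded_linear_entry]
        continuous_on_id closed_singleton)
qed

text \<open>Closed and bounded does not suffice for compactness in the infinite-dimensional ambient
  space. Instead the box is built coordinate by coordinate, each time as the continuous image of a
  product of compact sets.\<close>

lemma compact_family_box:
  fixes C :: "'i \<Rightarrow> 'a::real_inner set"
  assumes "finite I" "\<And>i. i \<in> I \<Longrightarrow> compact (C i)"
  shows "compact {x. \<forall>i. entry x i \<in> (if i \<in> I then C i else {0})}"
  using assms
proof (induction I rule: finite_induct)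
  case empty
  have "{x :: ('i, 'a) fsfam. \<forall>i. entry x i \<in> (if i \<in> {} then C i else {0})} = {0}"
    by (auto intro: fsfam_eqI)
  then show ?case by (simp only: compact_sing)
next
  case (insert k I)
  let ?B = "\<lambda>I. {x. \<forall>i. entry x i \<in> (if i \<in> I then C i else {0})}"
  have "?B (insert k I) = (\<lambda>(c, x). fsingle k c + x) ` (C k \<times> ?B I)"
  proof (intro equalityI subsetI)
    fix x assume x: "x \<in> ?B (insert k I)"
    then have ck: "entry x k \<in> C k" by (metis (mono_tags, lifting) insertI1 mem_Collect_eq)
    have "entry (x - fsingle k (entry x k)) i \<in> (if i \<in> I then C i else {0})" for i
    proof -
      have "entry x i \<in> (if i \<in> insert k I then C i else {0})" using x by blast
      then show ?thesis using insert.hyps by (auto simp: fsingle.rep_eq split: if_splits)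
    qed
    then show "x \<in> (\<lambda>(c, x). fsingle k c + x) ` (C k \<times> ?B I)"
      using ck by (intro image_eqI[of _ _ "(entry x k, x - fsingle k (entry x k))"]) auto
  next
    fix x assume "x \<in> (\<lambda>(c, x). fsingle k c + x) ` (C k \<times> ?B I)"
    then obtain c y where x: "x = fsingle k c + y" and c: "c \<in> C k" and y: "y \<in> ?B I" by auto
    have "entry x i \<in> (if i \<in> insert k I then C i else {0})" for i
    proof -
      have "entry y i \<in> (if i \<in> I then C i else {0})" using y by blast
      then show ?thesis using insert.hyps c by (auto simp: x fsingle.rep_eq split: if_splits)
    qed
    then show "x \<in> ?B (insert k I)" by blast
  qed
  moreover have "continuous_on (C k \<times> ?B I) (\<lambda>(c, x). fsingle k c + x)"
    unfolding case_prod_unfold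
    by (intro continuous_intros bounded_linear.continuous_on[OF bounded_linear_fsingle])
  moreover have "compact (C k \<times> ?B I)"
    using insert.prems by (intro compact_Times insert.IH) auto
  ultimately show ?case
    by (simp only: compact_continuous_image)
qed

section \<open>Gradients on subspaces\<close>

text \<open>The substitute for finite dimension: linear functionals are represented on
  \<open>T\<close> by a vector of \<open>T\<close>, with neither continuity nor completeness
  required.\<close>

definition riesz_space :: "'a::real_inner set \<Rightarrow> bool" where
  "riesz_space T \<longleftrightarrow> subspace T \<and> (\<forall>D. linear D \<longrightarrow> (\<exists>g\<in>T. \<forall>h\<in>T. D h = g \<bullet> h))"

lemma riesz_space_real: "riesz_space (UNIV :: real set)"
  unfolding riesz_space_def
proof (intro conjI allI impI)
  fix D :: "real \<Rightarrow> real" assume D: "linear D"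
  show "\<exists>g\<in>UNIV. \<forall>h\<in>UNIV. D h = g \<bullet> h"
  proof (intro bexI[of _ "D 1"] ballI)
    fix h :: real
    show "D h = D 1 \<bullet> h"
      using linear_cmul[OF D, of h 1] by simp
  qed simp
qed auto

text \<open>The representing family is assembled from the representations of \<open>D\<close> on
  families with a single nonzero entry.\<close>

lemma riesz_space_fam_space:
  assumes "finite I" "riesz_space T"
  shows "riesz_space (fam_space I T)"
  unfolding riesz_space_def
proof (intro conjI allI impI)
  have T: "subspace T" using assms(2) by (simp add: riesz_space_def)
  then show "subspace (fam_space I T)" by (rule subspace_fam_space)
  fix D :: "('a, 'b) fsfam \<Rightarrow> real" assume D: "linear D"
  have "linear (\<lambda>a. D (fsingle i a))" for i
    using linear_compose[OF bounded_linear.linear[OF bounded_linear_fsingle] D]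
    by (simp add: o_def)
  then have "\<forall>i. \<exists>g\<in>T. \<forall>h\<in>T. D (fsingle i h) = g \<bullet> h"
    using assms(2) unfolding riesz_space_def by blast
  then obtain g where g: "\<And>i. g i \<in> T" "\<And>i h. h \<in> T \<Longrightarrow> D (fsingle i h) = g i \<bullet> h"
    by metis
  define G where "G = (\<Sum>i\<in>I. fsingle i (g i))"
  have eG: "entry G i = (if i \<in> I then g i else 0)" for i
    using assms(1) by (simp add: G_def fsingle.rep_eq)
  show "\<exists>g\<in>fam_space I T. \<forall>h\<in>fam_space I T. D h = g \<bullet> h"
  proof (intro bexI[of _ G] ballI)
    show "G \<in> fam_space I T"
      using g(1) subspace_0[OF T] by (auto simp: fam_space_def eG)
    fix h assume h: "h \<in> fam_space I T"
    have "D h = D (\<Sum>i\<in>I. fsingle i (entry h i))"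
      using h by (subst fsfam_eq_sum_fsingle[OF assms(1), of h]) (auto simp: fam_space_def)
    also have "\<dots> = (\<Sum>i\<in>I. g i \<bullet> entry h i)"
      using h by (simp add: linear_sum[OF D] g(2) fam_space_def)
    also have "\<dots> = G \<bullet> h"
      using assms(1) h by (subst inner_fsfam_superset[of I]) (auto simp: eG fam_space_def)
    finally show "D h = G \<bullet> h" .
  qed
qed

lemma Rvec_eq_fam_space: "Rvec n = fam_space {..<n} UNIV"
  by (auto simp: Rvec_def fam_space_def)

lemma Rmat_eq_fam_space: "Rmat m n = fam_space ({..<m} \<times> {..<n}) UNIV"
  by (auto simp: Rmat_def fam_space_def)

lemma policy_space_eq_fam_space: "policy_space H m n = fam_space {1..H} (Rmat m n)"
  by (auto simp: policy_space_def fam_space_def)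

lemma riesz_Rvec: "riesz_space (Rvec n)"
  unfolding Rvec_eq_fam_space by (intro riesz_space_fam_space riesz_space_real) simp

lemma riesz_policy_space: "riesz_space (policy_space H m n)"
  unfolding policy_space_eq_fam_space Rmat_eq_fam_space
  by (intro riesz_space_fam_space riesz_space_real) simp_all

lemma subspace_Rvec [simp]: "subspace (Rvec n)"
  using riesz_Rvec by (simp add: riesz_space_def)

lemma subspace_Rmat [simp]: "subspace (Rmat m n)"
  unfolding Rmat_eq_fam_space by (intro subspace_fam_space subspace_UNIV)

lemma subspace_policy_space [simp]: "subspace (policy_space H m n)"
  using riesz_policy_space by (simp add: riesz_space_def)

lemma closed_policy_space: "closed (policy_space H m n)"
  unfolding policy_space_eq_fam_space Rmat_eq_fam_space
  by (intro closed_fam_space closed_UNIV)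

text \<open>Reduces uniqueness of the gradient and the tangent inequality to functions of one real
  variable.\<close>

lemma has_derivative_on_line:
  fixes f :: "'a::real_normed_vector \<Rightarrow> real"
  assumes "subspace S" "(f has_derivative D) (at x within S)" "x \<in> S" "h \<in> S"
  shows "((\<lambda>s. f (x + s *\<^sub>R h)) has_real_derivative D h) (at 0)"
proof -
  have "((\<lambda>s. x + s *\<^sub>R h) has_derivative (\<lambda>s. s *\<^sub>R h)) (at 0)"
    by (rule has_derivative_eq_rhs[OF has_derivative_add[OF has_derivative_const
        bounded_linear_imp_has_derivative[OF bounded_linear_scaleR_left]]]) simp
  moreover have "(f has_derivative D) (at (x + 0 *\<^sub>R h) within (\<lambda>s. x + s *\<^sub>R h) ` UNIV)"
  proof -
    have "(\<lambda>s. x + s *\<^sub>R h) ` UNIV \<subseteq> S"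
      using assms(1,3,4) by (auto simp: subspace_add subspace_scale)
    then show ?thesis
      using has_derivative_subset[OF assms(2)] by simp
  qed
  ultimately have "((\<lambda>s. f (x + s *\<^sub>R h)) has_derivative (\<lambda>s. D (s *\<^sub>R h))) (at 0)"
    by (rule has_derivative_in_compose)
  moreover have "D (s *\<^sub>R h) = D h * s" for s
    using linear_cmul[OF has_derivative_linear[OF assms(2)], of s h] by simp
  ultimately show ?thesis
    by (simp add: has_field_derivative_def)
qed

lemma grad_on_properties:
  fixes f :: "'a::real_inner \<Rightarrow> real"
  assumes S: "riesz_space S" and f: "(f has_derivative D) (at x within S)" and x: "x \<in> S"
  shows "grad_on S f x \<in> S" "\<And>h. h \<in> S \<Longrightarrow> grad_on S f x \<bullet> h = D h"
proof -
  have sub: "subspace S" using S by (simp add: riesz_space_def)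
  obtain g where g: "g \<in> S" "\<And>h. h \<in> S \<Longrightarrow> D h = g \<bullet> h"
    using S has_derivative_linear[OF f] unfolding riesz_space_def by blast
  \<comment> \<open>\<open>D\<close> and \<open>g\<close> agree only on \<open>S\<close>, but the
    difference quotient within \<open>S\<close> evaluates them only at \<open>y - x\<close>, which
    lies in \<open>S\<close>.\<close>
  have "(f has_derivative (\<lambda>h. g \<bullet> h)) (at x within S)"
    unfolding has_derivative_within
  proof
    show "bounded_linear (\<lambda>h. g \<bullet> h)" by (rule bounded_linear_inner_right)
    have "D (y - x) = g \<bullet> (y - x)" if "y \<in> S" for y
      using g(2) subspace_diff[OF sub that x] .
    then have "\<forall>\<^sub>F y in at x within S. (1 / norm (y - x)) *\<^sub>R (f y - (f x + D (y - x)))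
        = (1 / norm (y - x)) *\<^sub>R (f y - (f x + g \<bullet> (y - x)))"
      unfolding eventually_at_filter by (intro always_eventually allI impI) simp
    then show "((\<lambda>y. (1 / norm (y - x)) *\<^sub>R (f y - (f x + g \<bullet> (y - x)))) \<longlongrightarrow> 0) (at x within S)"
      using f[unfolded has_derivative_within] by (blast intro: Lim_transform_eventually)
  qed
  \<comment> \<open>Two candidates are compared along the direction \<open>g' - g\<close>, which
    lies in \<open>S\<close>; equality of the directional derivatives makes its squared norm vanish.
    Without uniqueness the definite description would be meaningless.\<close>
  moreover have "g' = g" if g': "g' \<in> S" "(f has_derivative (\<lambda>h. g' \<bullet> h)) (at x within S)" for g'
  proof -
    have "g' - g \<in> S" using sub g'(1) g(1) by (rule subspace_diff)
    from has_derivative_on_line[OF sub g'(2) x this] has_derivative_on_line[OF sub f x this]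
    have "g' \<bullet> (g' - g) = g \<bullet> (g' - g)"
      using g(2)[OF \<open>g' - g \<in> S\<close>] DERIV_unique by metis
    then have "(g' - g) \<bullet> (g' - g) = 0" by (simp add: inner_diff_left)
    then show ?thesis by simp
  qed
  ultimately have "grad_on S f x = g"
    unfolding grad_on_def using g(1) by (intro the_equality) blast+
  then show "grad_on S f x \<in> S" "\<And>h. h \<in> S \<Longrightarrow> grad_on S f x \<bullet> h = D h"
    using g by simp_all
qed

lemma convex_on_above_tangent:
  fixes f :: "'a::real_normed_vector \<Rightarrow> real"
  assumes "subspace S" "convex_on S f" "(f has_derivative D) (at x within S)" "x \<in> S" "y \<in> S"
  shows "f x + D (y - x) \<le> f y"
proof -
  let ?g = "\<lambda>s. f (x + s *\<^sub>R (y - x))"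
  have yx: "y - x \<in> S" using assms(1,4,5) by (simp add: subspace_diff)
  have mem: "x + s *\<^sub>R (y - x) \<in> S" for s
    using assms(1,4) yx by (simp add: subspace_add subspace_scale)
  have "convex_on UNIV ?g"
  proof (rule convex_onI)
    fix t a b :: real assume t: "0 < t" "t < 1"
    have "?g ((1 - t) *\<^sub>R a + t *\<^sub>R b)
        = f ((1 - t) *\<^sub>R (x + a *\<^sub>R (y - x)) + t *\<^sub>R (x + b *\<^sub>R (y - x)))"
      by (rule arg_cong[of _ _ f]) (simp add: algebra_simps)
    also have "\<dots> \<le> (1 - t) * ?g a + t * ?g b"
      using t by (intro convex_onD[OF assms(2)] mem) auto
    finally show "?g ((1 - t) *\<^sub>R a + t *\<^sub>R b) \<le> (1 - t) * ?g a + t * ?g b" .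
  qed simp
  moreover have "(?g has_real_derivative D (y - x)) (at 0 within UNIV)"
    using has_derivative_on_line[OF assms(1,3,4) yx] by simp
  ultimately have "?g 1 - ?g 0 \<ge> D (y - x) * (1 - 0)"
    by (intro convex_on_imp_above_tangent[of UNIV ?g 0 1]) auto
  then show ?thesis by simp
qed

section \<open>Projections\<close>

lemma proj_on_properties:
  fixes S :: "'a::real_inner set"
  assumes "compact S" "S \<noteq> {}"
  shows "proj_on S a \<in> S" "\<And>y. y \<in> S \<Longrightarrow> dist a (proj_on S a) \<le> dist a y"
proof -
  have "continuous_on S (\<lambda>x. dist a x)" by (intro continuous_intros)
  then have "\<exists>x. x \<in> S \<and> (\<forall>y\<in>S. dist a x \<le> dist a y)"
    using continuous_attains_inf[OF assms] by blast
  then have "proj_on S a \<in> S \<and> (\<forall>y\<in>S. dist a (proj_on S a) \<le> dist a y)"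
    unfolding proj_on_def by (rule someI_ex)
  then show "proj_on S a \<in> S" "\<And>y. y \<in> S \<Longrightarrow> dist a (proj_on S a) \<le> dist a y" by auto
qed

text \<open>At the projection \<open>p\<close> the directions to \<open>a\<close> and to
  \<open>y\<close> form no acute angle, since otherwise a small move from \<open>p\<close> towards
  \<open>y\<close> would come closer to \<open>a\<close>. Expanding the squared distance from
  \<open>a\<close> to \<open>y\<close> around \<open>p\<close> then gives the bound.\<close>

lemma norm_proj_on_diff_le:
  fixes S :: "'a::real_inner set"
  assumes "compact S" "convex S" "y \<in> S"
  shows "norm (proj_on S a - y) \<le> norm (a - y)"
proof -
  define p where "p = proj_on S a"
  have "S \<noteq> {}" using assms(3) by blast
  then have p: "p \<in> S" "\<And>y. y \<in> S \<Longrightarrow> dist a p \<le> dist a y"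
    unfolding p_def using proj_on_properties[OF assms(1)] by blast+
  have obtuse: "(a - p) \<bullet> (y - p) \<le> 0"
  proof (rule ccontr)
    assume "\<not> ?thesis"
    then have pos: "(a - p) \<bullet> (y - p) > 0" by simp
    obtain u where u: "u > 0" "u \<le> 1" "dist (p + u *\<^sub>R (y - p)) a < dist p a"
      using closer_point_lemma[OF pos] by blast
    have "p + u *\<^sub>R (y - p) = (1 - u) *\<^sub>R p + u *\<^sub>R y" by (simp add: algebra_simps)
    then have "p + u *\<^sub>R (y - p) \<in> S" using convexD_alt[OF assms(2) p(1) assms(3)] u by simp
    then show False using p(2)[of "p + u *\<^sub>R (y - p)"] u(3) by (simp add: dist_commute)
  qed
  have "(norm (a - y))\<^sup>2 = (norm (a - p))\<^sup>2 + (norm (p - y))\<^sup>2 - 2 * ((a - p) \<bullet> (y - p))"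
    by (simp add: power2_norm_eq_inner inner_diff_left inner_diff_right inner_commute)
  then have "(norm (p - y))\<^sup>2 \<le> (norm (a - y))\<^sup>2" using obtuse by (smt (verit) zero_le_power2)
  then show ?thesis unfolding p_def by (rule power2_le_imp_le) simp
qed

section \<open>Matrices acting on vectors\<close>

lemma entry_mat_vec:
  assumes "finite J" "\<And>j. j \<notin> J \<Longrightarrow> entry A (i, j) = 0 \<or> entry x j = 0"
  shows "entry (mat_vec A x) i = (\<Sum>j\<in>J. entry A (i, j) * entry x j)"
proof -
  have "entry (mat_vec A x) i = (\<Sum>j | entry x j \<noteq> 0. entry A (i, j) * entry x j)"
    by (simp add: mat_vec.rep_eq)
  also have "\<dots> = (\<Sum>j\<in>J \<union> {j. entry x j \<noteq> 0}. entry A (i, j) * entry x j)"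
    using assms(1) by (intro sum.mono_neutral_left) auto
  also have "\<dots> = (\<Sum>j\<in>J. entry A (i, j) * entry x j)"
    using assms by (intro sum.mono_neutral_right) (auto dest: assms(2))
  finally show ?thesis .
qed

lemma entry_mat_mult:
  assumes "finite J" "\<And>j. j \<notin> J \<Longrightarrow> entry A (i, j) = 0 \<or> entry B (j, l) = 0"
  shows "entry (mat_mult A B) (i, l) = (\<Sum>j\<in>J. entry A (i, j) * entry B (j, l))"
proof -
  have fin: "finite {j. entry B (j, l) \<noteq> 0}"
    by (rule finite_subset[of _ "fst ` {p. entry B p \<noteq> 0}"]) (auto intro!: image_eqI[of _ fst "(_, l)"])
  have "entry (mat_mult A B) (i, l) = (\<Sum>j | entry B (j, l) \<noteq> 0. entry A (i, j) * entry B (j, l))"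
    by (simp add: mat_mult.rep_eq)
  also have "\<dots> = (\<Sum>j\<in>J \<union> {j. entry B (j, l) \<noteq> 0}. entry A (i, j) * entry B (j, l))"
    using assms(1) fin by (intro sum.mono_neutral_left) auto
  also have "\<dots> = (\<Sum>j\<in>J. entry A (i, j) * entry B (j, l))"
    using assms fin by (intro sum.mono_neutral_right) (auto dest: assms(2))
  finally show ?thesis .
qed

text \<open>Rows turn an entry of a matrix-vector product into an inner product, from which
  bilinearity and the Frobenius bound (Cauchy-Schwarz in each row) follow.\<close>

definition mat_row :: "rmat \<Rightarrow> nat \<Rightarrow> rvec" where
  "mat_row A i = Fsfam (\<lambda>j. entry A (i, j))"

lemma entry_mat_row [simp]: "entry (mat_row A i) j = entry A (i, j)"
proof -
  have "finite {j. entry A (i, j) \<noteq> 0}"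
    by (rule finite_subset[of _ "snd ` {p. entry A p \<noteq> 0}"]) (auto intro!: image_eqI[of _ snd "(i, _)"])
  then show ?thesis by (simp add: mat_row_def Fsfam_inverse)
qed

lemma entry_mat_vec_eq_inner: "entry (mat_vec A x) i = mat_row A i \<bullet> x"
proof -
  have "mat_row A i \<bullet> x = (\<Sum>j | entry x j \<noteq> 0. entry A (i, j) * entry x j)"
    by (subst inner_fsfam_superset[of "{j. entry x j \<noteq> 0}"]) auto
  then show ?thesis by (simp add: mat_vec.rep_eq)
qed

lemma norm_mat_sq:
  assumes "finite I" "\<And>i j. entry A (i, j) \<noteq> 0 \<Longrightarrow> i \<in> I"
  shows "(norm A)\<^sup>2 = (\<Sum>i\<in>I. (norm (mat_row A i))\<^sup>2)"
proof -
  define J where "J = snd ` {p. entry A p \<noteq> 0}"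
  have J: "finite J" "\<And>i j. entry A (i, j) \<noteq> 0 \<Longrightarrow> j \<in> J"
    unfolding J_def by (auto intro!: image_eqI[of _ snd])
  have "(norm A)\<^sup>2 = (\<Sum>p\<in>I \<times> J. (norm (entry A p))\<^sup>2)"
    using assms J by (intro norm_fsfam_sq) auto
  also have "\<dots> = (\<Sum>i\<in>I. \<Sum>j\<in>J. (norm (entry A (i, j)))\<^sup>2)"
    by (simp add: sum.cartesian_product)
  also have "\<dots> = (\<Sum>i\<in>I. (norm (mat_row A i))\<^sup>2)"
    using J by (intro sum.cong refl) (subst norm_fsfam_sq[of J], auto)
  finally show ?thesis .
qed

lemma norm_mat_vec_le: "norm (mat_vec A x) \<le> norm A * norm x"
proof -
  define I where "I = fst ` {p. entry A p \<noteq> 0}"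
  have I: "finite I" "\<And>i j. entry A (i, j) \<noteq> 0 \<Longrightarrow> i \<in> I"
    unfolding I_def by (auto intro!: image_eqI[of _ fst])
  have "(norm (mat_vec A x))\<^sup>2 = (\<Sum>i\<in>I. (norm (entry (mat_vec A x) i))\<^sup>2)"
  proof (rule norm_fsfam_sq[OF I(1)])
    fix i assume "i \<notin> I"
    then have "entry A (i, j) = 0" for j using I(2) by blast
    then show "entry (mat_vec A x) i = 0" by (simp add: mat_vec.rep_eq)
  qed
  also have "\<dots> \<le> (\<Sum>i\<in>I. (norm (mat_row A i) * norm x)\<^sup>2)"
  proof (rule sum_mono)
    fix i
    have "\<bar>mat_row A i \<bullet> x\<bar> \<le> norm (mat_row A i) * norm x"
      by (rule Cauchy_Schwarz_ineq2)
    then show "(norm (entry (mat_vec A x) i))\<^sup>2 \<le> (norm (mat_row A i) * norm x)\<^sup>2"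
      by (intro power_mono) (simp_all add: entry_mat_vec_eq_inner)
  qed
  also have "\<dots> = (norm A * norm x)\<^sup>2"
    by (simp add: norm_mat_sq[OF I] power_mult_distrib sum_distrib_right)
  finally show ?thesis by (rule power2_le_imp_le) simp
qed

lemma bounded_bilinear_mat_vec: "bounded_bilinear mat_vec"
proof
  fix A B :: rmat and x y :: rvec and r :: real
  have row: "mat_row (A + B) i = mat_row A i + mat_row B i"
    "mat_row (r *\<^sub>R A) i = r *\<^sub>R mat_row A i" for i
    by (auto intro: fsfam_eqI)
  show "mat_vec (A + B) x = mat_vec A x + mat_vec B x" "mat_vec A (x + y) = mat_vec A x + mat_vec A y"
    "mat_vec (r *\<^sub>R A) x = r *\<^sub>R mat_vec A x" "mat_vec A (r *\<^sub>R x) = r *\<^sub>R mat_vec A x"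
    by (auto intro!: fsfam_eqI simp: entry_mat_vec_eq_inner row inner_add_left inner_add_right)
  show "\<exists>K. \<forall>A x. norm (mat_vec A x) \<le> norm A * norm x * K"
    by (intro exI[of _ 1]) (simp add: norm_mat_vec_le)
qed

interpretation mat_vec: bounded_bilinear mat_vec
  by (rule bounded_bilinear_mat_vec)

lemma mat_vec_mat_mult: "mat_vec (mat_mult A B) x = mat_vec A (mat_vec B x)"
proof (rule fsfam_eqI)
  fix i
  define J where "J = fst ` {p. entry B p \<noteq> 0}"
  define X where "X = {l. entry x l \<noteq> 0}"
  have J: "finite J" "\<And>j l. j \<notin> J \<Longrightarrow> entry B (j, l) = 0"
    unfolding J_def by (auto intro!: image_eqI[of _ fst])
  have X: "finite X" "\<And>l. l \<notin> X \<Longrightarrow> entry x l = 0" unfolding X_def by auto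
  have Bx: "entry (mat_vec B x) j = (\<Sum>l\<in>X. entry B (j, l) * entry x l)" for j
    using X by (intro entry_mat_vec) auto
  have "entry (mat_vec (mat_mult A B) x) i = (\<Sum>l\<in>X. entry (mat_mult A B) (i, l) * entry x l)"
    using X by (intro entry_mat_vec) auto
  also have "\<dots> = (\<Sum>l\<in>X. (\<Sum>j\<in>J. entry A (i, j) * entry B (j, l)) * entry x l)"
    using J by (intro sum.cong refl arg_cong2[of _ _ _ _ "(*)"] entry_mat_mult) auto
  also have "\<dots> = (\<Sum>l\<in>X. \<Sum>j\<in>J. entry A (i, j) * (entry B (j, l) * entry x l))"
    by (simp add: sum_distrib_right mult.assoc)
  also have "\<dots> = (\<Sum>j\<in>J. \<Sum>l\<in>X. entry A (i, j) * (entry B (j, l) * entry x l))"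
    by (rule sum.swap)
  also have "\<dots> = (\<Sum>j\<in>J. entry A (i, j) * entry (mat_vec B x) j)"
    by (simp add: Bx sum_distrib_left)
  also have "\<dots> = entry (mat_vec A (mat_vec B x)) i"
    using J Bx by (intro entry_mat_vec[symmetric]) auto
  finally show "entry (mat_vec (mat_mult A B) x) i = entry (mat_vec A (mat_vec B x)) i" .
qed

lemma entry_mat_vec_id_mat: "entry (mat_vec (id_mat n) x) i = (if i < n then entry x i else 0)"
proof -
  have "entry (mat_vec (id_mat n) x) i = (\<Sum>j\<in>{i}. entry (id_mat n) (i, j) * entry x j)"
    by (rule entry_mat_vec) (auto simp: id_mat.rep_eq)
  then show ?thesis by (simp add: id_mat.rep_eq)
qed

lemma mat_vec_id_mat [simp]: "x \<in> Rvec n \<Longrightarrow> mat_vec (id_mat n) x = x"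
  by (intro fsfam_eqI) (auto simp: entry_mat_vec_id_mat Rvec_def)

lemma id_mat_in_Rvec: "mat_vec (id_mat n) x \<in> Rvec n"
  by (auto simp: Rvec_def entry_mat_vec_id_mat split: if_splits)

lemma norm_mat_vec_id_mat: "norm (mat_vec (id_mat n) x) \<le> norm x"
proof -
  let ?X = "{l. entry x l \<noteq> 0}"
  have "(norm (mat_vec (id_mat n) x))\<^sup>2 = (\<Sum>i\<in>?X. (norm (entry (mat_vec (id_mat n) x) i))\<^sup>2)"
    by (rule norm_fsfam_sq) (auto simp: entry_mat_vec_id_mat)
  also have "\<dots> \<le> (\<Sum>i\<in>?X. (norm (entry x i))\<^sup>2)"
    by (rule sum_mono) (auto simp: entry_mat_vec_id_mat)
  also have "\<dots> = (norm x)\<^sup>2"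
    by (rule norm_fsfam_sq[symmetric]) auto
  finally show ?thesis by (rule power2_le_imp_le) simp
qed

lemma mat_vec_in_Rvec: "A \<in> Rmat m n \<Longrightarrow> mat_vec A x \<in> Rvec m"
proof -
  assume A: "A \<in> Rmat m n"
  have "entry (mat_vec A x) i = 0" if "\<not> i < m" for i
  proof -
    have "entry A (i, j) = 0" for j using A that unfolding Rmat_def by blast
    then show ?thesis by (simp add: mat_vec.rep_eq)
  qed
  then show ?thesis unfolding Rvec_def by blast
qed

lemma id_mat_in_Rmat: "id_mat n \<in> Rmat n n"
  by (auto simp: Rmat_def id_mat.rep_eq split: if_splits)

lemma mat_mult_in_Rmat:
  assumes "A \<in> Rmat m k" "B \<in> Rmat k n"
  shows "mat_mult A B \<in> Rmat m n"
proof -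
  have "i < m \<and> l < n" if "entry (mat_mult A B) (i, l) \<noteq> 0" for i l
  proof -
    have "(\<Sum>j | entry B (j, l) \<noteq> 0. entry A (i, j) * entry B (j, l)) \<noteq> 0"
      using that by (simp add: mat_mult.rep_eq)
    then obtain j where "entry A (i, j) * entry B (j, l) \<noteq> 0"
      by (rule sum.not_neutral_contains_not_neutral)
    then show ?thesis using assms by (auto simp: Rmat_def)
  qed
  then show ?thesis by (simp add: Rmat_def)
qed

lemma mat_pow_in_Rmat: "A \<in> Rmat n n \<Longrightarrow> mat_pow n A k \<in> Rmat n n"
  by (induction k) (auto intro: id_mat_in_Rmat mat_mult_in_Rmat)

text \<open>The zeroth power is the identity of dimension \<open>n\<close>, which truncates vectors
  of larger support; hence the extra \<open>id_mat n\<close> on the right.\<close>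

lemma mat_vec_mat_pow: "mat_vec (mat_pow n A k) x = (mat_vec A ^^ k) (mat_vec (id_mat n) x)"
  by (induction k) (auto simp: mat_vec_mat_mult)

lemma mat_vec_funpow_in_Rvec: "A \<in> Rmat n n \<Longrightarrow> x \<in> Rvec n \<Longrightarrow> (mat_vec A ^^ k) x \<in> Rvec n"
  by (cases k) (auto intro: mat_vec_in_Rvec)

section \<open>The spectral norm\<close>

lemma norm_mat_vec_snorm: "norm (mat_vec A x) \<le> snorm A * norm x"
  unfolding snorm_def by (rule onorm) (rule mat_vec.bounded_linear_right)

lemma snorm_leI: "0 \<le> b \<Longrightarrow> (\<And>x. norm (mat_vec A x) \<le> b * norm x) \<Longrightarrow> snorm A \<le> b"
  unfolding snorm_def by (rule onorm_bound)

lemma snorm_nonneg [simp]: "0 \<le> snorm A"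
  unfolding snorm_def by (rule onorm_pos_le) (rule mat_vec.bounded_linear_right)

lemma snorm_le_iff: "snorm A \<le> b \<longleftrightarrow> 0 \<le> b \<and> (\<forall>x. norm (mat_vec A x) \<le> b * norm x)"
  by (meson snorm_leI snorm_nonneg norm_mat_vec_snorm mult_right_mono norm_ge_zero order_trans)

text \<open>Apply the matrix to its own row: the entry obtained is the squared norm of that
  row.\<close>

lemma norm_mat_row_le_snorm: "norm (mat_row A i) \<le> snorm A"
proof -
  let ?r = "mat_row A i"
  have "norm ?r * norm ?r = \<bar>entry (mat_vec A ?r) i\<bar>"
    by (simp add: entry_mat_vec_eq_inner norm_eq_sqrt_inner)
  also have "\<dots> \<le> norm (mat_vec A ?r)"
    using norm_entry_le[of "mat_vec A ?r" i] by simp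
  also have "\<dots> \<le> snorm A * norm ?r" by (rule norm_mat_vec_snorm)
  finally show ?thesis
    by (cases "norm ?r = 0") (auto simp: mult_le_cancel_right)
qed

lemma norm_mat_sq_le_snorm:
  assumes "A \<in> Rmat m n"
  shows "(norm A)\<^sup>2 \<le> real m * (snorm A)\<^sup>2"
proof -
  have "(norm A)\<^sup>2 = (\<Sum>i<m. (norm (mat_row A i))\<^sup>2)"
    using assms by (intro norm_mat_sq) (auto simp: Rmat_def)
  also have "\<dots> \<le> (\<Sum>i<m. (snorm A)\<^sup>2)"
    by (intro sum_mono power_mono norm_mat_row_le_snorm) simp
  finally show ?thesis by simp
qed

section \<open>Sup-norm balls and shrunken sets\<close>

lemma abs_entry_le_linf: "\<bar>entry x i\<bar> \<le> linf x"
proof -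
  have "range (\<lambda>i. \<bar>entry x i\<bar>) \<subseteq> insert 0 ((\<lambda>i. \<bar>entry x i\<bar>) ` {i. entry x i \<noteq> 0})"
    by auto
  then have "bdd_above (range (\<lambda>i. \<bar>entry x i\<bar>))"
    by (rule bdd_above_finite[OF finite_subset]) (intro finite.insertI finite_imageI finite_support)
  then show ?thesis unfolding linf_def by (intro cSUP_upper) auto
qed

lemma linf_le_iff: "linf x \<le> r \<longleftrightarrow> (\<forall>i. \<bar>entry x i\<bar> \<le> r)"
proof
  show "\<forall>i. \<bar>entry x i\<bar> \<le> r" if "linf x \<le> r"
    using that abs_entry_le_linf order_trans by blast
  show "linf x \<le> r" if "\<forall>i. \<bar>entry x i\<bar> \<le> r"
    unfolding linf_def using that by (intro cSUP_least) auto
qed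

lemma linf_ball_iff: "x \<in> linf_ball d r \<longleftrightarrow> x \<in> Rvec d \<and> (\<forall>i. \<bar>entry x i\<bar> \<le> r)"
  by (simp add: linf_ball_def linf_le_iff)

lemma linf_ball_normI: "x \<in> Rvec d \<Longrightarrow> norm x \<le> r \<Longrightarrow> x \<in> linf_ball d r"
  unfolding linf_ball_iff using norm_entry_le[of x] by (auto intro: order_trans)

lemma norm_linf_ball:
  assumes "x \<in> linf_ball d r"
  shows "norm x \<le> sqrt (real d) * r"
proof -
  have r: "0 \<le> r" using assms unfolding linf_ball_iff by (meson abs_ge_zero order_trans)
  have "(norm x)\<^sup>2 = (\<Sum>i<d. (norm (entry x i))\<^sup>2)"
    using assms by (intro norm_fsfam_sq) (auto simp: linf_ball_iff Rvec_def)
  also have "\<dots> \<le> (\<Sum>i<d. r\<^sup>2)"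
    using assms by (intro sum_mono power_mono) (auto simp: linf_ball_iff)
  also have "\<dots> = (sqrt (real d) * r)\<^sup>2" by (simp add: power_mult_distrib)
  finally show ?thesis by (rule power2_le_imp_le) (use r in simp)
qed

lemma zero_in_linf_ball: "0 \<le> r \<Longrightarrow> 0 \<in> linf_ball d r"
  by (simp add: linf_ball_iff subspace_0)

lemma closed_shrink:
  assumes "closed X"
  shows "closed (shrink d r X)"
proof -
  have "shrink d r X = X \<inter> (\<Inter>y\<in>linf_ball d r. (\<lambda>x. x + y) -` X)"
    by (auto simp: shrink_def)
  then show ?thesis using assms
    by (simp only:) (intro closed_Int closed_INT ballI closed_vimage continuous_on_add
        continuous_on_id continuous_on_const)
qed

lemma convex_shrink:
  assumes "convex X"
  shows "convex (shrink d r X)"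
proof (rule convexI)
  fix x y and u v :: real
  assume *: "x \<in> shrink d r X" "y \<in> shrink d r X" "0 \<le> u" "0 \<le> v" "u + v = 1"
  have "u *\<^sub>R x + v *\<^sub>R y + z \<in> X" if "z \<in> linf_ball d r" for z
  proof -
    have "u *\<^sub>R (x + z) + v *\<^sub>R (y + z) \<in> X"
      using * that by (intro convexD[OF assms]) (auto simp: shrink_def)
    moreover have "u *\<^sub>R (x + z) + v *\<^sub>R (y + z) = u *\<^sub>R x + v *\<^sub>R y + (u + v) *\<^sub>R z"
      by (simp add: algebra_simps)
    ultimately show ?thesis using * by simp
  qed
  moreover have "u *\<^sub>R x + v *\<^sub>R y \<in> X"
    using * by (intro convexD[OF assms]) (auto simp: shrink_def)
  ultimately show "u *\<^sub>R x + v *\<^sub>R y \<in> shrink d r X" by (simp add: shrink_def)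
qed

text \<open>This is how the margin of the strictly safe policy pays for the perturbation \<open>e\<close>
  and for the shrinkage \<open>\<epsilon>\<close>.\<close>

lemma convex_combination_in_shrink:
  assumes X: "convex X" and x: "x \<in> X" and y: "y \<in> shrink d \<epsilon>s X" and l: "0 \<le> l" "l \<le> 1"
    and e: "e \<in> linf_ball d \<delta>" and "0 \<le> \<epsilon>" "0 < \<epsilon>s" "\<epsilon> + \<delta> \<le> l * \<epsilon>s"
  shows "(1 - l) *\<^sub>R x + l *\<^sub>R y + e \<in> shrink d \<epsilon> X"
proof -
  have main: "(1 - l) *\<^sub>R x + l *\<^sub>R y + e + z \<in> X" if z: "z \<in> linf_ball d \<epsilon>" for z
  proof -
    \<comment> \<open>The whole perturbation \<open>e + z\<close> is loaded onto \<open>y\<close>.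
      Its entries are at most \<open>l * \<epsilon>s\<close>, so after division by the weight of
      \<open>y\<close> it still fits into the margin of \<open>y\<close>.\<close>
    let ?b = "(1 / l) *\<^sub>R (e + z)"
    have b: "\<bar>entry (e + z) i\<bar> \<le> l * \<epsilon>s" for i
    proof -
      have "\<bar>entry e i\<bar> \<le> \<delta>" "\<bar>entry z i\<bar> \<le> \<epsilon>"
        using e z by (auto simp: linf_ball_iff)
      moreover have "\<bar>entry (e + z) i\<bar> \<le> \<bar>entry e i\<bar> + \<bar>entry z i\<bar>"
        by (simp only: plus_fsfam.rep_eq abs_triangle_ineq)
      ultimately show ?thesis using assms(9) by linarith
    qed
    have "?b \<in> linf_ball d \<epsilon>s"
      unfolding linf_ball_iff
    proof
      show "?b \<in> Rvec d"
        using e z unfolding linf_ball_iff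
        by (intro subspace_scale subspace_add subspace_Rvec) blast+
      show "\<forall>i. \<bar>entry ?b i\<bar> \<le> \<epsilon>s"
      proof
        fix i
        show "\<bar>entry ?b i\<bar> \<le> \<epsilon>s"
        proof (cases "l = 0")
          case False
          then have "l > 0" using l by simp
          moreover have "\<bar>entry ?b i\<bar> = \<bar>entry (e + z) i\<bar> / l"
            using l by (simp add: abs_mult)
          ultimately show ?thesis
            using b[of i] by (simp only: pos_divide_le_eq mult.commute)
        qed (use assms(8) in simp)
      qed
    qed
    then have "y + ?b \<in> X" using y by (simp add: shrink_def)
    then have "(1 - l) *\<^sub>R x + l *\<^sub>R (y + ?b) \<in> X"
      using l x by (intro convexD[OF X]) simp_all
    moreover have "l *\<^sub>R ?b = e + z"
    proof (cases "l = 0")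
      \<comment> \<open>Here \<open>1 / l\<close> is 0 by convention, and the bound
        \<open>l * \<epsilon>s\<close> on the entries forces \<open>e + z = 0\<close>.\<close>
      case True
      then have "entry (e + z) i = 0" for i using b[of i] by (simp only: mult_zero_left abs_le_zero_iff)
      then have "e + z = 0" by (intro fsfam_eqI) (simp only: zero_fsfam.rep_eq)
      then show ?thesis using True by simp
    qed simp
    ultimately show ?thesis by (simp add: scaleR_right_distrib add.assoc)
  qed
  from main[OF zero_in_linf_ball[OF assms(7)]] main show ?thesis
    by (simp add: shrink_def)
qed

text \<open>Blocks are counted from 0 here, but lags from 1, hence the argument \<open>k - 1\<close>
  wherever a stacked vector is read as a window.\<close>

definition block_of :: "nat \<Rightarrow> rvec \<Rightarrow> nat \<Rightarrow> rvec" where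
  "block_of n z k = Fsfam (\<lambda>j. if j < n then entry z (k * n + j) else 0)"

lemma entry_block_of [simp]: "entry (block_of n z k) j = (if j < n then entry z (k * n + j) else 0)"
proof -
  have "finite {j. (if j < n then entry z (k * n + j) else 0) \<noteq> 0}"
    by (rule finite_subset[of _ "{..<n}"]) (auto split: if_splits)
  then show ?thesis by (simp add: block_of_def Fsfam_inverse)
qed

lemma block_of_in_linf_ball: "z \<in> linf_ball d r \<Longrightarrow> block_of n z k \<in> linf_ball n r"
  unfolding linf_ball_iff Rvec_def by (auto intro: order_trans[OF abs_ge_zero])

lemma mat_vec_block_row:
  "mat_vec (block_row n N F) z = (\<Sum>k=1..N. mat_vec (F k) (block_of n z (k - 1)))"
proof (rule fsfam_eqI)
  fix i
  have "entry (mat_vec (block_row n N F) z) i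
      = (\<Sum>j<N * n. entry (block_row n N F) (i, j) * entry z j)"
  proof (rule entry_mat_vec)
    show "entry (block_row n N F) (i, j) = 0 \<or> entry z j = 0" if "j \<notin> {..<N * n}" for j
      using that by (simp add: block_row.rep_eq)
  qed simp
  also have "\<dots> = (\<Sum>k<N. \<Sum>j<n. entry (block_row n N F) (i, j + k * n) * entry z (j + k * n))"
  proof -
    let ?g = "\<lambda>j. entry (block_row n N F) (i, j) * entry z j"
    have "sum ?g {..<N * n} = (\<Sum>k<N. sum ?g {k * n..<k * n + n})"
      by (rule sum.nat_group[symmetric])
    also have "\<dots> = (\<Sum>k<N. \<Sum>j<n. ?g (j + k * n))"
    proof (rule sum.cong[OF refl])
      fix k
      show "sum ?g {k * n..<k * n + n} = (\<Sum>j<n. ?g (j + k * n))"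
        using sum.shift_bounds_nat_ivl[of ?g 0 "k * n" n]
        by (simp only: lessThan_atLeast0 add_0 add.commute[of n])
    qed
    finally show ?thesis .
  qed
  also have "\<dots> = (\<Sum>k<N. \<Sum>j<n. entry (F (Suc k)) (i, j) * entry (block_of n z k) j)"
  proof (intro sum.cong refl)
    fix k j assume "k \<in> {..<N}" "j \<in> {..<n}"
    then have kj: "k < N" "j < n" by auto
    have "k * n + j < k * n + n" using kj by simp
    also have "\<dots> = Suc k * n" by simp
    also have "\<dots> \<le> N * n" using kj by (intro mult_right_mono) auto
    finally have "k * n + j < N * n" .
    then show "entry (block_row n N F) (i, j + k * n) * entry z (j + k * n)
        = entry (F (Suc k)) (i, j) * entry (block_of n z k) j"
      using kj by (simp add: block_row.rep_eq add.commute)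
  qed
  also have "\<dots> = (\<Sum>k<N. entry (mat_vec (F (Suc k)) (block_of n z k)) i)"
    by (rule sum.cong[OF refl], rule entry_mat_vec[symmetric]) auto
  also have "\<dots> = entry (\<Sum>k=1..N. mat_vec (F k) (block_of n z (k - 1))) i"
    by (simp add: sum.atLeast1_atMost_eq lessThan_atLeast0)
  finally show "entry (mat_vec (block_row n N F) z) i
      = entry (\<Sum>k=1..N. mat_vec (F k) (block_of n z (k - 1))) i" .
qed

section \<open>Geometric sums\<close>

lemma geometric_sum_le:
  fixes \<gamma> :: real
  assumes "0 < \<gamma>" "\<gamma> \<le> 1"
  shows "(\<Sum>i<N. (1 - \<gamma>) ^ i) \<le> 1 / \<gamma>"
proof -
  have "\<gamma> * (\<Sum>i<N. (1 - \<gamma>) ^ i) = 1 - (1 - \<gamma>) ^ N"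
    by (induction N) (simp_all add: algebra_simps)
  also have "\<dots> \<le> 1" using assms by simp
  finally show ?thesis using assms(1) by (simp add: field_simps)
qed

text \<open>The tail is written with a case distinction because the sums below run over all past
  ages \<open>i < N\<close>, whether or not \<open>N\<close> exceeds \<open>H\<close>.\<close>

lemma geometric_tail_le:
  fixes \<gamma> :: real
  assumes "0 < \<gamma>" "\<gamma> \<le> 1"
  shows "(\<Sum>i<N. if i < H then 0 else (1 - \<gamma>) ^ i) \<le> (1 - \<gamma>) ^ H / \<gamma>"
proof -
  have "(\<Sum>i<N. if i < H then 0 else (1 - \<gamma>) ^ i) = (\<Sum>i\<in>{H..<N}. (1 - \<gamma>) ^ i)"
    by (rule sum.mono_neutral_cong_right) auto
  also have "\<dots> = (\<Sum>i\<in>{H..<H + (N - H)}. (1 - \<gamma>) ^ i)"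
    by (rule sum.cong) auto
  also have "\<dots> = (\<Sum>i<N - H. (1 - \<gamma>) ^ (i + H))"
    using sum.shift_bounds_nat_ivl[of "\<lambda>i. (1 - \<gamma>) ^ i" 0 H "N - H"]
    by (simp add: lessThan_atLeast0 add.commute)
  also have "\<dots> = (1 - \<gamma>) ^ H * (\<Sum>i<N - H. (1 - \<gamma>) ^ i)"
    by (simp add: power_add sum_distrib_left mult.commute)
  also have "\<dots> \<le> (1 - \<gamma>) ^ H * (1 / \<gamma>)"
    using assms by (intro mult_left_mono geometric_sum_le) auto
  finally show ?thesis by simp
qed

text \<open>The weight \<open>Suc i\<close> will be the number of descent steps made since a policy
  was in force. After multiplication by \<open>\<gamma>\<^sup>2\<close> the sum has an exact closed
  form, which the induction proves.\<close>

lemma arith_geometric_sum_le: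
  fixes \<gamma> :: real
  assumes "0 < \<gamma>" "\<gamma> \<le> 1"
  shows "(\<Sum>i<N. real (Suc i) * (1 - \<gamma>) ^ i) \<le> 1 / \<gamma>\<^sup>2"
proof -
  have "\<gamma>\<^sup>2 * (\<Sum>i<N. real (Suc i) * (1 - \<gamma>) ^ i) = 1 - (1 + real N * \<gamma>) * (1 - \<gamma>) ^ N"
    by (induction N) (simp_all add: algebra_simps power2_eq_square)
  also have "\<dots> \<le> 1" using assms by simp
  finally show ?thesis using assms(1) by (simp add: field_simps)
qed

section \<open>Linear systems\<close>

lemma linear_funpow: "linear f \<Longrightarrow> linear (f ^^ k)" for f :: "'a::real_vector \<Rightarrow> 'a"
  by (induction k) (auto simp: linear_id[unfolded id_def] linear_compose id_def intro: linear_compose)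

lemma bounded_linear_funpow: "bounded_linear f \<Longrightarrow> bounded_linear (f ^^ k)"
  for f :: "'a::real_normed_vector \<Rightarrow> 'a"
proof (induction k)
  case (Suc k)
  then show ?case using bounded_linear_compose[of f "f ^^ k"] by (simp add: o_def)
qed (simp add: id_def)

text \<open>Discrete variation of constants.\<close>

lemma linear_recurrence_solution:
  fixes \<Phi> :: "'a::real_vector \<Rightarrow> 'a"
  assumes "linear \<Phi>" "x 0 = 0" "\<And>t. x (Suc t) = \<Phi> (x t) + v t"
  shows "x t = (\<Sum>i<t. (\<Phi> ^^ i) (v (t - 1 - i)))"
proof (induction t)
  case (Suc t)
  have "x (Suc t) = v t + \<Phi> (\<Sum>i<t. (\<Phi> ^^ i) (v (t - 1 - i)))"
    using assms(3) Suc.IH by simp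
  also have "\<dots> = v t + (\<Sum>i<t. (\<Phi> ^^ Suc i) (v (t - Suc i)))"
    using linear_sum[OF assms(1)] by simp
  also have "\<dots> = (\<Sum>i<Suc t. (\<Phi> ^^ i) (v (Suc t - 1 - i)))"
    by (subst sum.lessThan_Suc_shift) simp
  finally show ?case .
qed (simp add: assms(2))

lemma Acl_in_Rmat:
  assumes "plant_ok S" "K \<in> Rmat (dimu S) (dimx S)"
  shows "Acl S K \<in> Rmat (dimx S) (dimx S)"
  unfolding Acl_def using assms
  by (intro subspace_diff[OF subspace_Rmat] mat_mult_in_Rmat) (auto simp: plant_ok_def)

lemma mat_vec_Acl: "mat_vec (Acl S K) x = mat_vec (Amat S) x - mat_vec (Bmat S) (mat_vec K x)"
  by (simp add: Acl_def mat_vec.diff_left mat_vec_mat_mult)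

lemma linear_mat_vec [simp]: "linear (mat_vec A)"
  by (rule bounded_linear.linear[OF mat_vec.bounded_linear_right])

lemma lin_state_eq:
  "lin_state S K w t = (\<Sum>i<t. (mat_vec (Acl S K) ^^ i) (w (t - 1 - i)))"
proof (rule linear_recurrence_solution)
  show "lin_state S K w (Suc t) = mat_vec (Acl S K) (lin_state S K w t) + w t" for t
    by (simp add: mat_vec_Acl mat_vec.minus_right)
qed simp_all

locale control_plant =
  fixes S :: plant
  assumes plant: "plant_ok S"
begin

abbreviation "n \<equiv> dimx S"
abbreviation "m \<equiv> dimu S"
abbreviation "\<kappa> \<equiv> kappa S"
abbreviation "\<gamma> \<equiv> gamma S"
abbreviation "\<kappa>B \<equiv> kappaB S"
abbreviation "a \<equiv> acoef S"
abbreviation "\<Phi> K \<equiv> mat_vec (Acl S K)"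

lemma n_pos: "n \<ge> 1" and m_pos: "m \<ge> 1" and wbar_nonneg: "0 \<le> wbar S"
  and kappa_gt1: "1 < \<kappa>" and gamma_pos: "0 < \<gamma>" and gamma_le1: "\<gamma> \<le> 1"
  and Bmat_in: "Bmat S \<in> Rmat n m"
  using plant by (auto simp: plant_ok_def)

lemma kappa_pos: "0 < \<kappa>" using kappa_gt1 by simp

lemma a_pos: "0 < a" using kappa_pos by (simp add: acoef_def)

lemma kappaB_ge1: "1 \<le> \<kappa>B" by (simp add: kappaB_def)

lemma norm_Bmat_le: "norm (mat_vec (Bmat S) u) \<le> \<kappa>B * norm u"
proof -
  have "snorm (Bmat S) * norm u \<le> \<kappa>B * norm u"
    by (intro mult_right_mono) (auto simp: kappaB_def)
  then show ?thesis using norm_mat_vec_snorm order_trans by blast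
qed

lemma strongly_stable_in: "strongly_stable S K \<Longrightarrow> K \<in> Rmat m n"
  by (simp add: strongly_stable_def)

lemma strongly_stable_Acl_in: "strongly_stable S K \<Longrightarrow> Acl S K \<in> Rmat n n"
  by (intro Acl_in_Rmat plant strongly_stable_in)

lemma strongly_stable_norm:
  assumes "strongly_stable S K"
  shows "norm (mat_vec K x) \<le> \<kappa> * norm x"
proof -
  have "snorm K * norm x \<le> \<kappa> * norm x"
    using assms by (intro mult_right_mono) (auto simp: strongly_stable_def)
  then show ?thesis using norm_mat_vec_snorm order_trans by blast
qed

text \<open>The powers of \<open>P L Q\<close> collapse to \<open>P L^k Q\<close>; the outer factors
  cost one \<kappa> each, and \<open>L\<close> contracts by 1 - \<gamma> in each step.\<close>

lemma strongly_stable_funpow: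
  assumes K: "strongly_stable S K" and x: "x \<in> Rvec n"
  shows "norm ((\<Phi> K ^^ k) x) \<le> \<kappa>\<^sup>2 * (1 - \<gamma>) ^ k * norm x"
proof -
  obtain L P Q where LPQ: "P \<in> Rmat n n" "L \<in> Rmat n n" "Q \<in> Rmat n n" "mat_mult P Q = id_mat n" "mat_mult Q P = id_mat n"
    "Acl S K = mat_mult P (mat_mult L Q)" "snorm L \<le> 1 - \<gamma>" "snorm P \<le> \<kappa>" "snorm Q \<le> \<kappa>"
    using K unfolding strongly_stable_def by auto
  have QP: "mat_vec Q (mat_vec P y) = y" if "y \<in> Rvec n" for y
    using that by (simp flip: mat_vec_mat_mult add: LPQ)
  have PQ: "mat_vec P (mat_vec Q y) = y" if "y \<in> Rvec n" for y
    using that by (simp flip: mat_vec_mat_mult add: LPQ)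
  \<comment> \<open>\<open>Q P\<close> acts as the identity only on \<open>Rvec n\<close>, so the
    iterates have to stay there for the inner factors to cancel.\<close>
  have Lk: "(mat_vec L ^^ k) (mat_vec Q x) \<in> Rvec n" for k
    by (intro mat_vec_funpow_in_Rvec LPQ mat_vec_in_Rvec[OF LPQ(3)])
  have "(\<Phi> K ^^ k) x = mat_vec P ((mat_vec L ^^ k) (mat_vec Q x))"
  proof (induction k)
    case (Suc k)
    show ?case
      by (simp add: Suc.IH, subst LPQ(6)) (simp add: mat_vec_mat_mult QP[OF Lk])
  qed (simp add: PQ x)
  moreover have "norm ((mat_vec L ^^ k) y) \<le> (1 - \<gamma>) ^ k * norm y" for y
  proof (induction k)
    case (Suc k)
    have "norm (mat_vec L ((mat_vec L ^^ k) y)) \<le> snorm L * norm ((mat_vec L ^^ k) y)"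
      by (rule norm_mat_vec_snorm)
    also have "\<dots> \<le> (1 - \<gamma>) * ((1 - \<gamma>) ^ k * norm y)"
      using LPQ(7) gamma_le1 by (intro mult_mono Suc.IH) auto
    finally show ?case by simp
  qed simp
  ultimately have "norm ((\<Phi> K ^^ k) x) \<le> snorm P * ((1 - \<gamma>) ^ k * (snorm Q * norm x))"
    using norm_mat_vec_snorm[of P "(mat_vec L ^^ k) (mat_vec Q x)"] norm_mat_vec_snorm[of Q x] gamma_le1
    by (smt (verit) mult_left_mono snorm_nonneg zero_le_power)
  also have "\<dots> \<le> \<kappa> * ((1 - \<gamma>) ^ k * (\<kappa> * norm x))"
    using LPQ(8,9) gamma_le1 kappa_pos by (intro mult_mono) auto
  finally show ?thesis by (simp add: power2_eq_square algebra_simps)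
qed

lemma funpow_in_Rvec: "strongly_stable S K \<Longrightarrow> x \<in> Rvec n \<Longrightarrow> (\<Phi> K ^^ k) x \<in> Rvec n"
  by (intro mat_vec_funpow_in_Rvec strongly_stable_Acl_in)

text \<open>The gain of a strongly stable loop for bounded forcing: \<kappa>^2 times a geometric
  series, whatever the number of steps.\<close>

lemma norm_resolvent_le:
  assumes K: "strongly_stable S K" and x: "\<And>i. i < N \<Longrightarrow> x i \<in> Rvec n \<and> norm (x i) \<le> b" and b: "0 \<le> b"
  shows "norm (\<Sum>i<N. (\<Phi> K ^^ i) (x i)) \<le> \<kappa>\<^sup>2 / \<gamma> * b"
proof -
  have "norm (\<Sum>i<N. (\<Phi> K ^^ i) (x i)) \<le> (\<Sum>i<N. \<kappa>\<^sup>2 * b * (1 - \<gamma>) ^ i)"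
  proof (rule sum_norm_le)
    fix i assume "i \<in> {..<N}"
    then have xi: "x i \<in> Rvec n" "norm (x i) \<le> b" using x by auto
    have "norm ((\<Phi> K ^^ i) (x i)) \<le> \<kappa>\<^sup>2 * (1 - \<gamma>) ^ i * norm (x i)"
      by (rule strongly_stable_funpow[OF K xi(1)])
    also have "\<dots> \<le> \<kappa>\<^sup>2 * (1 - \<gamma>) ^ i * b"
      using gamma_le1 xi(2) by (intro mult_left_mono) auto
    finally show "norm ((\<Phi> K ^^ i) (x i)) \<le> \<kappa>\<^sup>2 * b * (1 - \<gamma>) ^ i" by (simp add: mult_ac)
  qed
  also have "\<dots> = \<kappa>\<^sup>2 * b * (\<Sum>i<N. (1 - \<gamma>) ^ i)" by (simp add: sum_distrib_left)
  also have "\<dots> \<le> \<kappa>\<^sup>2 * b * (1 / \<gamma>)"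
    using b by (intro mult_left_mono geometric_sum_le gamma_pos gamma_le1) auto
  finally show ?thesis by simp
qed

section \<open>The response of a disturbance-action policy\<close>

text \<open>\<open>z k\<close> stands for the disturbance \<open>k\<close> steps back. Both the
  realized lags in the approximate cost and the blocks of an arbitrary vector in
  \<open>Omega\<close> are instances.\<close>

definition respx :: "rmat \<Rightarrow> nat \<Rightarrow> policy \<Rightarrow> (nat \<Rightarrow> rvec) \<Rightarrow> rvec" where
  "respx K H M z = (\<Sum>k=1..2*H. mat_vec (Psix S K H M k) (z k))"

definition respu :: "rmat \<Rightarrow> nat \<Rightarrow> policy \<Rightarrow> (nat \<Rightarrow> rvec) \<Rightarrow> rvec" where
  "respu K H M z = (\<Sum>k=1..2*H. mat_vec (Psiu S K H M k) (z k))"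

text \<open>The part of the response that is linear in the policy. What remains of
  \<open>respx\<close> is the response of the loop to the disturbances alone, which does not involve
  \<open>M\<close>.\<close>

definition linx :: "rmat \<Rightarrow> nat \<Rightarrow> policy \<Rightarrow> (nat \<Rightarrow> rvec) \<Rightarrow> rvec" where
  "linx K H M z = (\<Sum>i<H. (\<Phi> K ^^ i)
     (mat_vec (Bmat S) (\<Sum>j<H. mat_vec (entry M (Suc j)) (z (Suc i + Suc j)))))"

definition linu :: "rmat \<Rightarrow> nat \<Rightarrow> policy \<Rightarrow> (nat \<Rightarrow> rvec) \<Rightarrow> rvec" where
  "linu K H M z = (\<Sum>j<H. mat_vec (entry M (Suc j)) (z (Suc j))) - mat_vec K (linx K H M z)"

lemma Psix_apply:
  assumes "v \<in> Rvec n"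
  shows "mat_vec (Psix S K H M k) v = (if k \<le> H then (\<Phi> K ^^ (k - 1)) v else 0)
    + (\<Sum>i=1..H. if 1 \<le> k - i \<and> k - i \<le> H
        then (\<Phi> K ^^ (i - 1)) (mat_vec (Bmat S) (mat_vec (entry M (k - i)) v)) else 0)"
proof -
  have B: "mat_vec (id_mat n) (mat_vec (Bmat S) u) = mat_vec (Bmat S) u" for u
    by (intro mat_vec_id_mat mat_vec_in_Rvec[OF Bmat_in])
  show ?thesis unfolding Psix_def
    by (simp add: mat_vec.add_left mat_vec.sum_left mat_vec_mat_mult mat_vec_mat_pow B assms
        if_distrib[of "\<lambda>A. mat_vec A v"] mat_vec.zero_left cong: if_cong)
qed

lemma respx_eq:
  assumes z: "\<And>k. z k \<in> Rvec n"
  shows "respx K H M z = (\<Sum>i<H. (\<Phi> K ^^ i) (z (Suc i))) + linx K H M z"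
proof -
  let ?g = "\<lambda>i k. (\<Phi> K ^^ (i - 1)) (mat_vec (Bmat S) (mat_vec (entry M (k - i)) (z k)))"
  have "respx K H M z = (\<Sum>k=1..2*H. if k \<le> H then (\<Phi> K ^^ (k - 1)) (z k) else 0)
      + (\<Sum>k=1..2*H. \<Sum>i=1..H. if 1 \<le> k - i \<and> k - i \<le> H then ?g i k else 0)"
    by (simp only: respx_def Psix_apply[OF z] sum.distrib)
  also have "(\<Sum>k=1..2*H. if k \<le> H then (\<Phi> K ^^ (k - 1)) (z k) else 0)
      = (\<Sum>k=1..H. (\<Phi> K ^^ (k - 1)) (z k))"
    by (rule sum.mono_neutral_cong_right) auto
  also have "\<dots> = (\<Sum>i<H. (\<Phi> K ^^ i) (z (Suc i)))"
    by (simp add: sum.atLeast1_atMost_eq)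
  also have "(\<Sum>k=1..2*H. \<Sum>i=1..H. if 1 \<le> k - i \<and> k - i \<le> H then ?g i k else 0)
      = (\<Sum>i=1..H. \<Sum>k=1..2*H. if 1 \<le> k - i \<and> k - i \<le> H then ?g i k else 0)"
    by (rule sum.swap)
  \<comment> \<open>The indicator admits exactly the lags \<open>k = i + j\<close> with
    \<open>j\<close> from 1 to \<open>H\<close>; as \<open>i\<close> is at most \<open>H\<close>,
    none of them exceeds \<open>2 * H\<close>.\<close>
  also have "\<dots> = (\<Sum>i=1..H. \<Sum>k=i+1..i+H. ?g i k)"
    by (intro sum.cong refl sum.mono_neutral_cong_right) auto
  also have "\<dots> = (\<Sum>i=1..H. \<Sum>j=1..H. ?g i (j + i))"
    using sum.shift_bounds_cl_nat_ivl[of "?g _" 1 _ H] by (simp only: add.commute)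
  also have "\<dots> = (\<Sum>i<H. \<Sum>j<H. (\<Phi> K ^^ i) (mat_vec (Bmat S) (mat_vec (entry M (Suc j)) (z (Suc i + Suc j)))))"
    by (simp add: sum.atLeast1_atMost_eq add.commute)
  also have "\<dots> = linx K H M z"
    by (simp add: linx_def mat_vec.sum_right linear_sum[OF linear_funpow[OF linear_mat_vec]])
  finally show ?thesis .
qed

lemma respu_eq_respx:
  "respu K H M z = (\<Sum>j<H. mat_vec (entry M (Suc j)) (z (Suc j))) - mat_vec K (respx K H M z)"
proof -
  have "(\<Sum>k=1..2*H. mat_vec (if k \<le> H then entry M k else 0) (z k))
      = (\<Sum>k=1..H. mat_vec (entry M k) (z k))"
    by (rule sum.mono_neutral_cong_right) (auto simp: mat_vec.zero_left)
  then show ?thesis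
    by (simp add: respu_def respx_def Psiu_def mat_vec.diff_left sum_subtractf mat_vec_mat_mult
        mat_vec.sum_right sum.atLeast1_atMost_eq)
qed

lemma respu_eq:
  assumes z: "\<And>k. z k \<in> Rvec n"
  shows "respu K H M z = - mat_vec K (\<Sum>i<H. (\<Phi> K ^^ i) (z (Suc i))) + linu K H M z"
  by (simp add: respu_eq_respx respx_eq[OF z] linu_def mat_vec.add_right)

lemma bounded_linear_linx: "bounded_linear (\<lambda>M. linx K H M z)"
  unfolding linx_def
  by (intro bounded_linear_sum bounded_linear_compose[OF bounded_linear_funpow[OF mat_vec.bounded_linear_right]]
      bounded_linear_compose[OF mat_vec.bounded_linear_right[of "Bmat S"]]
      bounded_linear_compose[OF mat_vec.bounded_linear_left] bounded_linear_entry)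

lemma bounded_linear_linu: "bounded_linear (\<lambda>M. linu K H M z)"
  unfolding linu_def
  by (intro bounded_linear_sub bounded_linear_sum bounded_linear_compose[OF mat_vec.bounded_linear_left]
      bounded_linear_entry bounded_linear_compose[OF mat_vec.bounded_linear_right bounded_linear_linx])

lemma linx_in_Rvec: "strongly_stable S K \<Longrightarrow> linx K H M z \<in> Rvec n"
  unfolding linx_def
  by (intro subspace_sum subspace_Rvec funpow_in_Rvec mat_vec_in_Rvec[OF Bmat_in])

lemma linu_in_Rvec:
  assumes "strongly_stable S K" "M \<in> policy_space H m n"
  shows "linu K H M z \<in> Rvec m"
proof -
  have "entry M j \<in> Rmat m n" for j using assms(2) by (simp add: policy_space_def)
  then show ?thesis unfolding linu_def
    by (intro subspace_diff subspace_sum subspace_Rvec mat_vec_in_Rvec[of "entry M _"]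
        mat_vec_in_Rvec[OF strongly_stable_in[OF assms(1)]])
qed

lemma respx_in_Rvec:
  assumes "strongly_stable S K" "\<And>k. z k \<in> Rvec n"
  shows "respx K H M z \<in> Rvec n"
  unfolding respx_eq[OF assms(2)] using assms
  by (intro subspace_add subspace_sum subspace_Rvec funpow_in_Rvec linx_in_Rvec)

lemma respu_in_Rvec:
  assumes "strongly_stable S K" "M \<in> policy_space H m n" "\<And>k. z k \<in> Rvec n"
  shows "respu K H M z \<in> Rvec m"
  unfolding respu_eq[OF assms(3)] using assms
  by (intro subspace_add subspace_neg subspace_Rvec linu_in_Rvec mat_vec_in_Rvec[OF strongly_stable_in])

text \<open>The policy-independent part is shared by both responses, and weights that sum to 1
  reproduce it. Convexity of \<open>Omega\<close> and of the approximate costs rests on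
  this.\<close>

lemma resp_affine:
  assumes z: "\<And>k. z k \<in> Rvec n" and uv: "u + v = 1"
  shows "respx K H (u *\<^sub>R M + v *\<^sub>R N) z = u *\<^sub>R respx K H M z + v *\<^sub>R respx K H N z"
    and "respu K H (u *\<^sub>R M + v *\<^sub>R N) z = u *\<^sub>R respu K H M z + v *\<^sub>R respu K H N z"
proof -
  note lin = bounded_linear.linear[OF bounded_linear_linx] bounded_linear.linear[OF bounded_linear_linu]
  have shift: "c + (u *\<^sub>R p + v *\<^sub>R q) = u *\<^sub>R (c + p) + v *\<^sub>R (c + q)" for c p q :: rvec
  proof -
    have "u *\<^sub>R (c + p) + v *\<^sub>R (c + q) = (u + v) *\<^sub>R c + (u *\<^sub>R p + v *\<^sub>R q)"
      by (simp add: algebra_simps)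
    then show ?thesis by (simp add: uv)
  qed
  show "respx K H (u *\<^sub>R M + v *\<^sub>R N) z = u *\<^sub>R respx K H M z + v *\<^sub>R respx K H N z"
    by (simp only: respx_eq[OF z] linear_add[OF lin(1)] linear_cmul[OF lin(1)] shift)
  show "respu K H (u *\<^sub>R M + v *\<^sub>R N) z = u *\<^sub>R respu K H M z + v *\<^sub>R respu K H N z"
    by (simp only: respu_eq[OF z] linear_add[OF lin(2)] linear_cmul[OF lin(2)] shift)
qed

lemma hx_apply: "mat_vec (hx S K H M) z = respx K H M (\<lambda>k. block_of n z (k - 1))"
  by (simp add: hx_def respx_def mat_vec_block_row)

lemma hu_apply: "mat_vec (hu S K H M) z = respu K H M (\<lambda>k. block_of n z (k - 1))"
  by (simp add: hu_def respu_def mat_vec_block_row)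

end

definition policy_of :: "nat \<Rightarrow> (nat \<Rightarrow> rmat) \<Rightarrow> policy" where
  "policy_of H F = Fsfam (\<lambda>i. if 1 \<le> i \<and> i \<le> H then F i else 0)"

lemma entry_policy_of [simp]: "entry (policy_of H F) i = (if 1 \<le> i \<and> i \<le> H then F i else 0)"
proof -
  have "finite {i. (if 1 \<le> i \<and> i \<le> H then F i else 0) \<noteq> 0}"
    by (rule finite_subset[of _ "{1..H}"]) auto
  then show ?thesis by (simp add: policy_of_def Fsfam_inverse)
qed

context control_plant
begin

section \<open>Bounds on policies and responses\<close>

lemma Mset_in_policy_space: "M \<in> Mset S H \<Longrightarrow> M \<in> policy_space H m n"
  by (simp add: Mset_def)

lemma norm_Mset_entry_le:
  assumes "M \<in> Mset S H" "j < H"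
  shows "norm (mat_vec (entry M (Suc j)) x) \<le> a * (1 - \<gamma>) ^ j * norm x"
proof -
  have "snorm (entry M (Suc j)) \<le> a * (1 - \<gamma>) ^ (Suc j - 1)"
    using assms unfolding Mset_def by (auto dest!: bspec[of _ _ "Suc j"])
  then have "snorm (entry M (Suc j)) * norm x \<le> a * (1 - \<gamma>) ^ j * norm x"
    by (intro mult_right_mono) auto
  then show ?thesis using norm_mat_vec_snorm order_trans by blast
qed

text \<open>The geometric decay of the blocks keeps this bound free of \<open>H\<close>.\<close>

lemma norm_Mset_action_le:
  assumes M: "M \<in> Mset S H" and y: "\<And>j. norm (y j) \<le> b"
  shows "norm (\<Sum>j<H. mat_vec (entry M (Suc j)) (y j)) \<le> a / \<gamma> * b"
proof -
  have b: "0 \<le> b" using y[of 0] norm_ge_zero order_trans by blast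
  have "norm (\<Sum>j<H. mat_vec (entry M (Suc j)) (y j)) \<le> (\<Sum>j<H. a * b * (1 - \<gamma>) ^ j)"
  proof (rule sum_norm_le)
    fix j assume "j \<in> {..<H}"
    then have "norm (mat_vec (entry M (Suc j)) (y j)) \<le> a * (1 - \<gamma>) ^ j * norm (y j)"
      by (intro norm_Mset_entry_le[OF M]) auto
    also have "\<dots> \<le> a * (1 - \<gamma>) ^ j * b"
      using a_pos gamma_le1 y by (intro mult_left_mono) auto
    finally show "norm (mat_vec (entry M (Suc j)) (y j)) \<le> a * b * (1 - \<gamma>) ^ j"
      by (simp add: mult_ac)
  qed
  also have "\<dots> = a * b * (\<Sum>j<H. (1 - \<gamma>) ^ j)" by (simp add: sum_distrib_left)
  also have "\<dots> \<le> a * b * (1 / \<gamma>)"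
    using b a_pos by (intro mult_left_mono geometric_sum_le gamma_pos gamma_le1) auto
  finally show ?thesis by simp
qed

text \<open>Meant for gradients and differences of policies, which need not lie in
  \<open>Mset\<close>. Without decay every block is estimated by the norm of the whole policy, at
  the price of a factor \<open>H\<close>.\<close>

lemma norm_policy_action_le:
  assumes y: "\<And>j. norm (y j) \<le> b"
  shows "norm (\<Sum>j<H. mat_vec (entry M (Suc j)) (y j)) \<le> real H * b * norm M"
proof -
  have "norm (\<Sum>j<H. mat_vec (entry M (Suc j)) (y j)) \<le> (\<Sum>j<H. norm M * b)"
  proof (rule sum_norm_le)
    fix j
    have "norm (mat_vec (entry M (Suc j)) (y j)) \<le> norm (entry M (Suc j)) * norm (y j)"
      by (rule norm_mat_vec_le)
    also have "\<dots> \<le> norm M * b"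
      by (intro mult_mono norm_entry_le y) auto
    finally show "norm (mat_vec (entry M (Suc j)) (y j)) \<le> norm M * b" .
  qed
  then show ?thesis by (simp add: mult_ac)
qed

lemma norm_linx_le:
  assumes K: "strongly_stable S K" and s: "\<And>i. norm (\<Sum>j<H. mat_vec (entry M (Suc j)) (z (Suc i + Suc j))) \<le> b"
  shows "norm (linx K H M z) \<le> \<kappa>\<^sup>2 / \<gamma> * (\<kappa>B * b)"
  unfolding linx_def
proof (rule norm_resolvent_le[OF K])
  have b: "0 \<le> b" using s[of 0] norm_ge_zero order_trans by blast
  then show "0 \<le> \<kappa>B * b" using kappaB_ge1 by simp
  fix i
  show "mat_vec (Bmat S) (\<Sum>j<H. mat_vec (entry M (Suc j)) (z (Suc i + Suc j))) \<in> Rvec n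
    \<and> norm (mat_vec (Bmat S) (\<Sum>j<H. mat_vec (entry M (Suc j)) (z (Suc i + Suc j)))) \<le> \<kappa>B * b"
  proof
    have "\<kappa>B * norm (\<Sum>j<H. mat_vec (entry M (Suc j)) (z (Suc i + Suc j))) \<le> \<kappa>B * b"
      using s kappaB_ge1 by (intro mult_left_mono) auto
    then show "norm (mat_vec (Bmat S) (\<Sum>j<H. mat_vec (entry M (Suc j)) (z (Suc i + Suc j)))) \<le> \<kappa>B * b"
      using norm_Bmat_le order_trans by blast
  qed (intro mat_vec_in_Rvec[OF Bmat_in])
qed

text \<open>The gain from the policy action to state and input together: the resolvent bound for the
  state, \<kappa> times it for the feedback in the input, and 1 for the action itself.\<close>

definition lin_gain :: real where
  "lin_gain = (1 + \<kappa>) * \<kappa>\<^sup>2 * \<kappa>B / \<gamma> + 1"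

lemma lin_gain_nonneg: "0 \<le> lin_gain"
  using kappa_pos gamma_pos kappaB_ge1 by (simp add: lin_gain_def)

lemma norm_lin_le:
  assumes K: "strongly_stable S K" and z: "\<And>k. norm (z k) \<le> W"
  shows "norm (linx K H M z) + norm (linu K H M z) \<le> lin_gain * (real H * W * norm M)"
proof -
  let ?b = "real H * W * norm M"
  have act: "norm (\<Sum>j<H. mat_vec (entry M (Suc j)) (z (Suc i + Suc j))) \<le> ?b"
    "norm (\<Sum>j<H. mat_vec (entry M (Suc j)) (z (Suc j))) \<le> ?b" for i
    by (intro norm_policy_action_le z)+
  have x: "norm (linx K H M z) \<le> \<kappa>\<^sup>2 / \<gamma> * (\<kappa>B * ?b)"
    by (rule norm_linx_le[OF K act(1)])
  have "norm (linu K H M z) \<le> ?b + \<kappa> * norm (linx K H M z)"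
    unfolding linu_def using norm_triangle_ineq4 act(2) strongly_stable_norm[OF K]
    by (smt (verit, best))
  moreover have "(1 + \<kappa>) * norm (linx K H M z) \<le> (1 + \<kappa>) * (\<kappa>\<^sup>2 / \<gamma> * (\<kappa>B * ?b))"
    using x kappa_pos by (intro mult_left_mono) auto
  moreover have "(1 + \<kappa>) * (\<kappa>\<^sup>2 / \<gamma> * (\<kappa>B * ?b)) + ?b = lin_gain * ?b"
    by (simp add: lin_gain_def algebra_simps)
  ultimately show ?thesis by (simp add: algebra_simps)
qed

text \<open>The resolvent gain times the size of the forcing per unit of disturbance: 1 for the
  disturbance, the rest for the policy action passed through \<open>Bmat S\<close>.\<close>

definition state_gain :: real where
  "state_gain = \<kappa>\<^sup>2 / \<gamma> * (1 + \<kappa>B * a / \<gamma>)"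

text \<open>The sum of the state gain and the input gain. One number bounding both is wanted because
  the cost assumption has a single radius for state and input.\<close>

definition signal_gain :: real where
  "signal_gain = (1 + \<kappa>) * state_gain + a / \<gamma>"

lemma state_gain_nonneg: "0 \<le> state_gain"
  using kappa_pos gamma_pos kappaB_ge1 a_pos by (simp add: state_gain_def)

lemma gain_le: "state_gain \<le> signal_gain" "\<kappa> * state_gain + a / \<gamma> \<le> signal_gain"
  using state_gain_nonneg kappa_pos a_pos gamma_pos by (auto simp: signal_gain_def algebra_simps)

lemma signal_gain_nonneg: "0 \<le> signal_gain"
  using gain_le(1) state_gain_nonneg by linarith

lemma norm_resp_le:
  assumes K: "strongly_stable S K" and M: "M \<in> Mset S H"
    and z: "\<And>k. z k \<in> Rvec n" "\<And>k. norm (z k) \<le> W"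
  shows "norm (respx K H M z) \<le> signal_gain * W" "norm (respu K H M z) \<le> signal_gain * W"
proof -
  have W: "0 \<le> W" using z(2)[of 0] norm_ge_zero order_trans by blast
  have "norm (\<Sum>i<H. (\<Phi> K ^^ i) (z (Suc i))) \<le> \<kappa>\<^sup>2 / \<gamma> * W"
    using z W by (intro norm_resolvent_le K) auto
  moreover have "norm (linx K H M z) \<le> \<kappa>\<^sup>2 / \<gamma> * (\<kappa>B * (a / \<gamma> * W))"
    by (intro norm_linx_le K norm_Mset_action_le[OF M] z)
  moreover have "\<kappa>\<^sup>2 / \<gamma> * W + \<kappa>\<^sup>2 / \<gamma> * (\<kappa>B * (a / \<gamma> * W)) = state_gain * W"
    by (simp add: state_gain_def algebra_simps)
  ultimately have x: "norm (respx K H M z) \<le> state_gain * W"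
    unfolding respx_eq[OF z(1)] using norm_triangle_ineq by (smt (verit, best))
  then show "norm (respx K H M z) \<le> signal_gain * W"
    using gain_le(1) W mult_right_mono by (meson order_trans)
  have "norm (\<Sum>j<H. mat_vec (entry M (Suc j)) (z (Suc j))) \<le> a / \<gamma> * W"
    by (intro norm_Mset_action_le[OF M] z)
  moreover have "norm (mat_vec K (respx K H M z)) \<le> \<kappa> * (state_gain * W)"
    using strongly_stable_norm[OF K] x kappa_pos by (meson mult_left_mono order_trans less_imp_le)
  ultimately have "norm (respu K H M z) \<le> a / \<gamma> * W + \<kappa> * (state_gain * W)"
    unfolding respu_eq_respx using norm_triangle_ineq4 by (smt (verit, best))
  also have "\<dots> = (\<kappa> * state_gain + a / \<gamma>) * W" by (simp add: algebra_simps)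
  also have "\<dots> \<le> signal_gain * W" using gain_le(2) W by (rule mult_right_mono)
  finally show "norm (respu K H M z) \<le> signal_gain * W" .
qed

section \<open>The set of safe policies\<close>

definition Mset_radius :: real where
  "Mset_radius = sqrt (real m) * (a / \<gamma>)"

lemma Mset_radius_nonneg: "0 \<le> Mset_radius"
  using a_pos gamma_pos by (simp add: Mset_radius_def)

text \<open>The squared Frobenius norm of a block is at most \<open>m\<close> times its squared
  spectral norm, and the spectral bounds decay geometrically; so the radius does not grow with
  \<open>H\<close>.\<close>

lemma norm_Mset_le:
  assumes M: "M \<in> Mset S H"
  shows "norm M \<le> Mset_radius"
proof -
  have g: "0 \<le> 1 - \<gamma>" "1 - \<gamma> \<le> 1" using gamma_le1 gamma_pos by auto
  have "(norm M)\<^sup>2 = (\<Sum>i\<in>{1..H}. (norm (entry M i))\<^sup>2)"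
    using M by (intro norm_fsfam_sq) (auto simp: Mset_def policy_space_def)
  also have "\<dots> \<le> (\<Sum>i\<in>{1..H}. real m * a\<^sup>2 * (1 - \<gamma>) ^ (i - 1))"
  proof (rule sum_mono)
    fix i assume i: "i \<in> {1..H}"
    have "(norm (entry M i))\<^sup>2 \<le> real m * (snorm (entry M i))\<^sup>2"
      using M by (intro norm_mat_sq_le_snorm[of _ _ n]) (auto simp: Mset_def policy_space_def)
    also have "\<dots> \<le> real m * (a * (1 - \<gamma>) ^ (i - 1))\<^sup>2"
      using M i by (intro mult_left_mono power_mono) (auto simp: Mset_def)
    also have "\<dots> = real m * a\<^sup>2 * ((1 - \<gamma>) ^ (i - 1) * (1 - \<gamma>) ^ (i - 1))"
      by (simp add: power2_eq_square)
    \<comment> \<open>Dropping one of the two geometric factors leaves a plain geometric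
      series.\<close>
    also have "\<dots> \<le> real m * a\<^sup>2 * ((1 - \<gamma>) ^ (i - 1) * 1)"
      using g by (intro mult_left_mono power_le_one) auto
    finally show "(norm (entry M i))\<^sup>2 \<le> real m * a\<^sup>2 * (1 - \<gamma>) ^ (i - 1)" by simp
  qed
  also have "\<dots> = real m * a\<^sup>2 * (\<Sum>i<H. (1 - \<gamma>) ^ i)"
    by (simp add: sum_distrib_left sum.atLeast1_atMost_eq)
  also have "\<dots> \<le> real m * a\<^sup>2 * (1 / \<gamma>)"
    by (intro mult_left_mono geometric_sum_le gamma_pos gamma_le1) auto
  \<comment> \<open>Weakened so that the square root is linear in \<open>1 / \<gamma>\<close>, since
    the final constant has to be a polynomial in it.\<close>
  also have "\<dots> \<le> real m * a\<^sup>2 * (1 / \<gamma>\<^sup>2)"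
  proof (intro mult_left_mono)
    have "\<gamma>\<^sup>2 \<le> \<gamma> * 1" using gamma_pos gamma_le1 unfolding power2_eq_square by (intro mult_left_mono) auto
    then show "1 / \<gamma> \<le> 1 / \<gamma>\<^sup>2" using gamma_pos by (intro divide_left_mono) auto
  qed simp
  also have "\<dots> = Mset_radius\<^sup>2"
    by (simp add: Mset_radius_def power_mult_distrib power_divide)
  finally show ?thesis by (rule power2_le_imp_le) (rule Mset_radius_nonneg)
qed

lemma norm_Mset_diff_le:
  assumes "M \<in> Mset S H" "N \<in> Mset S H"
  shows "norm (M - N) \<le> 2 * Mset_radius"
  using norm_Mset_le[OF assms(1)] norm_Mset_le[OF assms(2)] norm_triangle_ineq4[of M N] by linarith

text \<open>Spectral bounds become conditions on the images of single vectors; each of them is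
  closed and convex in the policy, and so is their intersection.\<close>

lemma Mset_eq: "Mset S H = policy_space H m n \<inter>
  (\<Inter>i\<in>{1..H}. \<Inter>x. {M. norm (mat_vec (entry M i) x) \<le> a * (1 - \<gamma>) ^ (i - 1) * norm x})"
  using a_pos gamma_le1 by (auto simp: Mset_def snorm_le_iff)

lemma closed_Mset: "closed (Mset S H)"
  unfolding Mset_eq
  by (intro closed_Int closed_INT ballI closed_policy_space closed_Collect_le continuous_on_norm
      continuous_on_const
      linear_continuous_on[OF bounded_linear_compose[OF mat_vec.bounded_linear_left bounded_linear_entry]])

lemma convex_Mset: "convex (Mset S H)"
  unfolding Mset_eq
proof (intro convex_Int convex_INT)
  show "convex (policy_space H m n)" by (rule subspace_imp_convex) simp
  fix i and x :: rvec
  let ?b = "a * (1 - \<gamma>) ^ (i - 1) * norm x"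
  show "convex {M. norm (mat_vec (entry M i) x) \<le> ?b}"
  proof (rule convexI, clarify)
    fix M N and u v :: real
    assume MN: "norm (mat_vec (entry M i) x) \<le> ?b" "norm (mat_vec (entry N i) x) \<le> ?b"
      and uv: "0 \<le> u" "0 \<le> v" "u + v = 1"
    have "norm (mat_vec (entry (u *\<^sub>R M + v *\<^sub>R N) i) x)
        \<le> u * norm (mat_vec (entry M i) x) + v * norm (mat_vec (entry N i) x)"
      using norm_triangle_ineq[of "u *\<^sub>R mat_vec (entry M i) x" "v *\<^sub>R mat_vec (entry N i) x"] uv
      by (simp add: mat_vec.add_left mat_vec.scaleR_left)
    also have "\<dots> \<le> u * ?b + v * ?b"
      using MN uv by (intro add_mono mult_left_mono)
    also have "\<dots> = (u + v) * ?b" by (simp only: distrib_right)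
    finally show "norm (mat_vec (entry (u *\<^sub>R M + v *\<^sub>R N) i) x) \<le> ?b" by (simp add: uv(3))
  qed
qed

lemma block_of_in_Rvec: "block_of d z k \<in> Rvec d"
  by (auto simp: Rvec_def split: if_splits)

lemma Omega_iff:
  "M \<in> Omega S K H \<epsilon> \<longleftrightarrow> M \<in> Mset S H \<and> (\<forall>y\<in>linf_ball (2 * H * n) (wbar S).
     respx K H M (\<lambda>k. block_of n y (k - 1)) \<in> shrink n \<epsilon> (Xset S) \<and>
     respu K H M (\<lambda>k. block_of n y (k - 1)) \<in> shrink m \<epsilon> (Uset S))"
  by (auto simp: Omega_def hx_apply hu_apply)

lemma Omega_subset_Mset: "Omega S K H \<epsilon> \<subseteq> Mset S H"
  by (auto simp: Omega_iff)

lemma convex_Omega: "convex (Omega S K H \<epsilon>)"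
proof (rule convexI)
  fix M N and u v :: real
  assume *: "M \<in> Omega S K H \<epsilon>" "N \<in> Omega S K H \<epsilon>" "0 \<le> u" "0 \<le> v" "u + v = 1"
  have sets: "convex (shrink n \<epsilon> (Xset S))" "convex (shrink m \<epsilon> (Uset S))"
    using plant by (auto simp: plant_ok_def intro: convex_shrink)
  show "u *\<^sub>R M + v *\<^sub>R N \<in> Omega S K H \<epsilon>"
    unfolding Omega_iff resp_affine[OF block_of_in_Rvec *(5)]
    using * convexD[OF convex_Mset] unfolding Omega_iff
    by (intro conjI ballI convexD[OF convex_Mset] convexD[OF sets(1)] convexD[OF sets(2)]) auto
qed

lemma closed_Omega: "closed (Omega S K H \<epsilon>)"
proof -
  have eq: "Omega S K H \<epsilon> = Mset S H \<inter> (\<Inter>y\<in>linf_ball (2 * H * n) (wbar S).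
     (\<lambda>M. respx K H M (\<lambda>k. block_of n y (k - 1))) -` shrink n \<epsilon> (Xset S)
     \<inter> (\<lambda>M. respu K H M (\<lambda>k. block_of n y (k - 1))) -` shrink m \<epsilon> (Uset S))"
    unfolding set_eq_iff Omega_iff by blast
  have sets: "closed (shrink n \<epsilon> (Xset S))" "closed (shrink m \<epsilon> (Uset S))"
    using plant by (auto simp: plant_ok_def intro: closed_shrink)
  show ?thesis
    unfolding eq respx_eq[OF block_of_in_Rvec] respu_eq[OF block_of_in_Rvec]
    by (intro closed_Int closed_INT ballI closed_Mset closed_vimage sets continuous_on_add
        continuous_on_const linear_continuous_on[OF bounded_linear_linx] linear_continuous_on[OF bounded_linear_linu])
qed

text \<open>The norm bound on policies confines every scalar entry to one interval, so
  \<open>Omega\<close> is a closed subset of a box nested over blocks and entries.\<close>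

lemma compact_Omega: "compact (Omega S K H \<epsilon>)"
proof -
  define r where "r = Mset_radius"
  define C :: "rmat set" where "C = {A. \<forall>p. entry A p \<in> (if p \<in> {..<m} \<times> {..<n} then {- r..r} else {0})}"
  have "compact C" unfolding C_def by (rule compact_family_box) simp_all
  then have box: "compact {M :: policy. \<forall>i. entry M i \<in> (if i \<in> {1..H} then C else {0})}"
    by (rule compact_family_box[rotated]) simp
  have "Omega S K H \<epsilon> \<subseteq> {M. \<forall>i. entry M i \<in> (if i \<in> {1..H} then C else {0})}"
  proof clarify
    fix M i assume "M \<in> Omega S K H \<epsilon>"
    then have M: "M \<in> Mset S H" using Omega_subset_Mset by blast
    then have Mi: "entry M i \<in> Rmat m n" "entry M i \<noteq> 0 \<longrightarrow> i \<in> {1..H}"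
      by (auto simp: Mset_def policy_space_def)
    have "\<bar>entry (entry M i) p\<bar> \<le> r" for p
      using norm_entry_le[of "entry M i" p] norm_entry_le[of M i] norm_Mset_le[OF M]
      unfolding r_def by simp
    then have "- r \<le> entry (entry M i) p \<and> entry (entry M i) p \<le> r" for p
      by (simp only: abs_le_iff minus_le_iff)
    then have "entry M i \<in> C"
      using Mi(1) unfolding C_def Rmat_def by fastforce
    then show "entry M i \<in> (if i \<in> {1..H} then C else {0})" using Mi(2) by auto
  qed
  then have "Omega S K H \<epsilon> = Omega S K H \<epsilon> \<inter> {M. \<forall>i. entry M i \<in> (if i \<in> {1..H} then C else {0})}"
    by blast
  then show ?thesis
    using closed_Int_compact[OF closed_Omega box, of K H \<epsilon>] by simp
qed

end

context control_plant
begin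

section \<open>Disturbance-action policies that imitate a linear controller\<close>

text \<open>The state under \<open>K'\<close> is a sum of powers of its closed loop applied to past
  disturbances. Writing its input \<open>-K' x\<close> as \<open>-K x + (K - K') x\<close> and
  expanding the second \<open>x\<close> gives these blocks, cut off after \<open>H\<close> of
  them.\<close>

definition dap_of :: "rmat \<Rightarrow> rmat \<Rightarrow> nat \<Rightarrow> policy" where
  "dap_of K K' H = policy_of H (\<lambda>i. mat_mult (K - K') (mat_pow n (Acl S K') (i - 1)))"

lemma dap_of_apply:
  assumes "v \<in> Rvec n" "1 \<le> i" "i \<le> H"
  shows "mat_vec (entry (dap_of K K' H) i) v = mat_vec K ((\<Phi> K' ^^ (i - 1)) v) - mat_vec K' ((\<Phi> K' ^^ (i - 1)) v)"
  using assms by (simp add: dap_of_def mat_vec_mat_mult mat_vec_mat_pow mat_vec.diff_left)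

text \<open>This is where the value of \<open>a\<close> comes from: 2\<kappa> bounds the difference
  of the two controllers, and \<kappa>^2 comes with the power of the closed loop.\<close>

lemma dap_of_in_Mset:
  assumes K: "strongly_stable S K" and K': "strongly_stable S K'"
  shows "dap_of K K' H \<in> Mset S H"
  unfolding Mset_def
proof (intro CollectI conjI ballI)
  have "mat_mult (K - K') (mat_pow n (Acl S K') i) \<in> Rmat m n" for i
    by (intro mat_mult_in_Rmat[of _ m n] subspace_diff[OF subspace_Rmat] strongly_stable_in K K'
        mat_pow_in_Rmat strongly_stable_Acl_in)
  then show "dap_of K K' H \<in> policy_space H m n"
    by (auto simp: policy_space_def dap_of_def subspace_0 split: if_splits)
  fix i assume i: "i \<in> {1..H}"
  show "snorm (entry (dap_of K K' H) i) \<le> a * (1 - \<gamma>) ^ (i - 1)"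
  proof (rule snorm_leI)
    show "0 \<le> a * (1 - \<gamma>) ^ (i - 1)" using a_pos gamma_le1 by simp
    fix x
    let ?x = "mat_vec (id_mat n) x"
    let ?y = "(\<Phi> K' ^^ (i - 1)) ?x"
    have "mat_vec (entry (dap_of K K' H) i) x = mat_vec K ?y - mat_vec K' ?y"
      using i by (simp add: dap_of_def mat_vec_mat_mult mat_vec_mat_pow mat_vec.diff_left)
    then have "norm (mat_vec (entry (dap_of K K' H) i) x) \<le> norm (mat_vec K ?y) + norm (mat_vec K' ?y)"
      by (simp only: norm_triangle_ineq4)
    also have "\<dots> \<le> \<kappa> * norm ?y + \<kappa> * norm ?y"
      by (intro add_mono strongly_stable_norm K K')
    also have "\<dots> = 2 * \<kappa> * norm ?y" by simp
    also have "norm ?y \<le> \<kappa>\<^sup>2 * (1 - \<gamma>) ^ (i - 1) * norm ?x"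
      by (rule strongly_stable_funpow[OF K' id_mat_in_Rvec])
    also have "\<dots> \<le> \<kappa>\<^sup>2 * (1 - \<gamma>) ^ (i - 1) * norm x"
      using gamma_le1 by (intro mult_left_mono norm_mat_vec_id_mat) auto
    also have "2 * \<kappa> * \<dots> = a * (1 - \<gamma>) ^ (i - 1) * norm x"
      by (simp add: acoef_def power2_eq_square power3_eq_cube)
    finally show "norm (mat_vec (entry (dap_of K K' H) i) x) \<le> a * (1 - \<gamma>) ^ (i - 1) * norm x"
      using kappa_pos by simp
  qed
qed

text \<open>\<open>B (K - K') = A\<^bsub>K'\<^esub> - A\<^bsub>K\<^esub>\<close>. This makes the first \<open>H\<close> responses telescope, and it gains
  a factor \<open>1 - \<gamma>\<close> in the others.\<close>

lemma Bmat_dap_of: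
  assumes "v \<in> Rvec n" "1 \<le> i" "i \<le> H"
  shows "mat_vec (Bmat S) (mat_vec (entry (dap_of K K' H) i) v)
    = (\<Phi> K' ^^ i) v - \<Phi> K ((\<Phi> K' ^^ (i - 1)) v)"
proof -
  have "(\<Phi> K' ^^ i) v = \<Phi> K' ((\<Phi> K' ^^ (i - 1)) v)" using assms(2) by (cases i) auto
  then show ?thesis by (simp add: dap_of_apply[OF assms] mat_vec_Acl mat_vec.diff_right)
qed

lemma Psix_dap_of:
  assumes v: "v \<in> Rvec n" and k: "1 \<le> k" "k \<le> H"
  shows "mat_vec (Psix S K H (dap_of K K' H) k) v = (\<Phi> K' ^^ (k - 1)) v"
proof -
  let ?g = "\<lambda>i. (\<Phi> K ^^ i) ((\<Phi> K' ^^ (k - 1 - i)) v)"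
  have "(\<Sum>i=1..H. if 1 \<le> k - i \<and> k - i \<le> H
        then (\<Phi> K ^^ (i - 1)) (mat_vec (Bmat S) (mat_vec (entry (dap_of K K' H) (k - i)) v)) else 0)
      = (\<Sum>i=1..k - 1. ?g (i - 1) - ?g i)"
  proof (rule sum.mono_neutral_cong_right)
    fix i assume i: "i \<in> {1..k - 1}"
    then have ki: "1 \<le> k - i" "k - i \<le> H" "k - 1 - (i - 1) = k - i" "k - i - 1 = k - 1 - i" using k by auto
    obtain l where l: "i = Suc l" using i by (cases i) auto
    have "(\<Phi> K ^^ (i - 1)) (\<Phi> K y) = (\<Phi> K ^^ i) y" for y
      by (simp add: l funpow_swap1)
    then show "(if 1 \<le> k - i \<and> k - i \<le> H
        then (\<Phi> K ^^ (i - 1)) (mat_vec (Bmat S) (mat_vec (entry (dap_of K K' H) (k - i)) v)) else 0)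
        = ?g (i - 1) - ?g i"
      using ki by (simp add: Bmat_dap_of[OF v ki(1,2)] linear_diff[OF linear_funpow[OF linear_mat_vec]])
  qed (use k in auto)
  also have "\<dots> = (\<Sum>i<k - 1. ?g i - ?g (Suc i))"
    by (simp add: sum.atLeast1_atMost_eq)
  \<comment> \<open>\<open>?g 0\<close> is the response of \<open>K'\<close>, and
    \<open>?g (k - 1)\<close> is the free response of \<open>K\<close>, which the first summand of
    \<open>Psix\<close> cancels.\<close>
  also have "\<dots> = ?g 0 - ?g (k - 1)" by (rule sum_lessThan_telescope')
  finally show ?thesis using k by (simp add: Psix_apply[OF v])
qed

text \<open>Past lag \<open>H\<close> the sum is cut and no longer telescopes, so its at most
  \<open>H\<close> terms are bounded one by one. Both halves of a difference are at most \<kappa>^4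
  times the decay, and the outer power adds \<kappa>^2; the exponents \<open>i - 1\<close> and
  \<open>k - i\<close> combine to \<open>k - 1\<close>.\<close>

lemma norm_Psix_dap_of_le:
  assumes K: "strongly_stable S K" and K': "strongly_stable S K'" and v: "v \<in> Rvec n" and k: "H < k"
  shows "norm (mat_vec (Psix S K H (dap_of K K' H) k) v) \<le> real H * (2 * \<kappa> ^ 6 * (1 - \<gamma>) ^ (k - 1) * norm v)"
proof -
  let ?b = "2 * \<kappa> ^ 6 * (1 - \<gamma>) ^ (k - 1) * norm v"
  have g: "0 \<le> 1 - \<gamma>" using gamma_le1 by simp
  have k2: "1 \<le> \<kappa>\<^sup>2" using kappa_gt1 by simp
  have "norm (\<Sum>i=1..H. if 1 \<le> k - i \<and> k - i \<le> H
        then (\<Phi> K ^^ (i - 1)) (mat_vec (Bmat S) (mat_vec (entry (dap_of K K' H) (k - i)) v)) else 0)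
      \<le> (\<Sum>i=1..H. ?b)"
  proof (rule sum_norm_le)
    fix i assume i: "i \<in> {1..H}"
    have "norm ((\<Phi> K ^^ (i - 1)) (mat_vec (Bmat S) (mat_vec (entry (dap_of K K' H) (k - i)) v))) \<le> ?b"
      if ki: "1 \<le> k - i" "k - i \<le> H"
    proof -
      let ?r = "(1 - \<gamma>) ^ (k - i)"
      let ?y = "(\<Phi> K' ^^ (k - i - 1)) v"
      have y: "?y \<in> Rvec n" by (intro funpow_in_Rvec K' v)
      have "norm (\<Phi> K ?y) \<le> \<kappa>\<^sup>2 * (1 - \<gamma>) ^ 1 * norm ?y"
        using strongly_stable_funpow[OF K y, of 1] by simp
      also have "\<dots> \<le> \<kappa>\<^sup>2 * (1 - \<gamma>) ^ 1 * (\<kappa>\<^sup>2 * (1 - \<gamma>) ^ (k - i - 1) * norm v)"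
        using g by (intro mult_left_mono strongly_stable_funpow K' v) auto
      also have "\<dots> = \<kappa> ^ 4 * ?r * norm v"
        using ki(1) by (cases "k - i") (auto simp: power2_eq_square power4_eq_xxxx)
      finally have 1: "norm (\<Phi> K ?y) \<le> \<kappa> ^ 4 * ?r * norm v" .
      have "norm ((\<Phi> K' ^^ (k - i)) v) \<le> \<kappa>\<^sup>2 * ?r * norm v"
        by (rule strongly_stable_funpow[OF K' v])
      also have "\<dots> \<le> \<kappa> ^ 4 * ?r * norm v"
        using g kappa_gt1 by (intro mult_right_mono power_increasing) auto
      finally have 2: "norm (mat_vec (Bmat S) (mat_vec (entry (dap_of K K' H) (k - i)) v)) \<le> 2 * \<kappa> ^ 4 * ?r * norm v"
        unfolding Bmat_dap_of[OF v ki]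
        using 1 norm_triangle_ineq4[of "(\<Phi> K' ^^ (k - i)) v" "\<Phi> K ?y"] by simp
      have "norm ((\<Phi> K ^^ (i - 1)) (mat_vec (Bmat S) (mat_vec (entry (dap_of K K' H) (k - i)) v)))
          \<le> \<kappa>\<^sup>2 * (1 - \<gamma>) ^ (i - 1) * norm (mat_vec (Bmat S) (mat_vec (entry (dap_of K K' H) (k - i)) v))"
        by (intro strongly_stable_funpow K mat_vec_in_Rvec[OF Bmat_in])
      also have "\<dots> \<le> \<kappa>\<^sup>2 * (1 - \<gamma>) ^ (i - 1) * (2 * \<kappa> ^ 4 * ?r * norm v)"
        using g 2 by (intro mult_left_mono) auto
      also have "\<dots> = 2 * (\<kappa> ^ 2 * \<kappa> ^ 4) * ((1 - \<gamma>) ^ (i - 1) * ?r) * norm v" by (simp add: mult_ac)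
      also have "\<dots> = ?b"
      proof -
        have "i - 1 + (k - i) = k - 1" using i k by auto
        then show ?thesis by (simp only: power_add[symmetric]) simp
      qed
      finally show ?thesis .
    qed
    moreover have "0 \<le> ?b" using g by simp
    ultimately show "norm (if 1 \<le> k - i \<and> k - i \<le> H
        then (\<Phi> K ^^ (i - 1)) (mat_vec (Bmat S) (mat_vec (entry (dap_of K K' H) (k - i)) v)) else 0) \<le> ?b"
      by simp
  qed
  then show ?thesis using k by (simp add: Psix_apply[OF v])
qed

definition dap_error :: "nat \<Rightarrow> real \<Rightarrow> real" where
  "dap_error H W = 2 * real H * \<kappa> ^ 6 * (1 - \<gamma>) ^ H / \<gamma> * W"

text \<open>One error \<open>e\<close>, the response from lags beyond \<open>H\<close>, serves both
  signals. With \<open>s\<close> the truncated response of \<open>K'\<close>, the policy action is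
  \<open>K s - K' s\<close>, and subtracting \<open>K (s + e)\<close> leaves
  \<open>- K' s - K e\<close>.\<close>

lemma resp_dap_of:
  assumes K: "strongly_stable S K" and K': "strongly_stable S K'"
    and z: "\<And>k. z k \<in> Rvec n" "\<And>k. norm (z k) \<le> W"
  obtains e where "e \<in> Rvec n" "norm e \<le> dap_error H W"
    "respx K H (dap_of K K' H) z = (\<Sum>i<H. (\<Phi> K' ^^ i) (z (Suc i))) + e"
    "respu K H (dap_of K K' H) z = - mat_vec K' (\<Sum>i<H. (\<Phi> K' ^^ i) (z (Suc i))) + - mat_vec K e"
proof -
  let ?M = "dap_of K K' H"
  let ?s = "\<Sum>i<H. (\<Phi> K' ^^ i) (z (Suc i))"
  have W: "0 \<le> W" using z(2)[of 0] norm_ge_zero order_trans by blast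
  define e where "e = respx K H ?M z - ?s"
  have "e \<in> Rvec n" unfolding e_def
    by (intro subspace_diff subspace_sum subspace_Rvec respx_in_Rvec funpow_in_Rvec K K' z(1))
  moreover have "respx K H ?M z = ?s + e" by (simp add: e_def)
  moreover have "respu K H ?M z = - mat_vec K' ?s + - mat_vec K e"
  proof -
    have "(\<Sum>j<H. mat_vec (entry ?M (Suc j)) (z (Suc j))) = mat_vec K ?s - mat_vec K' ?s"
      by (simp add: dap_of_apply z(1) sum_subtractf mat_vec.sum_right)
    then show ?thesis by (simp add: respu_eq_respx e_def mat_vec.diff_right)
  qed
  moreover have "norm e \<le> dap_error H W"
  proof -
    have "respx K H ?M z = (\<Sum>k\<in>{1..H} \<union> {H + 1..2 * H}. mat_vec (Psix S K H ?M k) (z k))"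
      unfolding respx_def by (rule sum.cong) auto
    also have "\<dots> = (\<Sum>k=1..H. mat_vec (Psix S K H ?M k) (z k)) + (\<Sum>k=H + 1..2 * H. mat_vec (Psix S K H ?M k) (z k))"
      by (rule sum.union_disjoint) auto
    also have "(\<Sum>k=1..H. mat_vec (Psix S K H ?M k) (z k)) = ?s"
      by (simp add: sum.atLeast1_atMost_eq Psix_dap_of z(1))
    finally have "norm e \<le> (\<Sum>k=H + 1..2 * H. real H * (2 * \<kappa> ^ 6 * (1 - \<gamma>) ^ (k - 1) * W))"
    proof (simp only: e_def add_diff_cancel_left', intro sum_norm_le)
      fix k assume "k \<in> {H + 1..2 * H}"
      then have "norm (mat_vec (Psix S K H ?M k) (z k)) \<le> real H * (2 * \<kappa> ^ 6 * (1 - \<gamma>) ^ (k - 1) * norm (z k))"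
        by (intro norm_Psix_dap_of_le K K' z) auto
      also have "\<dots> \<le> real H * (2 * \<kappa> ^ 6 * (1 - \<gamma>) ^ (k - 1) * W)"
        using gamma_le1 kappa_pos by (intro mult_left_mono z(2)) auto
      finally show "norm (mat_vec (Psix S K H ?M k) (z k)) \<le> real H * (2 * \<kappa> ^ 6 * (1 - \<gamma>) ^ (k - 1) * W)" .
    qed
    also have "\<dots> = 2 * real H * \<kappa> ^ 6 * W * (\<Sum>k=H + 1..2 * H. (1 - \<gamma>) ^ (k - 1))"
      by (simp add: sum_distrib_left mult_ac)
    also have "(\<Sum>k=H + 1..2 * H. (1 - \<gamma>) ^ (k - 1)) = (\<Sum>i<2 * H. if i < H then 0 else (1 - \<gamma>) ^ i)"
    proof -
      have "(\<Sum>k=H + 1..2 * H. (1 - \<gamma>) ^ (k - 1)) = (\<Sum>i\<in>{H..<2 * H}. (1 - \<gamma>) ^ i)"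
        by (rule sum.reindex_bij_witness[of _ Suc "\<lambda>k. k - 1"]) auto
      also have "\<dots> = (\<Sum>i<2 * H. if i < H then 0 else (1 - \<gamma>) ^ i)"
        by (rule sum.mono_neutral_cong_left) auto
      finally show ?thesis .
    qed
    also have "2 * real H * \<kappa> ^ 6 * W * \<dots> \<le> 2 * real H * \<kappa> ^ 6 * W * ((1 - \<gamma>) ^ H / \<gamma>)"
      using W kappa_pos by (intro mult_left_mono geometric_tail_le gamma_pos gamma_le1) auto
    finally show ?thesis by (simp add: dap_error_def mult_ac)
  qed
  ultimately show ?thesis using that by blast
qed

text \<open>Transfers safety from trajectories to arbitrary windows: feeding the window in reversed
  order makes the truncated response the actual state at time \<open>H\<close>.\<close>

lemma linear_response_reachable:
  assumes z: "\<And>k. z k \<in> linf_ball n (wbar S)"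
  obtains w where "w \<in> disturbances S"
    "lin_state S K' w H = (\<Sum>i<H. (\<Phi> K' ^^ i) (z (Suc i)))"
    "lin_input S K' w H = - mat_vec K' (\<Sum>i<H. (\<Phi> K' ^^ i) (z (Suc i)))"
proof
  let ?w = "\<lambda>s. z (H - s)"
  show "?w \<in> disturbances S" using z by (simp add: disturbances_def)
  have "H - (H - 1 - i) = Suc i" if "i < H" for i using that by simp
  then show "lin_state S K' ?w H = (\<Sum>i<H. (\<Phi> K' ^^ i) (z (Suc i)))"
    unfolding lin_state_eq by (intro sum.cong) auto
  then show "lin_input S K' ?w H = - mat_vec K' (\<Sum>i<H. (\<Phi> K' ^^ i) (z (Suc i)))"
    by (simp add: lin_input_def)
qed

definition wnorm :: real where
  "wnorm = sqrt (real n) * wbar S"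

lemma wnorm_nonneg: "0 \<le> wnorm"
  using wbar_nonneg by (simp add: wnorm_def)

lemma in_linf_ball_wbar: "x \<in> linf_ball n (wbar S) \<Longrightarrow> x \<in> Rvec n" "x \<in> linf_ball n (wbar S) \<Longrightarrow> norm x \<le> wnorm"
  using norm_linf_ball by (auto simp: linf_ball_def wnorm_def)

lemma mixture_in_Omega:
  assumes K: "strongly_stable S K" and K': "K' \<in> benchmark S T" and HT: "H \<le> T"
    and Ks: "strongly_stable S Ks" "strictly_safe S \<epsilon>s Ks" and eps: "0 \<le> \<epsilon>" "0 < \<epsilon>s"
    and l: "0 \<le> l" "l \<le> 1" "\<epsilon> + \<kappa> * dap_error H wnorm \<le> l * \<epsilon>s"
  shows "(1 - l) *\<^sub>R dap_of K K' H + l *\<^sub>R dap_of K Ks H \<in> Omega S K H \<epsilon>" (is "?M \<in> _")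
  unfolding Omega_iff
proof (intro conjI ballI)
  have K's: "strongly_stable S K'" using K' by (simp add: benchmark_def)
  show "?M \<in> Mset S H"
    using l by (intro convexD[OF convex_Mset] dap_of_in_Mset K K's Ks) auto
  have XU: "convex (Xset S)" "convex (Uset S)" using plant by (auto simp: plant_ok_def)
  let ?\<delta> = "\<kappa> * dap_error H wnorm"
  fix y assume y: "y \<in> linf_ball (2 * H * n) (wbar S)"
  define z where "z = (\<lambda>k. block_of n y (k - 1))"
  have zb: "z k \<in> linf_ball n (wbar S)" for k
    unfolding z_def by (rule block_of_in_linf_ball[OF y])
  note z = in_linf_ball_wbar[OF zb]
  let ?p = "\<Sum>i<H. (\<Phi> K' ^^ i) (z (Suc i))"
  let ?q = "\<Sum>i<H. (\<Phi> Ks ^^ i) (z (Suc i))"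
  obtain w1 where w1: "w1 \<in> disturbances S" "lin_state S K' w1 H = ?p" "lin_input S K' w1 H = - mat_vec K' ?p"
    using linear_response_reachable[OF zb] .
  obtain w2 where w2: "w2 \<in> disturbances S" "lin_state S Ks w2 H = ?q" "lin_input S Ks w2 H = - mat_vec Ks ?q"
    using linear_response_reachable[OF zb] .
  \<comment> \<open>\<open>K'\<close> is known to be safe only up to time \<open>T\<close>, and its
    safety is used at time \<open>H\<close>.\<close>
  have p: "?p \<in> Xset S" "- mat_vec K' ?p \<in> Uset S"
    using K' w1 HT unfolding benchmark_def by (metis (mono_tags, lifting) mem_Collect_eq)+
  have q: "?q \<in> shrink n \<epsilon>s (Xset S)" "- mat_vec Ks ?q \<in> shrink m \<epsilon>s (Uset S)"
    using Ks(2) w2 unfolding strictly_safe_def by metis+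
  obtain e1 where e1: "e1 \<in> Rvec n" "norm e1 \<le> dap_error H wnorm"
    "respx K H (dap_of K K' H) z = ?p + e1" "respu K H (dap_of K K' H) z = - mat_vec K' ?p + - mat_vec K e1"
    using resp_dap_of[OF K K's z] .
  obtain e2 where e2: "e2 \<in> Rvec n" "norm e2 \<le> dap_error H wnorm"
    "respx K H (dap_of K Ks H) z = ?q + e2" "respu K H (dap_of K Ks H) z = - mat_vec Ks ?q + - mat_vec K e2"
    using resp_dap_of[OF K Ks(1) z] .
  let ?e = "(1 - l) *\<^sub>R e1 + l *\<^sub>R e2"
  have e: "?e \<in> Rvec n" by (intro subspace_add subspace_scale subspace_Rvec e1 e2)
  have en: "norm ?e \<le> dap_error H wnorm"
  proof -
    have "norm ?e \<le> (1 - l) * norm e1 + l * norm e2"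
      using norm_triangle_ineq[of "(1 - l) *\<^sub>R e1" "l *\<^sub>R e2"] l by simp
    also have "\<dots> \<le> (1 - l) * dap_error H wnorm + l * dap_error H wnorm"
      using l e1 e2 by (intro add_mono mult_left_mono) auto
    finally show ?thesis by (simp add: algebra_simps)
  qed
  then have "0 \<le> dap_error H wnorm" using norm_ge_zero order_trans by blast
  \<comment> \<open>As \<kappa> exceeds 1, the radius chosen for the input error also covers the
    state error, so one condition on \<open>l\<close> handles both constraint sets.\<close>
  then have "dap_error H wnorm \<le> ?\<delta>" using mult_right_mono[of 1 \<kappa> "dap_error H wnorm"] kappa_gt1 by simp
  then have ex: "?e \<in> linf_ball n ?\<delta>" using e en by (intro linf_ball_normI) auto
  have "norm (- mat_vec K ?e) \<le> ?\<delta>"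
    using strongly_stable_norm[OF K, of ?e] mult_left_mono[OF en, of \<kappa>] kappa_pos
    by (simp only: norm_minus_cancel) linarith
  then have eu: "- mat_vec K ?e \<in> linf_ball m ?\<delta>"
    by (intro linf_ball_normI subspace_neg subspace_Rvec mat_vec_in_Rvec[OF strongly_stable_in[OF K]])
  have "respx K H ?M z = (1 - l) *\<^sub>R ?p + l *\<^sub>R ?q + ?e"
    using z(1) by (simp add: resp_affine e1 e2 scaleR_right_distrib)
  then show "respx K H ?M (\<lambda>k. block_of n y (k - 1)) \<in> shrink n \<epsilon> (Xset S)"
    using convex_combination_in_shrink[OF XU(1) p(1) q(1) l(1,2) ex eps l(3)] by (simp only: z_def)
  have "respu K H ?M z = (1 - l) *\<^sub>R (- mat_vec K' ?p) + l *\<^sub>R (- mat_vec Ks ?q) + - mat_vec K ?e"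
    using z(1) by (simp add: resp_affine e1 e2 mat_vec.add_right mat_vec.scaleR_right scaleR_right_distrib scaleR_right_diff_distrib)
  then show "respu K H ?M (\<lambda>k. block_of n y (k - 1)) \<in> shrink m \<epsilon> (Uset S)"
    using convex_combination_in_shrink[OF XU(2) p(2) q(2) l(1,2) eu eps l(3)] by (simp only: z_def)
qed

text \<open>If the margin is too small for a mixture, any element of the set is close enough,
  since then the bound exceeds its diameter.\<close>

lemma comparator_in_Omega:
  assumes K: "strongly_stable S K" and K': "K' \<in> benchmark S T" and HT: "H \<le> T"
    and Ks: "strongly_stable S Ks" "strictly_safe S \<epsilon>s Ks" and eps: "0 \<le> \<epsilon>" "0 < \<epsilon>s"
    and M0: "M0 \<in> Omega S K H \<epsilon>"
  obtains M where "M \<in> Omega S K H \<epsilon>"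
    "norm (M - dap_of K K' H) \<le> (\<epsilon> + \<kappa> * dap_error H wnorm) / \<epsilon>s * (2 * Mset_radius)"
proof -
  have K's: "strongly_stable S K'" using K' by (simp add: benchmark_def)
  show ?thesis
  proof (cases "(\<epsilon> + \<kappa> * dap_error H wnorm) / \<epsilon>s \<le> 1")
    case True
    let ?l = "(\<epsilon> + \<kappa> * dap_error H wnorm) / \<epsilon>s"
    let ?M = "(1 - ?l) *\<^sub>R dap_of K K' H + ?l *\<^sub>R dap_of K Ks H"
    have l: "0 \<le> ?l"
      using eps kappa_pos gamma_pos gamma_le1 wnorm_nonneg by (simp add: dap_error_def)
    have "?M \<in> Omega S K H \<epsilon>"
      using eps l True by (intro mixture_in_Omega[OF K K' HT Ks]) auto
    moreover have "?M - dap_of K K' H = ?l *\<^sub>R (dap_of K Ks H - dap_of K K' H)"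
      by (simp add: algebra_simps)
    then have "norm (?M - dap_of K K' H) = ?l * norm (dap_of K Ks H - dap_of K K' H)"
      using l by (simp only: norm_scaleR abs_of_nonneg)
    moreover have "\<dots> \<le> ?l * (2 * Mset_radius)"
      by (intro mult_left_mono[OF _ l] norm_Mset_diff_le[where H = H] dap_of_in_Mset K Ks(1) K's)
    ultimately show ?thesis using that by metis
  next
    case False
    have "norm (M0 - dap_of K K' H) \<le> 2 * Mset_radius"
      by (intro norm_Mset_diff_le[where H = H] dap_of_in_Mset K K's subsetD[OF Omega_subset_Mset M0])
    also have "\<dots> \<le> (\<epsilon> + \<kappa> * dap_error H wnorm) / \<epsilon>s * (2 * Mset_radius)"
      using False mult_right_mono[of 1 "(\<epsilon> + \<kappa> * dap_error H wnorm) / \<epsilon>s" "2 * Mset_radius"]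
        Mset_radius_nonneg by linarith
    finally show ?thesis using that M0 by blast
  qed
qed

end

section \<open>Costs\<close>

locale control_costs = control_plant +
  fixes T :: nat and G :: real and c :: "nat \<Rightarrow> rvec \<times> rvec \<Rightarrow> real"
  assumes costs: "costs_ok S T G c"
begin

abbreviation "XU \<equiv> Rvec n \<times> Rvec m"

lemma subspace_XU: "subspace XU"
  by (intro subspace_Times subspace_Rvec)

lemma cost_abs_le:
  assumes "t \<le> T" "x \<in> Rvec n" "u \<in> Rvec m" "norm x \<le> r" "norm u \<le> r"
  shows "\<bar>c t (x, u)\<bar> \<le> G * r"
  using costs assms unfolding costs_ok_def by blast

lemma G_nonneg: "0 \<le> G"
  using cost_abs_le[OF le0 subspace_0 subspace_0, of 1] by simp

text \<open>The assumption bounds the two partial gradients. Composing the joint derivative with the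
  inclusions of the two factors identifies its components with them.\<close>

lemma cost_derivative:
  assumes t: "t \<le> T" and x: "x \<in> Rvec n" and u: "u \<in> Rvec m"
  obtains D where "(c t has_derivative D) (at (x, u) within XU)"
    "\<forall>r. \<forall>p\<in>Rvec n. \<forall>q\<in>Rvec m. norm x \<le> r \<and> norm u \<le> r \<longrightarrow> \<bar>D (p, q)\<bar> \<le> G * r * (norm p + norm q)"
proof -
  have "c t differentiable (at (x, u) within XU)"
    using costs t x u unfolding costs_ok_def differentiable_on_def by blast
  then obtain D where D: "(c t has_derivative D) (at (x, u) within XU)"
    unfolding differentiable_def by blast
  have "((\<lambda>y. c t (y, u)) has_derivative (\<lambda>h. D (h, 0))) (at x within Rvec n)"
  proof (rule has_derivative_in_compose[where f = "\<lambda>y. (y, u)"])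
    show "((\<lambda>y. (y, u)) has_derivative (\<lambda>h. (h, 0))) (at x within Rvec n)"
      by (intro has_derivative_Pair has_derivative_ident has_derivative_const)
    show "(c t has_derivative D) (at (x, u) within (\<lambda>y. (y, u)) ` Rvec n)"
      using u by (intro has_derivative_subset[OF D]) auto
  qed
  note gx = grad_on_properties[OF riesz_Rvec this x]
  have "((\<lambda>y. c t (x, y)) has_derivative (\<lambda>h. D (0, h))) (at u within Rvec m)"
  proof (rule has_derivative_in_compose[where f = "\<lambda>y. (x, y)"])
    show "((\<lambda>y. (x, y)) has_derivative (\<lambda>h. (0, h))) (at u within Rvec m)"
      by (intro has_derivative_Pair has_derivative_ident has_derivative_const)
    show "(c t has_derivative D) (at (x, u) within (\<lambda>y. (x, y)) ` Rvec m)"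
      using x by (intro has_derivative_subset[OF D]) auto
  qed
  note gu = grad_on_properties[OF riesz_Rvec this u]
  have "\<bar>D (p, q)\<bar> \<le> G * r * (norm p + norm q)"
    if r: "norm x \<le> r" "norm u \<le> r" and pq: "p \<in> Rvec n" "q \<in> Rvec m" for r p q
  proof -
    let ?gx = "grad_on (Rvec n) (\<lambda>x'. c t (x', u)) x"
    let ?gu = "grad_on (Rvec m) (\<lambda>u'. c t (x, u')) u"
    have b: "norm ?gx \<le> G * r" "norm ?gu \<le> G * r"
      using costs t x u r unfolding costs_ok_def by blast+
    have "D (p, q) = D (p, 0) + D (0, q)"
      using linear_add[OF has_derivative_linear[OF D], of "(p, 0)" "(0, q)"] by simp
    also have "\<dots> = ?gx \<bullet> p + ?gu \<bullet> q" using gx(2) gu(2) pq by simp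
    finally have "\<bar>D (p, q)\<bar> \<le> norm ?gx * norm p + norm ?gu * norm q"
      using Cauchy_Schwarz_ineq2[of ?gx p] Cauchy_Schwarz_ineq2[of ?gu q] by linarith
    also have "\<dots> \<le> G * r * norm p + G * r * norm q"
      using b by (intro add_mono mult_right_mono) auto
    finally show ?thesis by (simp add: distrib_left)
  qed
  then show ?thesis using that[OF D] by blast
qed

lemma cost_convex: "t \<le> T \<Longrightarrow> convex_on XU (c t)"
  using costs unfolding costs_ok_def by blast

text \<open>By convexity the tangent at \<open>(x, u)\<close> suffices, so only this point has to
  lie within radius \<open>r\<close>.\<close>

lemma cost_diff_le:
  assumes t: "t \<le> T" and x: "x \<in> Rvec n" "u \<in> Rvec m" "norm x \<le> r" "norm u \<le> r"
    and y: "y \<in> Rvec n" "v \<in> Rvec m"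
  shows "c t (x, u) - c t (y, v) \<le> G * r * (norm (x - y) + norm (u - v))"
proof -
  obtain D where D: "(c t has_derivative D) (at (x, u) within XU)"
    "\<forall>r. \<forall>p\<in>Rvec n. \<forall>q\<in>Rvec m. norm x \<le> r \<and> norm u \<le> r \<longrightarrow> \<bar>D (p, q)\<bar> \<le> G * r * (norm p + norm q)"
    using cost_derivative[OF t x(1,2)] .
  have "\<bar>D (y - x, v - u)\<bar> \<le> G * r * (norm (y - x) + norm (v - u))"
    using D(2) x y subspace_diff[OF subspace_Rvec] by blast
  moreover  have "c t (x, u) + D ((y, v) - (x, u)) \<le> c t (y, v)"
    using x y by (intro convex_on_above_tangent[OF subspace_XU cost_convex[OF t] D(1)]) auto
  ultimately show ?thesis by (simp add: norm_minus_commute)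
qed

end

section \<open>Projected gradient descent\<close>

text \<open>The squared distance to \<open>N\<close> serves as potential: the projection does not
  increase it, and expanding the gradient step bounds the linearized loss by its decrease plus a
  term quadratic in \<eta>. Convexity enters only as the tangent inequality at the iterates.\<close>

lemma projected_gradient_regret:
  fixes M g :: "nat \<Rightarrow> 'a::real_inner" and f :: "nat \<Rightarrow> 'a \<Rightarrow> real"
  assumes S: "compact S" "convex S" and N: "N \<in> S" and \<eta>: "0 < \<eta>"
    and step: "\<And>t. M (Suc t) = proj_on S (M t - \<eta> *\<^sub>R g t)"
    and g: "\<And>t. t \<le> T \<Longrightarrow> norm (g t) \<le> L" "\<And>t. t \<le> T \<Longrightarrow> f t (M t) + g t \<bullet> (N - M t) \<le> f t N"
  shows "(\<Sum>t\<le>T. f t (M t) - f t N) \<le> (norm (M 0 - N))\<^sup>2 / (2 * \<eta>) + \<eta> * L\<^sup>2 * real (Suc T) / 2"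
proof -
  let ?d = "\<lambda>t. (norm (M t - N))\<^sup>2"
  have one: "f t (M t) - f t N \<le> (?d t - ?d (Suc t)) / (2 * \<eta>) + \<eta> * L\<^sup>2 / 2" if t: "t \<le> T" for t
  proof -
    have "?d (Suc t) \<le> (norm (M t - \<eta> *\<^sub>R g t - N))\<^sup>2"
      unfolding step by (intro power_mono norm_proj_on_diff_le S N) simp
    also have "\<dots> = ?d t - 2 * \<eta> * (g t \<bullet> (M t - N)) + \<eta>\<^sup>2 * (norm (g t))\<^sup>2"
      unfolding power2_norm_eq_inner
      by (simp add: inner_diff_left inner_diff_right inner_commute power2_eq_square algebra_simps)
    also have "\<dots> \<le> ?d t - 2 * \<eta> * (g t \<bullet> (M t - N)) + \<eta>\<^sup>2 * L\<^sup>2"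
      using g(1)[OF t] by (intro add_left_mono mult_left_mono power_mono) auto
    finally have "2 * \<eta> * (g t \<bullet> (M t - N)) \<le> ?d t - ?d (Suc t) + \<eta>\<^sup>2 * L\<^sup>2" by simp
    then have "g t \<bullet> (M t - N) \<le> (?d t - ?d (Suc t) + \<eta>\<^sup>2 * L\<^sup>2) / (2 * \<eta>)"
      using \<eta> by (simp add: pos_le_divide_eq mult.commute)
    also have "\<dots> = (?d t - ?d (Suc t)) / (2 * \<eta>) + \<eta> * L\<^sup>2 / 2"
      using \<eta> by (simp add: add_divide_distrib power2_eq_square)
    finally show ?thesis using g(2)[OF t] by (simp add: inner_diff_right)
  qed
  have "(\<Sum>t\<le>T. f t (M t) - f t N) \<le> (\<Sum>t\<le>T. (?d t - ?d (Suc t)) / (2 * \<eta>) + \<eta> * L\<^sup>2 / 2)"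
    by (intro sum_mono one) simp
  also have "\<dots> = (\<Sum>t\<le>T. ?d t - ?d (Suc t)) / (2 * \<eta>) + real (Suc T) * (\<eta> * L\<^sup>2 / 2)"
    by (simp add: sum.distrib sum_divide_distrib)
  also have "(\<Sum>t\<le>T. ?d t - ?d (Suc t)) = ?d 0 - ?d (Suc T)" by (rule sum_telescope)
  also have "(?d 0 - ?d (Suc T)) / (2 * \<eta>) \<le> ?d 0 / (2 * \<eta>)"
    using \<eta> by (intro divide_right_mono) auto
  finally show ?thesis by (simp add: mult_ac)
qed

lemma sum_linear_combination:
  fixes A B :: "'b \<Rightarrow> real"
  shows "(\<Sum>i\<in>N. r * (p * A i + q * B i)) = r * (p * sum A N + q * sum B N)"
  by (simp add: sum_distrib_left sum.distrib distrib_left)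

section \<open>Tracking\<close>

text \<open>One disturbance sequence is fixed throughout; supremum and infimum are taken only in the
  final theorem.\<close>

locale ogd_control = control_costs +
  fixes K :: rmat and H :: nat and \<epsilon> \<eta> :: real and M0 :: policy and w :: "nat \<Rightarrow> rvec"
  assumes K: "strongly_stable S K" and H1: "1 \<le> H" and eta_pos: "0 < \<eta>"
    and M0: "M0 \<in> Omega S K H \<epsilon>" and w: "w \<in> disturbances S"
begin

definition "I = \<lparr>inK = K, inH = H, ineps = \<epsilon>, ineta = \<eta>, inM0 = M0\<rparr>"

abbreviation "x \<equiv> ogd_state S c I w"
abbreviation "u \<equiv> ogd_input S c I w"
abbreviation "Mt t \<equiv> snd (ogd_run S c I w t)"
abbreviation "f t \<equiv> approx_cost S c K H w t"
abbreviation "pol \<equiv> policy_space H m n"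
abbreviation "g t M \<equiv> grad_on pol (f t) M"
abbreviation "act M t \<equiv> (\<Sum>j<H. mat_vec (entry M (Suc j)) (lag w t (Suc j)))"
abbreviation "xr t M \<equiv> respx K H M (lag w t)"
abbreviation "ur t M \<equiv> respu K H M (lag w t)"

lemma f_eq: "f t M = c t (xr t M, ur t M)"
  by (simp add: approx_cost_def respx_def respu_def)

lemma w_in: "w t \<in> Rvec n" and w_norm: "norm (w t) \<le> wnorm"
  using w in_linf_ball_wbar by (auto simp: disturbances_def)

lemma lag_in: "lag w t k \<in> Rvec n" and lag_norm: "norm (lag w t k) \<le> wnorm"
  using w_in w_norm wnorm_nonneg by (auto simp: lag_def subspace_0)

lemma resp_in: "xr t M \<in> Rvec n" "M \<in> pol \<Longrightarrow> ur t M \<in> Rvec m"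
  by (intro respx_in_Rvec respu_in_Rvec K lag_in; assumption)+

lemma resp_norm: "M \<in> Mset S H \<Longrightarrow> norm (xr t M) \<le> signal_gain * wnorm"
  "M \<in> Mset S H \<Longrightarrow> norm (ur t M) \<le> signal_gain * wnorm"
  by (rule norm_resp_le[OF K _ lag_in lag_norm]; assumption)+

text \<open>The cost gradient over the radius of all signals, times the norm of the linear part of
  the response. Its two factors \<open>wnorm\<close> make it proportional to
  \<open>n * H\<close>.\<close>

definition Lip :: real where
  "Lip = G * (signal_gain * wnorm) * (lin_gain * (real H * wnorm))"

lemma Lip_nonneg: "0 \<le> Lip"
  using G_nonneg signal_gain_nonneg wnorm_nonneg lin_gain_nonneg by (simp add: Lip_def)

lemma f_gradient:
  assumes t: "t \<le> T" and M: "M \<in> Mset S H"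
  shows "norm (g t M) \<le> Lip" "N \<in> pol \<Longrightarrow> f t M + g t M \<bullet> (N - M) \<le> f t N"
proof -
  have Mp: "M \<in> pol" using M by (rule Mset_in_policy_space)
  obtain D where D: "(c t has_derivative D) (at (xr t M, ur t M) within XU)"
    and D': "\<forall>r. \<forall>p\<in>Rvec n. \<forall>q\<in>Rvec m. norm (xr t M) \<le> r \<and> norm (ur t M) \<le> r \<longrightarrow>
       \<bar>D (p, q)\<bar> \<le> G * r * (norm p + norm q)"
    using cost_derivative[OF t resp_in(1) resp_in(2)[OF Mp]] .
  have D: "(c t has_derivative D) (at (xr t M, ur t M) within XU)"
    "\<And>p q. p \<in> Rvec n \<Longrightarrow> q \<in> Rvec m \<Longrightarrow> \<bar>D (p, q)\<bar> \<le> G * (signal_gain * wnorm) * (norm p + norm q)"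
    using D D' resp_norm[OF M] by blast+
  let ?X = "\<lambda>h. linx K H h (lag w t)"
  let ?U = "\<lambda>h. linu K H h (lag w t)"
  have "((\<lambda>N. (xr t N, ur t N)) has_derivative (\<lambda>h. (0 + ?X h, 0 + ?U h))) (at M within pol)"
    unfolding respx_eq[OF lag_in] respu_eq[OF lag_in]
    by (intro has_derivative_Pair has_derivative_add has_derivative_const
        bounded_linear_imp_has_derivative bounded_linear_linx bounded_linear_linu)
  moreover have "(c t has_derivative D) (at (xr t M, ur t M) within (\<lambda>N. (xr t N, ur t N)) ` pol)"
    using resp_in by (intro has_derivative_subset[OF D(1)]) auto
  ultimately have "((\<lambda>N. c t (xr t N, ur t N)) has_derivative (\<lambda>h. D (0 + ?X h, 0 + ?U h))) (at M within pol)"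
    by (rule has_derivative_in_compose)
  then have df: "(f t has_derivative (\<lambda>h. D (?X h, ?U h))) (at M within pol)"
    by (simp add: f_eq[abs_def])
  note gr = grad_on_properties[OF riesz_policy_space df Mp]
  \<comment> \<open>Evaluating the derivative at the gradient itself gives the squared norm, so one
    factor can be cancelled at the end.\<close>
  have "norm (g t M) * norm (g t M) = D (?X (g t M), ?U (g t M))"
    using gr(2)[OF gr(1)] by (simp flip: power2_norm_eq_inner power2_eq_square)
  also have "\<dots> \<le> G * (signal_gain * wnorm) * (norm (?X (g t M)) + norm (?U (g t M)))"
    by (rule abs_le_D1, rule D(2)[OF linx_in_Rvec[OF K] linu_in_Rvec[OF K gr(1)]])
  also have "\<dots> \<le> G * (signal_gain * wnorm) * (lin_gain * (real H * wnorm * norm (g t M)))"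
    using G_nonneg signal_gain_nonneg wnorm_nonneg by (intro mult_left_mono norm_lin_le K lag_norm) auto
  also have "\<dots> = Lip * norm (g t M)" by (simp add: Lip_def)
  finally show "norm (g t M) \<le> Lip"
    using Lip_nonneg by (cases "norm (g t M) = 0") (auto simp: mult_le_cancel_right)
  assume N: "N \<in> pol"
  \<comment> \<open>A convex cost composed with affine responses.\<close>
  have "convex_on pol (f t)"
  proof (rule convex_onI)
    fix s :: real and M N assume s: "0 < s" "s < 1" and MN: "M \<in> pol" "N \<in> pol"
    have "f t ((1 - s) *\<^sub>R M + s *\<^sub>R N)
        = c t ((1 - s) *\<^sub>R (xr t M, ur t M) + s *\<^sub>R (xr t N, ur t N))"
      by (simp add: f_eq resp_affine lag_in)
    also have "\<dots> \<le> (1 - s) * f t M + s * f t N"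
      unfolding f_eq using s MN resp_in by (intro convex_onD[OF cost_convex[OF t]]) auto
    finally show "f t ((1 - s) *\<^sub>R M + s *\<^sub>R N) \<le> (1 - s) * f t M + s * f t N" .
  qed (rule subspace_imp_convex, simp)
  from convex_on_above_tangent[OF subspace_policy_space this df Mp N]
  show "f t M + g t M \<bullet> (N - M) \<le> f t N"
    using gr(2) subspace_diff[OF subspace_policy_space N Mp] by simp
qed

lemma f_diff_le:
  assumes t: "t \<le> T" and M: "M \<in> Mset S H" and N: "N \<in> pol"
  shows "f t M - f t N \<le> Lip * norm (M - N)"
proof -
  have "f t M - f t N \<le> - (g t M \<bullet> (N - M))" using f_gradient(2)[OF t M N] by simp
  also have "\<dots> \<le> norm (g t M) * norm (N - M)" using Cauchy_Schwarz_ineq2[of "g t M" "N - M"] by linarith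
  also have "\<dots> \<le> Lip * norm (N - M)" by (intro mult_right_mono f_gradient(1)[OF t M]) simp
  finally show ?thesis by (simp add: norm_minus_commute)
qed

section \<open>The run of the algorithm compared with frozen-policy responses\<close>

lemma run_simps:
  "x 0 = 0" "x (Suc t) = \<Phi> K (x t) + (mat_vec (Bmat S) (act (Mt t) t) + w t)"
  "u t = - mat_vec K (x t) + act (Mt t) t"
  "Mt 0 = M0" "Mt (Suc t) = proj_on (Omega S K H \<epsilon>) (Mt t - \<eta> *\<^sub>R g t (Mt t))"
  by (simp_all add: ogd_state_def ogd_input_def ogd_action_def I_def case_prod_unfold sum.atLeast1_atMost_eq
      mat_vec_Acl mat_vec.add_right mat_vec.minus_right mat_vec.diff_right)

lemma Mt_in_Omega: "Mt t \<in> Omega S K H \<epsilon>"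
proof (cases t)
  case (Suc s)
  have "Omega S K H \<epsilon> \<noteq> {}" using M0 by blast
  then show ?thesis using proj_on_properties(1)[OF compact_Omega] Suc by (simp only: run_simps)
qed (simp add: I_def M0)

lemma Mt_in_Mset: "Mt t \<in> Mset S H"
  using Mt_in_Omega Omega_subset_Mset by blast

text \<open>\<open>Mt t\<close> is itself feasible, so projecting the gradient step cannot increase
  the distance to it.\<close>

lemma Mt_step: "t \<le> T \<Longrightarrow> norm (Mt (Suc t) - Mt t) \<le> \<eta> * Lip"
proof -
  assume t: "t \<le> T"
  have "norm (Mt (Suc t) - Mt t) \<le> norm (Mt t - \<eta> *\<^sub>R g t (Mt t) - Mt t)"
    unfolding run_simps(5) by (rule norm_proj_on_diff_le[OF compact_Omega convex_Omega Mt_in_Omega])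
  also have "\<dots> = \<eta> * norm (g t (Mt t))" using eta_pos by simp
  also have "\<dots> \<le> \<eta> * Lip" using eta_pos by (intro mult_left_mono f_gradient t Mt_in_Mset) auto
  finally show ?thesis .
qed

lemma Mt_variation: "s + k \<le> T \<Longrightarrow> norm (Mt s - Mt (s + k)) \<le> \<eta> * Lip * real k"
proof (induction k)
  case (Suc k)
  have "norm (Mt s - Mt (s + Suc k)) \<le> norm (Mt s - Mt (s + k)) + norm (Mt (s + k) - Mt (Suc (s + k)))"
    using norm_triangle_ineq[of "Mt s - Mt (s + k)" "Mt (s + k) - Mt (Suc (s + k))"] by simp
  also have "\<dots> \<le> \<eta> * Lip * real k + \<eta> * Lip"
    using Suc Mt_step[of "s + k"] by (intro add_mono) (auto simp: norm_minus_commute)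
  finally show ?case by (simp add: algebra_simps)
qed simp

text \<open>The forcing of the closed loop at time \<open>s\<close> if policy \<open>M\<close> is in
  use then.\<close>

definition vt :: "nat \<Rightarrow> policy \<Rightarrow> rvec" where
  "vt s M = mat_vec (Bmat S) (act M s) + w s"

lemma vt_in: "vt s M \<in> Rvec n"
  unfolding vt_def by (intro subspace_add subspace_Rvec mat_vec_in_Rvec[OF Bmat_in] w_in)

lemma vt_norm: "M \<in> Mset S H \<Longrightarrow> norm (vt s M) \<le> (1 + \<kappa>B * a / \<gamma>) * wnorm"
proof -
  assume M: "M \<in> Mset S H"
  have "norm (vt s M) \<le> \<kappa>B * norm (act M s) + wnorm"
    unfolding vt_def using norm_Bmat_le[of "act M s"] w_norm[of s] norm_triangle_ineq[of "mat_vec (Bmat S) (act M s)" "w s"]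
    by linarith
  also have "\<dots> \<le> \<kappa>B * (a / \<gamma> * wnorm) + wnorm"
    using kappaB_ge1 by (intro add_right_mono mult_left_mono norm_Mset_action_le M lag_norm) auto
  finally show ?thesis by (simp add: algebra_simps)
qed

lemma vt_diff: "norm (vt s M - vt s N) \<le> \<kappa>B * (real H * wnorm * norm (M - N))"
proof -
  have "vt s M - vt s N = mat_vec (Bmat S) (\<Sum>j<H. mat_vec (entry (M - N) (Suc j)) (lag w s (Suc j)))"
    by (simp add: vt_def mat_vec.diff_left sum_subtractf mat_vec.diff_right)
  also have "norm \<dots> \<le> \<kappa>B * norm (\<Sum>j<H. mat_vec (entry (M - N) (Suc j)) (lag w s (Suc j)))"
    by (rule norm_Bmat_le)
  also have "\<dots> \<le> \<kappa>B * (real H * wnorm * norm (M - N))"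
    using kappaB_ge1 by (intro mult_left_mono norm_policy_action_le lag_norm) auto
  finally show ?thesis .
qed

lemma x_eq: "x t = (\<Sum>i<t. (\<Phi> K ^^ i) (vt (t - 1 - i) (Mt (t - 1 - i))))"
  by (rule linear_recurrence_solution[where v = "\<lambda>s. vt s (Mt s)"])
     (simp_all only: run_simps vt_def linear_mat_vec)

text \<open>Reconciles the memory window \<open>i < H\<close> with the actual past
  \<open>i < t\<close>, using that disturbances at negative times vanish.\<close>

lemma sum_lag_truncate:
  fixes p :: "nat \<Rightarrow> rvec"
  assumes "\<And>i. t \<le> i \<Longrightarrow> p i = 0"
  shows "(\<Sum>i<H. p i) = (\<Sum>i<t. if i < H then p i else 0)"
proof -
  have "(\<Sum>i<H. p i) = sum p ({..<t} \<inter> {..<H})"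
    using assms by (intro sum.mono_neutral_right) (auto simp: not_less[symmetric])
  then show ?thesis by (simp add: sum.inter_restrict)
qed

lemma xr_eq: "xr t M = (\<Sum>i<t. (\<Phi> K ^^ i) (if i < H then vt (t - 1 - i) M else 0))"
proof -
  let ?p = "\<lambda>i. (\<Phi> K ^^ i) (lag w t (Suc i) + mat_vec (Bmat S) (\<Sum>j<H. mat_vec (entry M (Suc j)) (lag w t (Suc i + Suc j))))"
  note lin = linear_funpow[OF linear_mat_vec]
  have "xr t M = (\<Sum>i<H. ?p i)"
    by (simp add: respx_eq[OF lag_in] linx_def sum.distrib linear_add[OF lin])
  also have "\<dots> = (\<Sum>i<t. if i < H then ?p i else 0)"
    by (rule sum_lag_truncate) (simp add: lag_def mat_vec.zero_right linear_0[OF lin])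
  also have "\<dots> = (\<Sum>i<t. (\<Phi> K ^^ i) (if i < H then vt (t - 1 - i) M else 0))"
  proof (rule sum.cong[OF refl])
    fix i assume "i \<in> {..<t}"
    then have i: "i < t" by simp
    \<comment> \<open>A policy acting \<open>Suc i\<close> steps ago saw its own lags from time
      \<open>t - 1 - i\<close>; values at negative times vanish on both sides alike.\<close>
    have "lag w t (Suc i + k) = lag w (t - 1 - i) k" for k
      using i by (auto simp: lag_def)
    then have "lag w t (Suc i + Suc j) = lag w (t - 1 - i) (Suc j)" for j by blast
    moreover have "lag w t (Suc i) = w (t - 1 - i)" using i by (simp add: lag_def)
    ultimately show "(if i < H then ?p i else 0) = (\<Phi> K ^^ i) (if i < H then vt (t - 1 - i) M else 0)"
      by (simp add: vt_def add.commute linear_0[OF lin])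
  qed
  finally show ?thesis .
qed

definition track_error :: real where
  "track_error = \<kappa>\<^sup>2 * (\<kappa>B * (real H * wnorm * (\<eta> * Lip)) / \<gamma>\<^sup>2
     + (1 + \<kappa>B * a / \<gamma>) * wnorm * ((1 - \<gamma>) ^ H / \<gamma>))"

lemma x_tracks:
  assumes t: "t \<le> T"
  shows "norm (x t - xr t (Mt t)) \<le> track_error"
proof -
  let ?\<rho> = "1 - \<gamma>"
  let ?V = "(1 + \<kappa>B * a / \<gamma>) * wnorm"
  let ?q = "\<kappa>B * (real H * wnorm * (\<eta> * Lip))"
  have V: "0 \<le> ?V" using kappaB_ge1 a_pos gamma_pos wnorm_nonneg by simp
  have q: "0 \<le> ?q" using kappaB_ge1 wnorm_nonneg eta_pos Lip_nonneg by simp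
  let ?\<delta> = "\<lambda>i. vt (t - 1 - i) (Mt (t - 1 - i)) - (if i < H then vt (t - 1 - i) (Mt t) else 0)"
  have "x t - xr t (Mt t) = (\<Sum>i<t. (\<Phi> K ^^ i) (?\<delta> i))"
    by (simp only: x_eq[of t] xr_eq sum_subtractf linear_diff[OF linear_funpow[OF linear_mat_vec]])
  then have "norm (x t - xr t (Mt t)) = norm (\<Sum>i<t. (\<Phi> K ^^ i) (?\<delta> i))" by (rule arg_cong)
  also have "\<dots> \<le> (\<Sum>i<t. \<kappa>\<^sup>2 * (?q * (real (Suc i) * ?\<rho> ^ i) + ?V * (if i < H then 0 else ?\<rho> ^ i)))"
  proof (rule sum_norm_le)
    fix i assume "i \<in> {..<t}"
    then have i: "i < t" by simp
    have \<delta>: "norm (?\<delta> i) \<le> ?q * real (Suc i) + (if i < H then 0 else ?V)"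
    proof (cases "i < H")
      case True
      have "norm (Mt (t - 1 - i) - Mt t) \<le> \<eta> * Lip * real (Suc i)"
        using Mt_variation[of "t - 1 - i" "Suc i"] i t by simp
      then have "\<kappa>B * (real H * wnorm * norm (Mt (t - 1 - i) - Mt t)) \<le> \<kappa>B * (real H * wnorm * (\<eta> * Lip * real (Suc i)))"
        using kappaB_ge1 wnorm_nonneg by (intro mult_left_mono) auto
      then have "norm (vt (t - 1 - i) (Mt (t - 1 - i)) - vt (t - 1 - i) (Mt t)) \<le> \<kappa>B * (real H * wnorm * (\<eta> * Lip * real (Suc i)))"
        by (rule order_trans[OF vt_diff])
      then show ?thesis using True by (simp only: if_True add_0_right mult.assoc)
    next
      case False
      then have "norm (?\<delta> i) \<le> ?V" using vt_norm[OF Mt_in_Mset] by simp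
      moreover have "0 \<le> ?q * real (Suc i)" by (intro mult_nonneg_nonneg q) simp
      ultimately show ?thesis using False by (simp only: if_False)
    qed
    have "norm ((\<Phi> K ^^ i) (?\<delta> i)) \<le> \<kappa>\<^sup>2 * ?\<rho> ^ i * norm (?\<delta> i)"
    proof (rule strongly_stable_funpow[OF K])
      have "(if i < H then vt (t - 1 - i) (Mt t) else 0) \<in> Rvec n"
        by (simp add: vt_in subspace_0)
      then show "?\<delta> i \<in> Rvec n" by (intro subspace_diff[OF subspace_Rvec vt_in])
    qed
    also have "\<dots> \<le> \<kappa>\<^sup>2 * ?\<rho> ^ i * (?q * real (Suc i) + (if i < H then 0 else ?V))"
      using gamma_le1 by (intro mult_left_mono \<delta>) auto
    also have "\<dots> = \<kappa>\<^sup>2 * (?q * (real (Suc i) * ?\<rho> ^ i) + ?V * (if i < H then 0 else ?\<rho> ^ i))"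
      by (cases "i < H") (simp_all only: if_True if_False algebra_simps mult_zero_right add_0_right)
    finally show "norm ((\<Phi> K ^^ i) (?\<delta> i)) \<le> \<kappa>\<^sup>2 * (?q * (real (Suc i) * ?\<rho> ^ i) + ?V * (if i < H then 0 else ?\<rho> ^ i))" .
  qed
  also have "\<dots> = \<kappa>\<^sup>2 * (?q * (\<Sum>i<t. real (Suc i) * ?\<rho> ^ i) + ?V * (\<Sum>i<t. if i < H then 0 else ?\<rho> ^ i))"
    by (rule sum_linear_combination)
  also have "\<dots> \<le> \<kappa>\<^sup>2 * (?q * (1 / \<gamma>\<^sup>2) + ?V * (?\<rho> ^ H / \<gamma>))"
    by (intro mult_left_mono add_mono arith_geometric_sum_le geometric_tail_le gamma_pos gamma_le1 V q) simp
  finally show ?thesis by (simp add: track_error_def)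
qed

lemma x_in: "x t \<in> Rvec n"
  unfolding x_eq by (intro subspace_sum subspace_Rvec funpow_in_Rvec K vt_in)

lemma act_in: "M \<in> pol \<Longrightarrow> act M t \<in> Rvec m"
  by (intro subspace_sum subspace_Rvec mat_vec_in_Rvec[of _ m n]) (simp add: policy_space_def)

lemma Mt_in_pol: "Mt t \<in> pol"
  by (rule Mset_in_policy_space[OF Mt_in_Mset])

lemma u_in: "u t \<in> Rvec m"
  unfolding run_simps
  by (intro subspace_add subspace_neg subspace_Rvec act_in Mt_in_pol mat_vec_in_Rvec[OF strongly_stable_in[OF K]])

lemma xu_norm: "norm (x t) \<le> signal_gain * wnorm" "norm (u t) \<le> signal_gain * wnorm"
proof -
  have "norm (x t) \<le> \<kappa>\<^sup>2 / \<gamma> * ((1 + \<kappa>B * a / \<gamma>) * wnorm)"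
    unfolding x_eq using kappaB_ge1 a_pos gamma_pos wnorm_nonneg
    by (intro norm_resolvent_le K conjI vt_in vt_norm Mt_in_Mset) auto
  then have x: "norm (x t) \<le> state_gain * wnorm" by (simp add: state_gain_def mult.assoc)
  then show "norm (x t) \<le> signal_gain * wnorm"
    using mult_right_mono[OF gain_le(1) wnorm_nonneg] by linarith
  have "norm (u t) \<le> norm (mat_vec K (x t)) + norm (act (Mt t) t)"
    unfolding run_simps(3) using norm_triangle_ineq[of "- mat_vec K (x t)" "act (Mt t) t"] by simp
  also have "\<dots> \<le> \<kappa> * (state_gain * wnorm) + a / \<gamma> * wnorm"
  proof (rule add_mono)
    show "norm (mat_vec K (x t)) \<le> \<kappa> * (state_gain * wnorm)"
      using strongly_stable_norm[OF K, of "x t"] mult_left_mono[OF x, of \<kappa>] kappa_pos by linarith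
  qed (intro norm_Mset_action_le[OF Mt_in_Mset] lag_norm)
  also have "\<dots> = (\<kappa> * state_gain + a / \<gamma>) * wnorm" by (simp add: algebra_simps)
  also have "\<dots> \<le> signal_gain * wnorm" using gain_le(2) wnorm_nonneg by (rule mult_right_mono)
  finally show "norm (u t) \<le> signal_gain * wnorm" .
qed

lemma cost_tracks:
  assumes t: "t \<le> T"
  shows "c t (x t, u t) - f t (Mt t) \<le> G * (signal_gain * wnorm) * ((1 + \<kappa>) * track_error)"
proof -
  have "u t - ur t (Mt t) = - mat_vec K (x t - xr t (Mt t))"
    by (simp add: run_simps respu_eq_respx mat_vec.diff_right)
  then have "norm (u t - ur t (Mt t)) \<le> \<kappa> * norm (x t - xr t (Mt t))"
    using strongly_stable_norm[OF K] by simp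
  then have "norm (x t - xr t (Mt t)) + norm (u t - ur t (Mt t)) \<le> (1 + \<kappa>) * norm (x t - xr t (Mt t))"
    by (simp add: distrib_right)
  also have "\<dots> \<le> (1 + \<kappa>) * track_error"
    using kappa_pos by (intro mult_left_mono x_tracks t) auto
  finally have "G * (signal_gain * wnorm) * (norm (x t - xr t (Mt t)) + norm (u t - ur t (Mt t)))
      \<le> G * (signal_gain * wnorm) * ((1 + \<kappa>) * track_error)"
    using G_nonneg signal_gain_nonneg wnorm_nonneg by (intro mult_left_mono) auto
  moreover have "c t (x t, u t) - f t (Mt t)
      \<le> G * (signal_gain * wnorm) * (norm (x t - xr t (Mt t)) + norm (u t - ur t (Mt t)))"
    unfolding f_eq by (intro cost_diff_le t x_in u_in xu_norm resp_in Mt_in_pol)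
  ultimately show ?thesis by linarith
qed

text \<open>Cutting the response of \<open>K'\<close> after \<open>H\<close> lags, plus the
  imitation error of \<open>dap_of\<close>.\<close>

definition bench_error :: real where
  "bench_error = \<kappa>\<^sup>2 * (1 - \<gamma>) ^ H / \<gamma> * wnorm + dap_error H wnorm"

lemma lin_state_lag: "lin_state S K' w t = (\<Sum>i<t. (\<Phi> K' ^^ i) (lag w t (Suc i)))"
  unfolding lin_state_eq by (intro sum.cong) (auto simp: lag_def)

lemma lin_in:
  assumes "strongly_stable S K'"
  shows "lin_state S K' w t \<in> Rvec n" "lin_input S K' w t \<in> Rvec m"
proof -
  show "lin_state S K' w t \<in> Rvec n"
    unfolding lin_state_eq by (intro subspace_sum subspace_Rvec funpow_in_Rvec assms w_in)
  show "lin_input S K' w t \<in> Rvec m"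
    unfolding lin_input_def
    by (intro subspace_neg subspace_Rvec mat_vec_in_Rvec[OF strongly_stable_in[OF assms]])
qed

lemma lin_norm:
  assumes K': "strongly_stable S K'"
  shows "norm (lin_state S K' w t) \<le> signal_gain * wnorm" "norm (lin_input S K' w t) \<le> signal_gain * wnorm"
proof -
  have "\<kappa>\<^sup>2 / \<gamma> * 1 \<le> state_gain"
    unfolding state_gain_def using kappaB_ge1 a_pos gamma_pos by (intro mult_left_mono) auto
  then have "\<kappa>\<^sup>2 / \<gamma> * wnorm \<le> state_gain * wnorm" using wnorm_nonneg by (intro mult_right_mono) auto
  moreover have "norm (lin_state S K' w t) \<le> \<kappa>\<^sup>2 / \<gamma> * wnorm"
    unfolding lin_state_eq by (intro norm_resolvent_le K' conjI w_in w_norm wnorm_nonneg)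
  ultimately have x: "norm (lin_state S K' w t) \<le> state_gain * wnorm" by linarith
  then show "norm (lin_state S K' w t) \<le> signal_gain * wnorm"
    using mult_right_mono[OF gain_le(1) wnorm_nonneg] by linarith
  have "norm (lin_input S K' w t) \<le> \<kappa> * norm (lin_state S K' w t)"
    unfolding lin_input_def using strongly_stable_norm[OF K'] by simp
  also have "\<dots> \<le> \<kappa> * (state_gain * wnorm)" using x kappa_pos by (intro mult_left_mono) auto
  also have "\<dots> \<le> signal_gain * wnorm"
  proof -
    have "\<kappa> * state_gain \<le> signal_gain"
      using gain_le(2) a_pos gamma_pos divide_pos_pos[of a \<gamma>] by linarith
    then show ?thesis using mult_right_mono[OF _ wnorm_nonneg] by (simp flip: mult.assoc)
  qed
  finally show "norm (lin_input S K' w t) \<le> signal_gain * wnorm" .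
qed

lemma cost_dap_of:
  assumes t: "t \<le> T" and K': "strongly_stable S K'"
  shows "f t (dap_of K K' H) - c t (lin_state S K' w t, lin_input S K' w t)
    \<le> G * (signal_gain * wnorm) * ((1 + \<kappa>) * bench_error)"
proof -
  let ?M = "dap_of K K' H" and ?y = "lin_state S K' w t" and ?v = "lin_input S K' w t"
  let ?p = "\<Sum>i<H. (\<Phi> K' ^^ i) (lag w t (Suc i))"
  obtain e where e: "e \<in> Rvec n" "norm e \<le> dap_error H wnorm" "xr t ?M = ?p + e"
    "ur t ?M = - mat_vec K' ?p + - mat_vec K e"
    using resp_dap_of[OF K K' lag_in lag_norm] .
  note lin = linear_funpow[OF linear_mat_vec]
  have M: "?M \<in> Mset S H" by (intro dap_of_in_Mset K K')
  have "?p = (\<Sum>i<t. if i < H then (\<Phi> K' ^^ i) (lag w t (Suc i)) else 0)"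
    by (rule sum_lag_truncate) (simp add: lag_def linear_0[OF lin])
  then have "?p - ?y = (\<Sum>i<t. (if i < H then (\<Phi> K' ^^ i) (lag w t (Suc i)) else 0) - (\<Phi> K' ^^ i) (lag w t (Suc i)))"
    by (simp only: lin_state_lag sum_subtractf)
  also have "\<dots> = (\<Sum>i<t. if i < H then 0 else - (\<Phi> K' ^^ i) (lag w t (Suc i)))"
    by (rule sum.cong) auto
  finally have "norm (?p - ?y) = norm (\<Sum>i<t. if i < H then 0 else - (\<Phi> K' ^^ i) (lag w t (Suc i)))"
    by (rule arg_cong)
  also have "\<dots> \<le> (\<Sum>i<t. \<kappa>\<^sup>2 * wnorm * (if i < H then 0 else (1 - \<gamma>) ^ i))"
  proof (rule sum_norm_le)
    fix i
    have "norm ((\<Phi> K' ^^ i) (lag w t (Suc i))) \<le> \<kappa>\<^sup>2 * (1 - \<gamma>) ^ i * norm (lag w t (Suc i))"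
      by (intro strongly_stable_funpow K' lag_in)
    also have "\<dots> \<le> \<kappa>\<^sup>2 * (1 - \<gamma>) ^ i * wnorm"
      using gamma_le1 by (intro mult_left_mono lag_norm) auto
    finally show "norm (if i < H then 0 else - (\<Phi> K' ^^ i) (lag w t (Suc i)))
        \<le> \<kappa>\<^sup>2 * wnorm * (if i < H then 0 else (1 - \<gamma>) ^ i)"
      by (simp add: mult_ac)
  qed
  also have "\<dots> = \<kappa>\<^sup>2 * wnorm * (\<Sum>i<t. if i < H then 0 else (1 - \<gamma>) ^ i)" by (simp only: sum_distrib_left)
  also have "\<dots> \<le> \<kappa>\<^sup>2 * wnorm * ((1 - \<gamma>) ^ H / \<gamma>)"
    using wnorm_nonneg by (intro mult_left_mono geometric_tail_le gamma_pos gamma_le1) auto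
  finally have pe: "norm (?p - ?y) + norm e \<le> bench_error"
    using e(2) by (simp add: bench_error_def mult_ac)
  have "xr t ?M - ?y = (?p - ?y) + e" by (simp add: e)
  then have "norm (xr t ?M - ?y) \<le> norm (?p - ?y) + norm e"
    by (simp only: norm_triangle_ineq)
  moreover have "norm (ur t ?M - ?v) \<le> \<kappa> * (norm (?p - ?y) + norm e)"
  proof -
    \<comment> \<open>The truncated part passes through \<open>K'\<close> and the imitation error
      through \<open>K\<close>; both gains are at most \<kappa>.\<close>
    have "ur t ?M - ?v = - mat_vec K' (?p - ?y) + - mat_vec K e"
      by (simp only: e lin_input_def mat_vec.diff_right) simp
    then have "norm (ur t ?M - ?v) \<le> norm (mat_vec K' (?p - ?y)) + norm (mat_vec K e)"
      using norm_triangle_ineq[of "- mat_vec K' (?p - ?y)" "- mat_vec K e"] by (simp only: norm_minus_cancel)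
    then show ?thesis
      using strongly_stable_norm[OF K', of "?p - ?y"] strongly_stable_norm[OF K, of e]
      by (simp only: distrib_left)
  qed
  ultimately have "norm (xr t ?M - ?y) + norm (ur t ?M - ?v) \<le> (1 + \<kappa>) * (norm (?p - ?y) + norm e)"
    by (simp only: distrib_right mult_1_left)
  also have "\<dots> \<le> (1 + \<kappa>) * bench_error"
    using pe kappa_pos by (intro mult_left_mono) auto
  finally have "G * (signal_gain * wnorm) * (norm (xr t ?M - ?y) + norm (ur t ?M - ?v))
      \<le> G * (signal_gain * wnorm) * ((1 + \<kappa>) * bench_error)"
    using G_nonneg signal_gain_nonneg wnorm_nonneg by (intro mult_left_mono) auto
  moreover have "f t ?M - c t (?y, ?v) \<le> G * (signal_gain * wnorm) * (norm (xr t ?M - ?y) + norm (ur t ?M - ?v))"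
    unfolding f_eq by (intro cost_diff_le t resp_in resp_norm M Mset_in_policy_space lin_in K')
  ultimately show ?thesis by linarith
qed

lemma regret_trivial:
  assumes K': "strongly_stable S K'"
  shows "(\<Sum>t\<le>T. c t (x t, u t)) - (\<Sum>t\<le>T. c t (lin_state S K' w t, lin_input S K' w t))
    \<le> 2 * real T * (G * (signal_gain * wnorm))"
proof -
  let ?d = "\<lambda>t. c t (x t, u t) - c t (lin_state S K' w t, lin_input S K' w t)"
  \<comment> \<open>Both trajectories start with zero state and zero input, so round 0 cancels and
    the bound is proportional to \<open>T\<close> rather than \<open>T + 1\<close>.\<close>
  have "u 0 = 0" by (simp add: run_simps lag_def mat_vec.zero_right)
  then have "?d 0 = 0" by (simp add: run_simps lin_input_def mat_vec.zero_right)
  moreover have "?d t \<le> 2 * (G * (signal_gain * wnorm))" if "t \<le> T" for t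
  proof -
    have "\<bar>c t (x t, u t)\<bar> \<le> G * (signal_gain * wnorm)"
      by (intro cost_abs_le that x_in u_in xu_norm)
    moreover have "\<bar>c t (lin_state S K' w t, lin_input S K' w t)\<bar> \<le> G * (signal_gain * wnorm)"
      by (intro cost_abs_le that lin_in lin_norm K')
    ultimately show ?thesis by linarith
  qed
  then have "(\<Sum>t\<in>{1..T}. ?d t) \<le> (\<Sum>t\<in>{1..T}. 2 * (G * (signal_gain * wnorm)))"
    by (intro sum_mono) auto
  moreover have "(\<Sum>t\<le>T. ?d t) = ?d 0 + (\<Sum>t\<in>{1..T}. ?d t)"
    by (simp add: sum.atMost_shift sum.atLeast1_atMost_eq)
  ultimately show ?thesis by (simp add: sum_subtractf mult_ac)
qed

lemma regret_against_benchmark: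
  assumes K': "K' \<in> benchmark S T" and HT: "H \<le> T" and Ks: "strongly_stable S Ks" "strictly_safe S \<epsilon>s Ks"
    and eps: "0 \<le> \<epsilon>" "0 < \<epsilon>s"
  shows "(\<Sum>t\<le>T. c t (x t, u t)) - (\<Sum>t\<le>T. c t (lin_state S K' w t, lin_input S K' w t))
    \<le> (2 * Mset_radius)\<^sup>2 / (2 * \<eta>) + \<eta> * Lip\<^sup>2 * real (Suc T) / 2
      + real (Suc T) * (G * (signal_gain * wnorm) * ((1 + \<kappa>) * track_error)
        + Lip * ((\<epsilon> + \<kappa> * dap_error H wnorm) / \<epsilon>s * (2 * Mset_radius))
        + G * (signal_gain * wnorm) * ((1 + \<kappa>) * bench_error))" (is "_ \<le> ?A + ?B + real (Suc T) * ?C")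
proof -
  have K's: "strongly_stable S K'" using K' by (simp add: benchmark_def)
  obtain M where M: "M \<in> Omega S K H \<epsilon>"
    "norm (M - dap_of K K' H) \<le> (\<epsilon> + \<kappa> * dap_error H wnorm) / \<epsilon>s * (2 * Mset_radius)"
    using comparator_in_Omega[OF K K' HT Ks eps M0] .
  have Ms: "M \<in> Mset S H" using M(1) Omega_subset_Mset by blast
  have "(norm (Mt 0 - M))\<^sup>2 / (2 * \<eta>) \<le> ?A"
    using eta_pos by (intro divide_right_mono power_mono norm_Mset_diff_le[OF Mt_in_Mset Ms]) auto
  moreover have "(\<Sum>t\<le>T. f t (Mt t) - f t M) \<le> (norm (Mt 0 - M))\<^sup>2 / (2 * \<eta>) + ?B"
  proof (rule projected_gradient_regret[where M = Mt and g = "\<lambda>t. g t (Mt t)", OF compact_Omega convex_Omega M(1) eta_pos])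
    show "Mt (Suc t) = proj_on (Omega S K H \<epsilon>) (Mt t - \<eta> *\<^sub>R g t (Mt t))" for t
      by (rule run_simps(5))
    show "norm (g t (Mt t)) \<le> Lip" if "t \<le> T" for t
      by (rule f_gradient(1)[OF that Mt_in_Mset])
    show "f t (Mt t) + g t (Mt t) \<bullet> (M - Mt t) \<le> f t M" if "t \<le> T" for t
      by (rule f_gradient(2)[OF that Mt_in_Mset Mset_in_policy_space[OF Ms]])
  qed
  ultimately have ogd: "(\<Sum>t\<le>T. f t (Mt t) - f t M) \<le> ?A + ?B" by (rule order_trans[OF _ add_right_mono, rotated])
  have "(\<Sum>t\<le>T. c t (x t, u t) - c t (lin_state S K' w t, lin_input S K' w t))
      \<le> (\<Sum>t\<le>T. (f t (Mt t) - f t M) + ?C)"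
  proof (rule sum_mono)
    fix t assume "t \<in> {..T}"
    then have t: "t \<le> T" by simp
    have "f t M - f t (dap_of K K' H) \<le> Lip * norm (M - dap_of K K' H)"
      by (intro f_diff_le t Ms Mset_in_policy_space dap_of_in_Mset K K's)
    also have "\<dots> \<le> Lip * ((\<epsilon> + \<kappa> * dap_error H wnorm) / \<epsilon>s * (2 * Mset_radius))"
      by (intro mult_left_mono M(2) Lip_nonneg)
    \<comment> \<open>The costs of the run and of \<open>K'\<close> are linked through
      \<open>f t (Mt t)\<close>, \<open>f t M\<close> and \<open>f t (dap_of K K' H)\<close>; the
      missing link from \<open>Mt t\<close> to \<open>M\<close> is left to the descent
      bound.\<close>
    finally have "(c t (x t, u t) - f t (Mt t)) + (f t M - f t (dap_of K K' H))
        + (f t (dap_of K K' H) - c t (lin_state S K' w t, lin_input S K' w t)) \<le> ?C"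
      by (intro add_mono cost_tracks[OF t] cost_dap_of[OF t K's])
    then show "c t (x t, u t) - c t (lin_state S K' w t, lin_input S K' w t) \<le> (f t (Mt t) - f t M) + ?C"
      by simp
  qed
  also have "\<dots> = (\<Sum>t\<le>T. f t (Mt t) - f t M) + real (Suc T) * ?C"
    by (rule trans[OF sum.distrib]) (simp only: sum_constant card_atMost)
  also have "\<dots> \<le> ?A + ?B + real (Suc T) * ?C"
    by (rule add_right_mono[OF ogd])
  finally show ?thesis by (simp only: sum_subtractf)
qed

end

section \<open>Polynomials\<close>

text \<open>The exponents \<open>e\<close> may repeat, so sums and products need not collect like
  terms; this is done here once.\<close>

lemma polynomial_funI:
  assumes J: "finite J"
    and F: "\<And>xs. length xs = k \<Longrightarrow> F xs = (\<Sum>j\<in>J. coef j * (\<Prod>i<k. xs ! i ^ e j i))"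
  shows "polynomial_fun k F"
  unfolding polynomial_fun_def
proof (intro exI conjI allI impI)
  show "finite (e ` J)" using J by simp
  fix xs :: "real list" assume xs: "length xs = k"
  have "F xs = (\<Sum>\<alpha>\<in>e ` J. \<Sum>j | j \<in> J \<and> e j = \<alpha>. coef j * (\<Prod>i<k. xs ! i ^ e j i))"
    unfolding F[OF xs] by (rule sum.image_gen[OF J])
  also have "\<dots> = (\<Sum>\<alpha>\<in>e ` J. (\<Sum>j | j \<in> J \<and> e j = \<alpha>. coef j) * (\<Prod>i<k. xs ! i ^ \<alpha> i))"
    by (simp add: sum_distrib_right)
  finally show "F xs = (\<Sum>\<alpha>\<in>e ` J. (\<Sum>j | j \<in> J \<and> e j = \<alpha>. coef j) * (\<Prod>i<k. xs ! i ^ \<alpha> i))" .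
qed

lemma polynomial_fun_const: "polynomial_fun k (\<lambda>_. r)"
  by (rule polynomial_funI[of "{()}" _ _ "\<lambda>_. r" "\<lambda>_ _. 0"]) auto

lemma polynomial_fun_nth:
  assumes "i < k"
  shows "polynomial_fun k (\<lambda>xs. xs ! i)"
proof (rule polynomial_funI[of "{()}" _ _ "\<lambda>_. 1" "\<lambda>_ j. if j = i then 1 else 0"])
  fix xs :: "real list"
  have "(\<Prod>j<k. xs ! j ^ (if j = i then 1 else 0)) = (\<Prod>j<k. if j = i then xs ! j else 1)"
    by (rule prod.cong) auto
  then show "xs ! i = (\<Sum>j\<in>{()}. 1 * (\<Prod>j<k. xs ! j ^ (if j = i then 1 else 0)))"
    using assms by simp
qed simp

lemma polynomial_fun_add:
  assumes "polynomial_fun k F" "polynomial_fun k F'"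
  shows "polynomial_fun k (\<lambda>xs. F xs + F' xs)"
proof -
  obtain E coef where E: "finite E" "\<And>xs. length xs = k \<Longrightarrow> F xs = (\<Sum>\<alpha>\<in>E. coef \<alpha> * (\<Prod>i<k. xs ! i ^ \<alpha> i))"
    using assms(1) unfolding polynomial_fun_def by blast
  obtain E' coef' where E': "finite E'" "\<And>xs. length xs = k \<Longrightarrow> F' xs = (\<Sum>\<alpha>\<in>E'. coef' \<alpha> * (\<Prod>i<k. xs ! i ^ \<alpha> i))"
    using assms(2) unfolding polynomial_fun_def by blast
  show ?thesis
    by (rule polynomial_funI[of "E <+> E'" _ _ "case_sum coef coef'" "case_sum (\<lambda>\<alpha>. \<alpha>) (\<lambda>\<alpha>. \<alpha>)"])
       (simp_all add: E E' sum.Plus)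
qed

lemma polynomial_fun_mult:
  assumes "polynomial_fun k F" "polynomial_fun k F'"
  shows "polynomial_fun k (\<lambda>xs. F xs * F' xs)"
proof -
  obtain E coef where E: "finite E" "\<And>xs. length xs = k \<Longrightarrow> F xs = (\<Sum>\<alpha>\<in>E. coef \<alpha> * (\<Prod>i<k. xs ! i ^ \<alpha> i))"
    using assms(1) unfolding polynomial_fun_def by blast
  obtain E' coef' where E': "finite E'" "\<And>xs. length xs = k \<Longrightarrow> F' xs = (\<Sum>\<alpha>\<in>E'. coef' \<alpha> * (\<Prod>i<k. xs ! i ^ \<alpha> i))"
    using assms(2) unfolding polynomial_fun_def by blast
  show ?thesis
  proof (rule polynomial_funI[of "E \<times> E'" _ _ "\<lambda>(\<alpha>, \<beta>). coef \<alpha> * coef' \<beta>" "\<lambda>(\<alpha>, \<beta>) i. \<alpha> i + \<beta> i"])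
    show "finite (E \<times> E')" using E E' by simp
    fix xs :: "real list" assume xs: "length xs = k"
    have "F xs * F' xs = (\<Sum>\<alpha>\<in>E. \<Sum>\<beta>\<in>E'. (coef \<alpha> * (\<Prod>i<k. xs ! i ^ \<alpha> i)) * (coef' \<beta> * (\<Prod>i<k. xs ! i ^ \<beta> i)))"
      by (simp only: E(2)[OF xs] E'(2)[OF xs] sum_product)
    also have "\<dots> = (\<Sum>\<alpha>\<in>E. \<Sum>\<beta>\<in>E'. coef \<alpha> * coef' \<beta> * (\<Prod>i<k. xs ! i ^ (\<alpha> i + \<beta> i)))"
      by (simp add: power_add prod.distrib mult_ac)
    finally show "F xs * F' xs = (\<Sum>j\<in>E \<times> E'. (case j of (\<alpha>, \<beta>) \<Rightarrow> coef \<alpha> * coef' \<beta>)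
        * (\<Prod>i<k. xs ! i ^ (case j of (\<alpha>, \<beta>) \<Rightarrow> \<lambda>i. \<alpha> i + \<beta> i) i))"
      by (simp add: sum.cartesian_product case_prod_unfold)
  qed
qed

lemma polynomial_fun_power: "polynomial_fun k F \<Longrightarrow> polynomial_fun k (\<lambda>xs. F xs ^ j)"
  by (induction j) (auto intro: polynomial_fun_const polynomial_fun_mult)

lemmas polynomial_fun_intros =
  polynomial_fun_add polynomial_fun_mult polynomial_fun_power polynomial_fun_const polynomial_fun_nth

section \<open>The constant\<close>

text \<open>The arguments are \<open>w\<close>, \<open>G\<close>, \<open>\<kappa>\<close>, \<open>\<kappa>\<^sub>B\<close>, \<open>a\<close> and \<open>g = \<gamma>\<^sup>-\<^sup>1\<close>.\<close>

definition signal_const :: "real \<Rightarrow> real \<Rightarrow> real \<Rightarrow> real \<Rightarrow> real" where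
  "signal_const k b a g = (1 + k) * (k\<^sup>2 * g * (1 + b * a * g)) + a * g"

definition lip_const :: "real \<Rightarrow> real \<Rightarrow> real \<Rightarrow> real \<Rightarrow> real \<Rightarrow> real \<Rightarrow> real" where
  "lip_const w G k b a g = G * signal_const k b a g * ((1 + k) * k\<^sup>2 * b * g + 1) * w\<^sup>2"

text \<open>The factor 2 here and in \<open>bench_const\<close> pays for replacing
  \<open>T + 1\<close> rounds by \<open>2 * T\<close>; the 4 in \<open>mix_const\<close> also
  contains the 2 from the diameter of the policy set.\<close>

definition track_const :: "real \<Rightarrow> real \<Rightarrow> real \<Rightarrow> real \<Rightarrow> real \<Rightarrow> real \<Rightarrow> real" where
  "track_const w G k b a g = 2 * G * signal_const k b a g * w\<^sup>2 * (1 + k) * k\<^sup>2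
     * (b * lip_const w G k b a g * g\<^sup>2 + (1 + b * a * g) * g)"

definition bench_const :: "real \<Rightarrow> real \<Rightarrow> real \<Rightarrow> real \<Rightarrow> real \<Rightarrow> real \<Rightarrow> real" where
  "bench_const w G k b a g = 2 * G * signal_const k b a g * w\<^sup>2 * (1 + k) * (k\<^sup>2 + 2 * k ^ 6) * g"

definition mix_const :: "real \<Rightarrow> real \<Rightarrow> real \<Rightarrow> real \<Rightarrow> real \<Rightarrow> real \<Rightarrow> real" where
  "mix_const w G k b a g = 4 * lip_const w G k b a g * a * g * (1 + 2 * k ^ 7 * g * w)"

text \<open>After the three error terms come the two parts of the descent bound. The last summand is
  the trivial bound for horizons shorter than the memory.\<close>

definition regret_const :: "real \<Rightarrow> real \<Rightarrow> real \<Rightarrow> real \<Rightarrow> real \<Rightarrow> real \<Rightarrow> real" where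
  "regret_const w G k b a g = track_const w G k b a g + bench_const w G k b a g + mix_const w G k b a g
     + (lip_const w G k b a g)\<^sup>2 + 2 * a\<^sup>2 * g\<^sup>2 + 2 * G * signal_const k b a g * w"

lemma polynomial_fun_regret_const:
  "polynomial_fun 6 (\<lambda>xs. regret_const (xs ! 0) (xs ! 1) (xs ! 2) (xs ! 3) (xs ! 4) (xs ! 5))"
  unfolding regret_const_def track_const_def bench_const_def mix_const_def lip_const_def signal_const_def
  by (intro polynomial_fun_intros) simp_all

section \<open>Comparison of rates\<close>

locale rates =
  fixes n m T H :: nat and \<gamma> \<eta> \<epsilon> \<epsilon>s :: real
  assumes pos: "1 \<le> n" "1 \<le> m" "1 \<le> H" and gamma: "\<gamma> \<le> 1" and eta: "0 < \<eta>" and eps: "0 \<le> \<epsilon>" "0 < \<epsilon>s"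
begin

abbreviation "\<rho> \<equiv> 1 - \<gamma>"
abbreviation "rate \<equiv> regret_rate n m T H \<gamma> \<eta> \<epsilon> \<epsilon>s"

lemma rho: "0 \<le> \<rho>" using gamma by simp

lemma real_pos: "1 \<le> real n" "1 \<le> real m" "1 \<le> real H"
  using pos by auto

lemma rate_ge:
  "real T * sqrt (real m ^ 2 * real n ^ 3) * real H ^ 2 * \<rho> ^ H \<le> rate" (is "?r1 \<le> _")
  "real T * real m * real n ^ 2 * real H ^ 3 * \<eta> \<le> rate" (is "?r2 \<le> _")
  "real m / \<eta> \<le> rate" (is "?r3 \<le> _")
  "real T * \<rho> ^ H * sqrt (real m ^ 2 * real n ^ 3 * real H ^ 5) / \<epsilon>s
    + \<epsilon> * real T * sqrt (real m ^ 2 * real n ^ 2 * real H ^ 3) / \<epsilon>s \<le> rate" (is "?r4 + ?r5 \<le> _")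
  "real T * real m * real n ^ 2 * real H ^ 3 * \<eta> + real m / \<eta> \<le> rate"
proof -
  have nn: "0 \<le> ?r1" "0 \<le> ?r2" "0 \<le> ?r3" "0 \<le> ?r4" "0 \<le> ?r5"
    using rho eta eps by simp_all
  have "rate = ?r1 + ?r2 + ?r3 + ?r4 + ?r5" by (simp add: regret_rate_def)
  with nn show "?r1 \<le> rate" "?r2 \<le> rate" "?r3 \<le> rate" "?r4 + ?r5 \<le> rate" "?r2 + ?r3 \<le> rate"
    by simp_all
qed

lemma rate_nonneg: "0 \<le> rate"
proof -
  have "0 \<le> real m / \<eta>" using eta by simp
  then show ?thesis using rate_ge(3) by linarith
qed

lemma rate_drift: "real T * \<eta> * (real n)\<^sup>2 * (real H)\<^sup>2 \<le> rate"
proof -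
  have "1 * (real H)\<^sup>2 \<le> real m * real H ^ 3"
    using real_pos by (intro mult_mono power_increasing) auto
  then have "(real T * \<eta> * (real n)\<^sup>2) * (1 * (real H)\<^sup>2) \<le> (real T * \<eta> * (real n)\<^sup>2) * (real m * real H ^ 3)"
    using eta by (intro mult_left_mono) auto
  also have "\<dots> = real T * real m * real n ^ 2 * real H ^ 3 * \<eta>" by (simp add: mult_ac)
  finally show ?thesis using rate_ge(2) by simp
qed

lemma rate_truncation: "real T * real n * real H * \<rho> ^ H \<le> rate" "real T * real n * \<rho> ^ H \<le> rate"
proof -
  have "1 * (real n)\<^sup>2 \<le> real m ^ 2 * real n ^ 3"
    using real_pos by (intro mult_mono power_increasing one_le_power) auto
  then have s: "real n \<le> sqrt (real m ^ 2 * real n ^ 3)" by (intro real_le_rsqrt) simp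
  have h: "real H \<le> real H ^ 2" using real_pos by (simp add: power2_eq_square)
  have "real T * real n * real H * \<rho> ^ H \<le> real T * sqrt (real m ^ 2 * real n ^ 3) * real H ^ 2 * \<rho> ^ H"
    using rho s h by (intro mult_right_mono mult_mono mult_left_mono) auto
  then show 1: "real T * real n * real H * \<rho> ^ H \<le> rate" using rate_ge(1) by linarith
  have "real T * real n * 1 * \<rho> ^ H \<le> real T * real n * real H * \<rho> ^ H"
    using rho real_pos by (intro mult_right_mono mult_left_mono) auto
  then show "real T * real n * \<rho> ^ H \<le> rate" using 1 by simp
qed

text \<open>Splitting the mixture weight, the share of \<epsilon> falls under the last term of the
  rate and the imitation error under the one before. The radicals are compared by squaring, where
  spare powers of \<open>m\<close> and \<open>H\<close>, all at least 1, are given away.\<close>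

lemma rate_mixture:
  assumes "0 \<le> d"
  shows "real T * (real n * real H) * ((\<epsilon> + d * (real H * \<rho> ^ H * sqrt (real n))) / \<epsilon>s) * sqrt (real m) \<le> (1 + d) * rate"
proof -
  have "(real n * real H * sqrt (real m))\<^sup>2 = real m ^ 1 * real n ^ 2 * real H ^ 2"
    by (simp add: power_mult_distrib)
  also have "\<dots> \<le> real m ^ 2 * real n ^ 2 * real H ^ 3"
    using real_pos by (intro mult_mono power_increasing) auto
  finally have s1: "real n * real H * sqrt (real m) \<le> sqrt (real m ^ 2 * real n ^ 2 * real H ^ 3)"
    by (rule real_le_rsqrt)
  have "(real n * real H * sqrt (real m) * (real H * sqrt (real n)))\<^sup>2 = real m ^ 1 * real n ^ 3 * real H ^ 4"
    by (simp add: power_mult_distrib) (simp add: power2_eq_square power3_eq_cube power4_eq_xxxx)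
  also have "\<dots> \<le> real m ^ 2 * real n ^ 3 * real H ^ 5"
    using real_pos by (intro mult_mono power_increasing) auto
  finally have s2: "real n * real H * sqrt (real m) * (real H * sqrt (real n)) \<le> sqrt (real m ^ 2 * real n ^ 3 * real H ^ 5)"
    by (rule real_le_rsqrt)
  let ?r4 = "real T * \<rho> ^ H * sqrt (real m ^ 2 * real n ^ 3 * real H ^ 5) / \<epsilon>s"
  let ?r5 = "\<epsilon> * real T * sqrt (real m ^ 2 * real n ^ 2 * real H ^ 3) / \<epsilon>s"
  have r: "0 \<le> ?r4" "0 \<le> ?r5" using rho eps by simp_all
  have "real T * (real n * real H) * ((\<epsilon> + d * (real H * \<rho> ^ H * sqrt (real n))) / \<epsilon>s) * sqrt (real m)
      = \<epsilon> * real T * (real n * real H * sqrt (real m)) / \<epsilon>s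
        + d * (real T * \<rho> ^ H * (real n * real H * sqrt (real m) * (real H * sqrt (real n))) / \<epsilon>s)"
    by (simp add: add_divide_distrib algebra_simps)
  also have "\<dots> \<le> ?r5 + d * ?r4"
    using s1 s2 rho eps assms by (intro add_mono mult_left_mono divide_right_mono) auto
  also have "\<dots> \<le> (1 + d) * (?r4 + ?r5)"
  proof -
    have "y + d * z \<le> (1 + d) * (z + y)" if "0 \<le> y" "0 \<le> z" for y z :: real
      using mult_nonneg_nonneg[OF assms that(1)] that by (simp add: algebra_simps)
    then show ?thesis using r by blast
  qed
  also have "\<dots> \<le> (1 + d) * rate"
    using assms by (intro mult_left_mono rate_ge(4)) auto
  finally show ?thesis .
qed

text \<open>Over a horizon shorter than the memory, safety of the benchmark does not extend to the memory
  window. Then the arithmetic-geometric mean inequality between the terms in \<open>\<eta>\<close> and \<open>1 / \<eta>\<close>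
  shows that the rate dominates the trivial bound.\<close>

lemma rate_short_horizon:
  assumes "T \<le> H"
  shows "real T * sqrt (real n) \<le> rate"
proof -
  define X where "X = real T * real n ^ 2 * real H ^ 3"
  have X: "0 \<le> X" by (simp add: X_def)
  have "(real T * sqrt (real n))\<^sup>2 = real T * (real n ^ 1 * real T)"
    by (simp add: power_mult_distrib power2_eq_square)
  also have "\<dots> \<le> real T * (real n ^ 2 * real H ^ 3)"
  proof (intro mult_left_mono mult_mono power_increasing)
    have "real T \<le> real H ^ 1" using assms by simp
    also have "\<dots> \<le> real H ^ 3" using real_pos by (intro power_increasing) auto
    finally show "real T \<le> real H ^ 3" .
  qed (use real_pos in auto)
  also have "\<dots> = X" by (simp add: X_def)
  finally have "real T * sqrt (real n) \<le> sqrt X" by (rule real_le_rsqrt)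
  also have "\<dots> \<le> X * \<eta> + 1 / \<eta>"
  proof -
    have "0 \<le> (sqrt X * \<eta> - 1)\<^sup>2" by simp
    also have "\<dots> = X * \<eta>\<^sup>2 + 1 - 2 * (sqrt X * \<eta>)"
      using X by (simp add: power2_diff power_mult_distrib)
    finally have "sqrt X * \<eta> \<le> X * \<eta>\<^sup>2 + 1" using mult_nonneg_nonneg[OF real_sqrt_ge_zero[OF X], of \<eta>] eta by linarith
    then have "sqrt X \<le> (X * \<eta>\<^sup>2 + 1) / \<eta>" using eta by (simp add: pos_le_divide_eq)
    then show ?thesis using eta by (simp add: add_divide_distrib power2_eq_square)
  qed
  also have "\<dots> \<le> real m * (X * \<eta> + 1 / \<eta>)"
    using X eta real_pos mult_right_mono[of 1 "real m" "X * \<eta> + 1 / \<eta>"] by simp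
  also have "\<dots> = real T * real m * real n ^ 2 * real H ^ 3 * \<eta> + real m / \<eta>"
    by (simp add: X_def algebra_simps)
  finally show ?thesis using rate_ge(5) by linarith
qed

end

section \<open>The regret bound\<close>

context ogd_control
begin

abbreviation "gi \<equiv> inverse \<gamma>"
abbreviation "sc \<equiv> signal_const \<kappa> \<kappa>B a gi"
abbreviation "lc \<equiv> lip_const (wbar S) G \<kappa> \<kappa>B a gi"
abbreviation "tc \<equiv> track_const (wbar S) G \<kappa> \<kappa>B a gi"
abbreviation "bc \<equiv> bench_const (wbar S) G \<kappa> \<kappa>B a gi"
abbreviation "mc \<equiv> mix_const (wbar S) G \<kappa> \<kappa>B a gi"
abbreviation "rc \<equiv> regret_const (wbar S) G \<kappa> \<kappa>B a gi"

lemma gi_pos: "0 < gi" using gamma_pos by simp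

lemma signal_gain_eq: "signal_gain = sc"
  by (simp add: signal_gain_def state_gain_def signal_const_def divide_inverse)

lemma wnorm_sq: "wnorm\<^sup>2 = real n * (wbar S)\<^sup>2"
  by (simp add: wnorm_def power_mult_distrib)

lemma Lip_eq: "Lip = lc * (real n * real H)"
proof -
  have "Lip = G * sc * lin_gain * real H * wnorm\<^sup>2"
    by (simp add: Lip_def signal_gain_eq power2_eq_square)
  also have "\<dots> = lc * (real n * real H)"
    unfolding wnorm_sq by (simp add: lip_const_def lin_gain_def divide_inverse)
  finally show ?thesis .
qed

lemma consts_nonneg: "0 \<le> sc" "0 \<le> lc" "0 \<le> tc" "0 \<le> bc" "0 \<le> mc"
proof -
  show sc: "0 \<le> sc" using signal_gain_nonneg by (simp add: signal_gain_eq)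
  show lc: "0 \<le> lc"
    using sc G_nonneg kappa_pos kappaB_ge1 gi_pos by (simp add: lip_const_def)
  show "0 \<le> tc" "0 \<le> bc" "0 \<le> mc"
    using sc lc G_nonneg kappa_pos kappaB_ge1 gi_pos a_pos wbar_nonneg
    by (simp_all add: track_const_def bench_const_def mix_const_def)
qed

lemma dap_error_eq: "dap_error H wnorm = 2 * \<kappa> ^ 6 * gi * wbar S * (real H * (1 - \<gamma>) ^ H * sqrt (real n))"
  by (simp add: dap_error_def wnorm_def divide_inverse)

context
  fixes \<epsilon>s :: real
  assumes T1: "1 \<le> T" and eps: "0 \<le> \<epsilon>" "0 < \<epsilon>s"
begin

interpretation rates n m T H \<gamma> \<eta> \<epsilon> \<epsilon>s
  using n_pos m_pos H1 gamma_le1 eta_pos eps by unfold_locales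

text \<open>There are \<open>T + 1\<close> rounds, whereas the rate terms they are compared with are
  proportional to \<open>T\<close>.\<close>

lemma rounds_le: "0 \<le> y \<Longrightarrow> real (Suc T) * y \<le> 2 * real T * y"
  using T1 by (intro mult_right_mono) auto

text \<open>The drift part carries \<eta> n^2 H^2: \<open>Lip\<close> contributes n H, the two
  factors \<open>wnorm\<close> another n, and the bound on the action of a policy difference another
  H.\<close>

lemma track_term: "real (Suc T) * (G * (signal_gain * wnorm) * ((1 + \<kappa>) * track_error)) \<le> tc * rate"
proof -
  let ?Q = "G * sc * (wbar S)\<^sup>2 * (1 + \<kappa>) * \<kappa>\<^sup>2"
  let ?p = "\<kappa>B * lc * gi\<^sup>2" and ?q = "(1 + \<kappa>B * a * gi) * gi"
  let ?P = "\<eta> * (real n)\<^sup>2 * (real H)\<^sup>2" and ?R = "real n * (1 - \<gamma>) ^ H"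
  have nn: "0 \<le> ?Q" "0 \<le> ?p" "0 \<le> ?q" "0 \<le> ?P" "0 \<le> ?R"
    using G_nonneg consts_nonneg kappa_pos kappaB_ge1 gi_pos a_pos eta_pos gamma_le1 by simp_all
  have te: "track_error = wnorm * \<kappa>\<^sup>2 * (?p * (\<eta> * real n * (real H)\<^sup>2) + ?q * (1 - \<gamma>) ^ H)"
    unfolding track_error_def Lip_eq by (simp add: divide_inverse power2_eq_square algebra_simps)
  have "G * (signal_gain * wnorm) * ((1 + \<kappa>) * track_error)
      = G * sc * (1 + \<kappa>) * \<kappa>\<^sup>2 * wnorm\<^sup>2 * (?p * (\<eta> * real n * (real H)\<^sup>2) + ?q * (1 - \<gamma>) ^ H)"
    unfolding te signal_gain_eq power2_eq_square[of wnorm] by (simp only: mult_ac)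
  also have "\<dots> = ?Q * (real n * (?p * (\<eta> * real n * (real H)\<^sup>2) + ?q * (1 - \<gamma>) ^ H))"
    unfolding wnorm_sq by (simp only: mult_ac)
  also have "real n * (?p * (\<eta> * real n * (real H)\<^sup>2) + ?q * (1 - \<gamma>) ^ H) = ?p * ?P + ?q * ?R"
    by (simp only: distrib_left power2_eq_square[of "real n"] mult_ac)
  finally have "real (Suc T) * (G * (signal_gain * wnorm) * ((1 + \<kappa>) * track_error))
      = real (Suc T) * (?Q * (?p * ?P + ?q * ?R))" by (rule arg_cong)
  also have "\<dots> \<le> 2 * real T * (?Q * (?p * ?P + ?q * ?R))"
    by (intro rounds_le mult_nonneg_nonneg[OF nn(1)] add_nonneg_nonneg
        mult_nonneg_nonneg[OF nn(2,4)] mult_nonneg_nonneg[OF nn(3,5)])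
  also have "\<dots> = 2 * ?Q * (?p * (real T * ?P) + ?q * (real T * ?R))"
    by (simp only: distrib_left mult_ac)
  also have "\<dots> \<le> 2 * ?Q * (?p * rate + ?q * rate)"
  proof (intro mult_left_mono add_mono)
    show "real T * ?P \<le> rate" using rate_drift by (simp only: mult.assoc)
    show "real T * ?R \<le> rate" using rate_truncation(2) by (simp only: mult.assoc)
  qed (use nn in simp_all)
  also have "\<dots> = tc * rate"
    unfolding track_const_def by (simp only: distrib_right distrib_left mult_ac)
  finally show ?thesis .
qed

lemma bench_term: "real (Suc T) * (G * (signal_gain * wnorm) * ((1 + \<kappa>) * bench_error)) \<le> bc * rate"
proof -
  let ?Q = "G * sc * (wbar S)\<^sup>2 * (1 + \<kappa>) * (\<kappa>\<^sup>2 + 2 * \<kappa> ^ 6) * gi"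
  let ?\<rho> = "(1 - \<gamma>) ^ H"
  have Q: "0 \<le> ?Q" and r: "0 \<le> ?\<rho>"
    using G_nonneg consts_nonneg kappa_pos gi_pos gamma_le1 by simp_all
  have "bench_error = wnorm * gi * (\<kappa>\<^sup>2 * (1 * ?\<rho>) + 2 * \<kappa> ^ 6 * (real H * ?\<rho>))"
    by (simp add: bench_error_def dap_error_def divide_inverse algebra_simps)
  \<comment> \<open>With \<open>1 \<le> H\<close> the truncation error is absorbed into the order of
    the imitation error.\<close>
  also have "\<dots> \<le> wnorm * gi * (\<kappa>\<^sup>2 * (real H * ?\<rho>) + 2 * \<kappa> ^ 6 * (real H * ?\<rho>))"
    using wnorm_nonneg gi_pos r real_pos by (intro mult_left_mono add_mono mult_right_mono) auto
  finally have "G * (signal_gain * wnorm) * ((1 + \<kappa>) * bench_error)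
      \<le> G * (signal_gain * wnorm) * ((1 + \<kappa>) * (wnorm * gi * (\<kappa>\<^sup>2 * (real H * ?\<rho>) + 2 * \<kappa> ^ 6 * (real H * ?\<rho>))))"
    using G_nonneg signal_gain_nonneg wnorm_nonneg kappa_pos by (intro mult_left_mono) auto
  also have "\<dots> = G * sc * (1 + \<kappa>) * (\<kappa>\<^sup>2 + 2 * \<kappa> ^ 6) * gi * wnorm\<^sup>2 * (real H * ?\<rho>)"
    unfolding signal_gain_eq power2_eq_square[of wnorm] by (simp only: distrib_right distrib_left mult_ac)
  also have "\<dots> = ?Q * (real n * (real H * ?\<rho>))"
    unfolding wnorm_sq by (simp only: mult_ac)
  finally have "real (Suc T) * (G * (signal_gain * wnorm) * ((1 + \<kappa>) * bench_error))
      \<le> real (Suc T) * (?Q * (real n * (real H * ?\<rho>)))" by (rule mult_left_mono) simp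
  also have "\<dots> \<le> 2 * real T * (?Q * (real n * (real H * ?\<rho>)))"
    using r by (intro rounds_le mult_nonneg_nonneg[OF Q]) simp
  also have "\<dots> = 2 * ?Q * (real T * real n * real H * ?\<rho>)" by (simp only: mult_ac)
  also have "\<dots> \<le> 2 * ?Q * rate"
    using Q by (intro mult_left_mono rate_truncation) auto
  also have "\<dots> = bc * rate" by (simp only: bench_const_def mult_ac)
  finally show ?thesis .
qed

lemma mix_term:
  "real (Suc T) * (Lip * ((\<epsilon> + \<kappa> * dap_error H wnorm) / \<epsilon>s * (2 * Mset_radius))) \<le> mc * rate"
proof -
  let ?d = "2 * \<kappa> ^ 7 * gi * wbar S"
  let ?l = "(\<epsilon> + ?d * (real H * (1 - \<gamma>) ^ H * sqrt (real n))) / \<epsilon>s"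
  have d: "0 \<le> ?d" using kappa_pos gi_pos wbar_nonneg by simp
  then have l: "0 \<le> ?l" using eps gamma_le1 by simp
  have Q: "0 \<le> lc * a * gi" using consts_nonneg a_pos gi_pos by simp
  have "\<kappa> * dap_error H wnorm = ?d * (real H * (1 - \<gamma>) ^ H * sqrt (real n))"
  proof -
    have "\<kappa> ^ 7 = \<kappa> * \<kappa> ^ 6" by (simp flip: power_Suc)
    then show ?thesis unfolding dap_error_eq by (simp only: mult_ac)
  qed
  then have "Lip * ((\<epsilon> + \<kappa> * dap_error H wnorm) / \<epsilon>s * (2 * Mset_radius))
      = 2 * (lc * a * gi) * ((real n * real H) * ?l * sqrt (real m))"
    unfolding Lip_eq Mset_radius_def by (simp only: divide_inverse[of a] mult_ac)
  then have "real (Suc T) * (Lip * ((\<epsilon> + \<kappa> * dap_error H wnorm) / \<epsilon>s * (2 * Mset_radius)))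
      = real (Suc T) * (2 * (lc * a * gi) * ((real n * real H) * ?l * sqrt (real m)))" by (rule arg_cong)
  also have "\<dots> \<le> 2 * real T * (2 * (lc * a * gi) * ((real n * real H) * ?l * sqrt (real m)))"
  proof (rule rounds_le)
    have "0 \<le> 2 * (lc * a * gi)" using Q by simp
    moreover have "0 \<le> real n * real H * ?l * sqrt (real m)" by (intro mult_nonneg_nonneg l) simp_all
    ultimately show "0 \<le> 2 * (lc * a * gi) * (real n * real H * ?l * sqrt (real m))"
      by (rule mult_nonneg_nonneg)
  qed
  also have "\<dots> = 4 * (lc * a * gi) * (real T * (real n * real H) * ?l * sqrt (real m))"
  proof -
    have "2 * p * (2 * q * (r * s * v)) = 4 * q * (p * r * s * v)" for p q r s v :: real by simp
    then show ?thesis .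
  qed
  also have "\<dots> \<le> 4 * (lc * a * gi) * ((1 + ?d) * rate)"
    using Q by (intro mult_left_mono rate_mixture[OF d]) auto
  also have "\<dots> = mc * rate" by (simp only: mix_const_def mult_ac)
  finally show ?thesis .
qed

lemma descent_term:
  "(2 * Mset_radius)\<^sup>2 / (2 * \<eta>) \<le> 2 * a\<^sup>2 * gi\<^sup>2 * rate"
  "\<eta> * Lip\<^sup>2 * real (Suc T) / 2 \<le> lc\<^sup>2 * rate"
proof -
  have "(2 * Mset_radius)\<^sup>2 / (2 * \<eta>) = 2 * a\<^sup>2 * gi\<^sup>2 * (real m / \<eta>)"
  proof -
    have "(2 * Mset_radius)\<^sup>2 = 4 * (a\<^sup>2 * gi\<^sup>2 * real m)"
      unfolding Mset_radius_def divide_inverse[of a] power_mult_distrib by simp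
    then show ?thesis by simp
  qed
  also have "\<dots> \<le> 2 * a\<^sup>2 * gi\<^sup>2 * rate" by (intro mult_left_mono rate_ge) simp
  finally show "(2 * Mset_radius)\<^sup>2 / (2 * \<eta>) \<le> 2 * a\<^sup>2 * gi\<^sup>2 * rate" .
  have "\<eta> * Lip\<^sup>2 * real (Suc T) / 2 = real (Suc T) * (\<eta> * Lip\<^sup>2 / 2)" by simp
  also have "\<dots> \<le> 2 * real T * (\<eta> * Lip\<^sup>2 / 2)" using eta_pos by (intro rounds_le) simp
  also have "\<dots> = lc\<^sup>2 * (real T * \<eta> * (real n)\<^sup>2 * (real H)\<^sup>2)"
    by (simp add: Lip_eq power_mult_distrib)
  also have "\<dots> \<le> lc\<^sup>2 * rate" by (intro mult_left_mono rate_drift) simp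
  finally show "\<eta> * Lip\<^sup>2 * real (Suc T) / 2 \<le> lc\<^sup>2 * rate" .
qed

end

lemma regret_le_rate:
  assumes eps: "0 \<le> \<epsilon>" "0 < \<epsilon>s" and Ks: "strongly_stable S Ks" "strictly_safe S \<epsilon>s Ks"
    and K': "K' \<in> benchmark S T"
  shows "(\<Sum>t\<le>T. c t (x t, u t)) - (\<Sum>t\<le>T. c t (lin_state S K' w t, lin_input S K' w t))
    \<le> rc * regret_rate n m T H \<gamma> \<eta> \<epsilon> \<epsilon>s"
proof -
  interpret rates n m T H \<gamma> \<eta> \<epsilon> \<epsilon>s
    using n_pos m_pos H1 gamma_le1 eta_pos eps by unfold_locales
  have rc: "rc * rate = tc * rate + bc * rate + mc * rate + lc\<^sup>2 * rate + 2 * a\<^sup>2 * gi\<^sup>2 * rate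
      + 2 * G * sc * wbar S * rate"
    by (simp only: regret_const_def distrib_right)
  have nn: "0 \<le> tc * rate" "0 \<le> bc * rate" "0 \<le> mc * rate" "0 \<le> lc\<^sup>2 * rate"
    "0 \<le> 2 * a\<^sup>2 * gi\<^sup>2 * rate" "0 \<le> 2 * G * sc * wbar S * rate"
    using consts_nonneg rate_nonneg G_nonneg wbar_nonneg by simp_all
  show ?thesis
  proof (cases "H \<le> T")
    case True
    then have T1: "1 \<le> T" using H1 by simp
    have 1: "(2 * Mset_radius)\<^sup>2 / (2 * \<eta>) + \<eta> * Lip\<^sup>2 * real (Suc T) / 2
      + real (Suc T) * (G * (signal_gain * wnorm) * ((1 + \<kappa>) * track_error)
        + Lip * ((\<epsilon> + \<kappa> * dap_error H wnorm) / \<epsilon>s * (2 * Mset_radius))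
        + G * (signal_gain * wnorm) * ((1 + \<kappa>) * bench_error))
      \<le> (2 * a\<^sup>2 * gi\<^sup>2 * rate + lc\<^sup>2 * rate) + (tc * rate + mc * rate + bc * rate)"
      unfolding distrib_left[of "real (Suc T)"]
      by (intro add_mono descent_term[OF T1 eps] track_term[OF T1 eps] mix_term[OF T1 eps] bench_term[OF T1 eps])
    have 2: "(2 * a\<^sup>2 * gi\<^sup>2 * rate + lc\<^sup>2 * rate) + (tc * rate + mc * rate + bc * rate) \<le> rc * rate"
    proof -
      have "p1 + p2 + (p3 + p4 + p5) \<le> p3 + p5 + p4 + p2 + p1 + p6" if "0 \<le> p6" for p1 p2 p3 p4 p5 p6 :: real
        using that by simp
      from this[OF nn(6)] show ?thesis unfolding rc .
    qed
    show ?thesis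
      by (rule order_trans[OF regret_against_benchmark[OF K' True Ks eps] order_trans[OF 1 2]])
  next
    case False
    have "strongly_stable S K'" using K' by (simp add: benchmark_def)
    note trivial = regret_trivial[OF this]
    have "2 * real T * (G * (signal_gain * wnorm)) = 2 * G * sc * wbar S * (real T * sqrt (real n))"
      unfolding wnorm_def signal_gain_eq by (simp only: mult_ac)
    also have "\<dots> \<le> 2 * G * sc * wbar S * rate"
      using False G_nonneg consts_nonneg wbar_nonneg by (intro mult_left_mono rate_short_horizon) auto
    also have "\<dots> \<le> rc * rate"
      unfolding rc using nn by (intro le_add_same_cancel2[THEN iffD2] add_nonneg_nonneg)
    finally show ?thesis by (rule order_trans[OF trivial])
  qed
qed

end

theorem theorem2:
  shows "\<exists>F. polynomial_fun 6 F \<and>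
    (\<forall>(S :: plant) (T :: nat) (c :: nat \<Rightarrow> rvec \<times> rvec \<Rightarrow> real) (G :: real) (\<epsilon>s :: real) (Kss :: rmat)
      (K :: rmat) (H :: nat) (\<epsilon> :: real) (\<eta> :: real) (M0 :: policy).
        plant_ok S \<and> costs_ok S T G c
      \<and> \<epsilon>s > 0 \<and> strongly_stable S Kss \<and> strictly_safe S \<epsilon>s Kss
      \<and> strongly_stable S K
      \<and> H \<ge> 1 \<and> (gamma S < 1 \<longrightarrow> real H \<ge> ln (2 * kappa S ^ 2) / ln (inverse (1 - gamma S)))
      \<and> \<eta> > 0 \<and> \<epsilon> \<ge> 0
      \<and> eps1 S H + eps2 S G \<eta> H \<le> \<epsilon> \<and> \<epsilon> \<le> \<epsilon>s - eps1 S H - eps3 S H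
      \<and> \<epsilon> < \<epsilon>s / 2 - eps1 S H - eps3 S H
      \<and> M0 \<in> Omega S K H \<epsilon>
      \<longrightarrow> regret S T c \<lparr>inK = K, inH = H, ineps = \<epsilon>, ineta = \<eta>, inM0 = M0\<rparr>
          \<le> ereal (F [wbar S, G, kappa S, kappaB S, acoef S, inverse (gamma S)]
              * regret_rate (dimx S) (dimu S) T H (gamma S) \<eta> \<epsilon> \<epsilon>s))"
proof (intro exI conjI allI impI)
  let ?F = "\<lambda>xs. regret_const (xs ! 0) (xs ! 1) (xs ! 2) (xs ! 3) (xs ! 4) (xs ! 5)"
  show "polynomial_fun 6 ?F" by (rule polynomial_fun_regret_const)
  fix S T c G \<epsilon>s Kss K H \<epsilon> \<eta> M0
  let ?I = "\<lparr>inK = K, inH = H, ineps = \<epsilon>, ineta = \<eta>, inM0 = M0\<rparr>"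
  let ?R = "?F [wbar S, G, kappa S, kappaB S, acoef S, inverse (gamma S)]
    * regret_rate (dimx S) (dimu S) T H (gamma S) \<eta> \<epsilon> \<epsilon>s"
  assume hyps: "plant_ok S \<and> costs_ok S T G c
      \<and> \<epsilon>s > 0 \<and> strongly_stable S Kss \<and> strictly_safe S \<epsilon>s Kss
      \<and> strongly_stable S K
      \<and> H \<ge> 1 \<and> (gamma S < 1 \<longrightarrow> real H \<ge> ln (2 * kappa S ^ 2) / ln (inverse (1 - gamma S)))
      \<and> \<eta> > 0 \<and> \<epsilon> \<ge> 0
      \<and> eps1 S H + eps2 S G \<eta> H \<le> \<epsilon> \<and> \<epsilon> \<le> \<epsilon>s - eps1 S H - eps3 S H
      \<and> \<epsilon> < \<epsilon>s / 2 - eps1 S H - eps3 S H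
      \<and> M0 \<in> Omega S K H \<epsilon>"
  show "regret S T c ?I \<le> ereal ?R"
    unfolding regret_def
  proof (rule SUP_least)
    fix w assume w: "w \<in> disturbances S"
    interpret ogd_control S T G c K H \<epsilon> \<eta> M0 w
      using hyps w by unfold_locales blast+
    let ?A = "\<Sum>t\<le>T. c t (ogd_state S c ?I w t, ogd_input S c ?I w t)"
    let ?B = "\<lambda>K'. \<Sum>t\<le>T. c t (lin_state S K' w t, lin_input S K' w t)"
    have "?A - ?B K' \<le> ?R" if "K' \<in> benchmark S T" for K'
      using regret_le_rate[OF _ _ _ _ that, of \<epsilon>s Kss] hyps by (simp add: I_def)
    \<comment> \<open>Bounding the infimum from below excludes the value minus infinity. For an
      empty benchmark it is plus infinity, and the difference is then minus infinity.\<close>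
    then have "ereal (?A - ?R) \<le> (INF K'\<in>benchmark S T. ereal (?B K'))"
      by (intro INF_greatest) (simp add: algebra_simps)
    then show "ereal ?A - (INF K'\<in>benchmark S T. ereal (?B K')) \<le> ereal ?R"
      by (cases "INF K'\<in>benchmark S T. ereal (?B K')") auto
  qed
qed

end
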